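(* Let $d,n\in\mathbb{N}$ (positive integers). The map $\Psi_{d,n}\colon \mathbb{P}_{d,n}\to\mathbb{X}_{d,n}$, $\Psi_{d,n}(P)=\sigma_J\big(PM_z|_{PH^2_d}\big)$, is continuous, where $\mathbb{P}_{d,n}$ carries the operator norm topology and $\mathbb{X}_{d,n}$ carries the topology of the symmetric distance $d_s$. Moreover, $\Psi_{d,n}$ restricts to a homeomorphism from $\mathbb{P}_{d,n}^0$, the subspace of those projections in $\mathbb{P}_{d,n}$ whose range is spanned by $n$ distinct kernel functions $k_{\lambda_1},\dots,k_{\lambda_n}$, onto $\mathbb{X}_{d,n}^0$, the configuration space of $n$ unordered distinct points of $\mathbb{B}_d$.
   Context: $\mathbb{B}_d$ is the open unit ball of $\mathbb{C}^d$. The Drury-Arveson space $H^2_d$ is the reproducing kernel Hilbert space of holomorphic functions on $\mathbb{B}_d$ with kernel $k(z,w)=\frac{1}{1-\langle z,w\rangle}$; $k_\lambda=k(\cdot,\lambda)$. $\mathcal{M}_d$ is its multiplier algebra, $M_f$ is multiplication by $f\in\mathcal{M}_d$, and $M_z=(M_{z_1},\dots,M_{z_d})$. $\mathbb{P}_{d,n}\subset B(H^2_d)$ is the set of orthogonal projections $P$ with $\dim(PH^2_d)=n$ and $PM_f^*P=M_f^*P$ for all $f\in\mathcal{M}_d$ (i.e. projections onto $n$-dimensional multiplier-coinvariant subspaces), with the norm topology. $PM_z|_{PH^2_d}$ denotes the commuting tuple $(PM_{z_1}|_{PH^2_d},\dots,PM_{z_d}|_{PH^2_d})$ on the $n$-dimensional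 space $PH^2_d$; it is jointly similar to a strict row contraction. The symmetrized polyball $\mathbb{X}_{d,n}=\mathbb{B}_d^n/S_n$ is the set of multisets of $n$ points of $\mathbb{B}_d$, written as formal sums $\sum_j m_j[\lambda_j]$ with $m_j\ge 0$, $\sum_j m_j=n$. $\mathbb{X}_{d,n}^0\subset\mathbb{X}_{d,n}$ consists of the multisets of $n$ distinct points. The pseudohyperbolic distance is $d_{ph}(z,w)=\|\varphi_z(w)\|$, where $\varphi_z$ is the involutive automorphism of $\mathbb{B}_d$ exchanging $z$ and $0$; explicitly $d_{ph}(z,w)^2=1-\frac{(1-\|z\|^2)(1-\|w\|^2)}{|1-\langle z,w\rangle|^2}$. The symmetric distance is $d_s([X],[Y])=\min_{\sigma\in S_n}\max_{1\le j\le n}d_{ph}(x_j,y_{\sigma(j)})$ for $X=(x_j)$, $Y=(y_j)$. For a commuting $d$-tuple $A$ of operators on an $n$-dimensional space, the joint spectrum is $\sigma(A)=\{\lambda\in\mathbb{C}^d:\bigcap_j\ker(A_j-\lambda_jI)\ne\{0\}\}$, the root subspaces are $R_\lambda(A)=\bigcap_{|\alpha|=n}\ker(A-\lambda I)^\alpha$ (with $(A-\lambda I)^\alpha=\prod_j(A_j-\lambda_jI)^{\alpha_j}$), and, if $A$ is jointly similar to a strict row contraction (so $\sigma(A)\subset\mathbb{B}_d$), $\sigma_J(A)=\sum_{\lambda\in\sigma(A)}\dim R_\lambda(A)\,[\lambda]\in\mathbb{X}_{d,n}$. *)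

theory Defs
  imports "HOL-Analysis.Analysis" "HOL-Library.Function_Algebras" "HOL-Library.Multiset"
    "HOL-Library.FuncSet" "HOL-Combinatorics.Permutations"
begin

section \<open>The complex vector space of complex-valued functions\<close>

definition fscale :: "complex \<Rightarrow> ('a \<Rightarrow> complex) \<Rightarrow> 'a \<Rightarrow> complex"
  where "fscale c f = (\<lambda>x. c * f x)"

interpretation cfun: vector_space "fscale :: complex \<Rightarrow> ('a \<Rightarrow> complex) \<Rightarrow> 'a \<Rightarrow> complex"
  by standard (auto simp: fscale_def algebra_simps fun_eq_iff)


section \<open>Reproducing kernel Hilbert spaces\<close>

text \<open>
  A space of functions on a set \<open>X\<close> is a set \<open>H\<close> of functions on the whole type that vanish
  off \<open>X\<close>, so that equality of functions is equality on \<open>X\<close>. The inner product \<open>ip\<close> is linear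
  in its first argument; only its values on \<open>H\<close> matter.
\<close>

definition fnorm :: "(('a \<Rightarrow> complex) \<Rightarrow> ('a \<Rightarrow> complex) \<Rightarrow> complex) \<Rightarrow> ('a \<Rightarrow> complex) \<Rightarrow> real"
  where "fnorm ip f = sqrt (Re (ip f f))"

definition inner_product_on ::
  "('a \<Rightarrow> complex) set \<Rightarrow> (('a \<Rightarrow> complex) \<Rightarrow> ('a \<Rightarrow> complex) \<Rightarrow> complex) \<Rightarrow> bool"
  where "inner_product_on H ip \<longleftrightarrow>
    (\<forall>f\<in>H. \<forall>g\<in>H. \<forall>h\<in>H. ip (f + g) h = ip f h + ip g h) \<and>
    (\<forall>c. \<forall>f\<in>H. \<forall>g\<in>H. ip (fscale c f) g = c * ip f g) \<and>
    (\<forall>f\<in>H. \<forall>g\<in>H. ip g f = cnj (ip f g)) \<and>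
    (\<forall>f\<in>H. f \<noteq> 0 \<longrightarrow> Re (ip f f) > 0)"

definition complete_on ::
  "('a \<Rightarrow> complex) set \<Rightarrow> (('a \<Rightarrow> complex) \<Rightarrow> ('a \<Rightarrow> complex) \<Rightarrow> complex) \<Rightarrow> bool"
  where "complete_on H ip \<longleftrightarrow>
    (\<forall>s :: nat \<Rightarrow> 'a \<Rightarrow> complex. range s \<subseteq> H \<and>
        (\<forall>e>0. \<exists>N. \<forall>i\<ge>N. \<forall>j\<ge>N. fnorm ip (s i - s j) < e)
      \<longrightarrow> (\<exists>f\<in>H. (\<lambda>i. fnorm ip (s i - f)) \<longlonglongrightarrow> 0))"

definition kernel_at :: "'a set \<Rightarrow> ('a \<Rightarrow> 'a \<Rightarrow> complex) \<Rightarrow> 'a \<Rightarrow> 'a \<Rightarrow> complex"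
  where "kernel_at X K w = (\<lambda>z. if z \<in> X then K z w else 0)"

definition rkhs :: "'a set \<Rightarrow> ('a \<Rightarrow> 'a \<Rightarrow> complex) \<Rightarrow> ('a \<Rightarrow> complex) set \<Rightarrow>
    (('a \<Rightarrow> complex) \<Rightarrow> ('a \<Rightarrow> complex) \<Rightarrow> complex) \<Rightarrow> bool"
  where "rkhs X K H ip \<longleftrightarrow>
    (\<forall>f\<in>H. \<forall>z. z \<notin> X \<longrightarrow> f z = 0) \<and> cfun.subspace H \<and>
    inner_product_on H ip \<and> complete_on H ip \<and>
    (\<forall>w\<in>X. kernel_at X K w \<in> H \<and> (\<forall>f\<in>H. ip f (kernel_at X K w) = f w))"


section \<open>Bounded operators and multipliers\<close>

text \<open>
  Operators on \<open>H\<close> are extensional functions, so that equal operators are equal as functions.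
\<close>

definition bounded_operators :: "('a \<Rightarrow> complex) set \<Rightarrow>
    (('a \<Rightarrow> complex) \<Rightarrow> ('a \<Rightarrow> complex) \<Rightarrow> complex) \<Rightarrow> (('a \<Rightarrow> complex) \<Rightarrow> 'a \<Rightarrow> complex) set"
  where "bounded_operators H ip = {T \<in> H \<rightarrow>\<^sub>E H.
    (\<forall>f\<in>H. \<forall>g\<in>H. T (f + g) = T f + T g) \<and>
    (\<forall>c. \<forall>f\<in>H. T (fscale c f) = fscale c (T f)) \<and>
    (\<exists>C. \<forall>f\<in>H. fnorm ip (T f) \<le> C * fnorm ip f)}"

definition op_dist :: "('a \<Rightarrow> complex) set \<Rightarrow> (('a \<Rightarrow> complex) \<Rightarrow> ('a \<Rightarrow> complex) \<Rightarrow> complex) \<Rightarrow>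
    (('a \<Rightarrow> complex) \<Rightarrow> 'a \<Rightarrow> complex) \<Rightarrow> (('a \<Rightarrow> complex) \<Rightarrow> 'a \<Rightarrow> complex) \<Rightarrow> real"
  where "op_dist H ip S T = (SUP f\<in>{f\<in>H. fnorm ip f \<le> 1}. fnorm ip (S f - T f))"

definition adjoint_on :: "('a \<Rightarrow> complex) set \<Rightarrow> (('a \<Rightarrow> complex) \<Rightarrow> ('a \<Rightarrow> complex) \<Rightarrow> complex) \<Rightarrow>
    (('a \<Rightarrow> complex) \<Rightarrow> 'a \<Rightarrow> complex) \<Rightarrow> ('a \<Rightarrow> complex) \<Rightarrow> 'a \<Rightarrow> complex"
  where "adjoint_on H ip T =
    (\<lambda>g\<in>H. THE h. h \<in> H \<and> (\<forall>f\<in>H. ip (T f) g = ip f h))"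

text \<open>
  Since the elements of \<open>H\<close> vanish off the underlying set, the values of a multiplier off that
  set are irrelevant. Boundedness of multiplication by \<open>\<phi>\<close> is automatic (closed graph theorem).
\<close>

definition multipliers :: "('a \<Rightarrow> complex) set \<Rightarrow> ('a \<Rightarrow> complex) set"
  where "multipliers H = {\<phi>. \<forall>f\<in>H. \<phi> * f \<in> H}"

definition mult_op :: "('a \<Rightarrow> complex) set \<Rightarrow> ('a \<Rightarrow> complex) \<Rightarrow> ('a \<Rightarrow> complex) \<Rightarrow> 'a \<Rightarrow> complex"
  where "mult_op H \<phi> = (\<lambda>f\<in>H. \<phi> * f)"


section \<open>The Drury-Arveson space\<close>

definition cdot :: "complex ^ 'd \<Rightarrow> complex ^ 'd \<Rightarrow> complex"
  where "cdot z w = (\<Sum>i\<in>UNIV. z $ i * cnj (w $ i))"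

abbreviation unit_ball :: "(complex ^ 'd) set"
  where "unit_ball \<equiv> ball 0 1"

definition da_kernel :: "complex ^ 'd \<Rightarrow> complex ^ 'd \<Rightarrow> complex"
  where "da_kernel z w = 1 / (1 - cdot z w)"

text \<open>
  A reproducing kernel Hilbert space is determined by its kernel, so \<open>H\<close> and the restriction of
  \<open>ip\<close> to \<open>H\<close> are unique; existence is proved at the end of this theory. The functions in \<open>H\<close> are
  automatically holomorphic on the ball, being locally uniform limits of linear combinations of
  the functions \<open>da_kernel _ w\<close>.
\<close>

definition drury_arveson_space :: "(complex ^ 'd \<Rightarrow> complex) set \<Rightarrow>
    ((complex ^ 'd \<Rightarrow> complex) \<Rightarrow> (complex ^ 'd \<Rightarrow> complex) \<Rightarrow> complex) \<Rightarrow> bool"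
  where "drury_arveson_space H ip \<longleftrightarrow> rkhs unit_ball da_kernel H ip"

definition coinvariant_projections :: "(complex ^ 'd \<Rightarrow> complex) set \<Rightarrow>
    ((complex ^ 'd \<Rightarrow> complex) \<Rightarrow> (complex ^ 'd \<Rightarrow> complex) \<Rightarrow> complex) \<Rightarrow> nat \<Rightarrow>
    ((complex ^ 'd \<Rightarrow> complex) \<Rightarrow> complex ^ 'd \<Rightarrow> complex) set"
  where "coinvariant_projections H ip n = {P \<in> bounded_operators H ip.
    compose H P P = P \<and> adjoint_on H ip P = P \<and>
    cfun.dim (P ` H) = n \<and>
    (\<forall>\<phi>\<in>multipliers H.
      compose H P (compose H (adjoint_on H ip (mult_op H \<phi>)) P)
        = compose H (adjoint_on H ip (mult_op H \<phi>)) P)}"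

definition kernel_span_projections :: "(complex ^ 'd \<Rightarrow> complex) set \<Rightarrow>
    ((complex ^ 'd \<Rightarrow> complex) \<Rightarrow> (complex ^ 'd \<Rightarrow> complex) \<Rightarrow> complex) \<Rightarrow> nat \<Rightarrow>
    ((complex ^ 'd \<Rightarrow> complex) \<Rightarrow> complex ^ 'd \<Rightarrow> complex) set"
  where "kernel_span_projections H ip n = {P \<in> coinvariant_projections H ip n.
    \<exists>L \<subseteq> unit_ball. finite L \<and> card L = n \<and>
      P ` H = cfun.span (kernel_at unit_ball da_kernel ` L)}"

definition compressed_tuple :: "(complex ^ 'd \<Rightarrow> complex) set \<Rightarrow>
    ((complex ^ 'd \<Rightarrow> complex) \<Rightarrow> complex ^ 'd \<Rightarrow> complex) \<Rightarrow>
    'd \<Rightarrow> (complex ^ 'd \<Rightarrow> complex) \<Rightarrow> complex ^ 'd \<Rightarrow> complex"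
  where "compressed_tuple H P j = (\<lambda>f\<in>P ` H. P (mult_op H (\<lambda>z. z $ j) f))"


section \<open>Joint spectrum of a commuting tuple\<close>

text \<open>
  In the following \<open>A\<close> is a commuting tuple of linear operators on a finite-dimensional space \<open>V\<close>
  of functions.
\<close>

definition shifted :: "('d \<Rightarrow> ('a \<Rightarrow> complex) \<Rightarrow> 'a \<Rightarrow> complex) \<Rightarrow> complex ^ 'd \<Rightarrow>
    'd \<Rightarrow> ('a \<Rightarrow> complex) \<Rightarrow> 'a \<Rightarrow> complex"
  where "shifted A l j f = A j f - fscale (l $ j) f"

definition joint_spectrum :: "('a \<Rightarrow> complex) set \<Rightarrow>
    ('d \<Rightarrow> ('a \<Rightarrow> complex) \<Rightarrow> 'a \<Rightarrow> complex) \<Rightarrow> (complex ^ 'd) set"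
  where "joint_spectrum V A = {l. (\<Inter>j. {f \<in> V. shifted A l j f = 0}) \<noteq> {0}}"

text \<open>
  The product defining a monomial in a commuting tuple is taken in a fixed, arbitrary order of
  the coordinates.
\<close>

definition coords :: "'d::finite list"
  where "coords = (SOME js. set js = UNIV \<and> distinct js)"

definition tuple_power :: "('d::finite \<Rightarrow> ('a \<Rightarrow> complex) \<Rightarrow> 'a \<Rightarrow> complex) \<Rightarrow> ('d \<Rightarrow> nat) \<Rightarrow>
    ('a \<Rightarrow> complex) \<Rightarrow> 'a \<Rightarrow> complex"
  where "tuple_power B \<alpha> = foldr (\<lambda>j T. (B j ^^ \<alpha> j) \<circ> T) coords id"

definition root_subspace :: "('a \<Rightarrow> complex) set \<Rightarrow>
    ('d \<Rightarrow> ('a \<Rightarrow> complex) \<Rightarrow> 'a \<Rightarrow> complex) \<Rightarrow> complex ^ 'd \<Rightarrow> ('a \<Rightarrow> complex) set"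
  where "root_subspace V A l =
    (\<Inter>\<alpha>\<in>{\<alpha>. (\<Sum>j\<in>UNIV. \<alpha> j) = cfun.dim V}. {f \<in> V. tuple_power (shifted A l) \<alpha> f = 0})"

definition spectral_multiset :: "('a \<Rightarrow> complex) set \<Rightarrow>
    ('d \<Rightarrow> ('a \<Rightarrow> complex) \<Rightarrow> 'a \<Rightarrow> complex) \<Rightarrow> (complex ^ 'd) multiset"
  where "spectral_multiset V A =
    (\<Sum>l\<in>joint_spectrum V A. replicate_mset (cfun.dim (root_subspace V A l)) l)"


section \<open>The symmetrized polyball\<close>

definition sym_polyball :: "nat \<Rightarrow> (complex ^ 'd) multiset set"
  where "sym_polyball n = {X. size X = n \<and> set_mset X \<subseteq> unit_ball}"

definition sym_polyball0 :: "nat \<Rightarrow> (complex ^ 'd) multiset set"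
  where "sym_polyball0 n = {X \<in> sym_polyball n. \<forall>x\<in>#X. count X x = 1}"

text \<open>The involutive automorphism of the ball exchanging \<open>a\<close> and \<open>0\<close>; for \<open>a = 0\<close> it is \<open>uminus\<close>.\<close>

definition ball_aut :: "complex ^ 'd \<Rightarrow> complex ^ 'd \<Rightarrow> complex ^ 'd"
  where "ball_aut a z =
    (let p = (cdot z a / cdot a a) *s a; s = complex_of_real (sqrt (1 - (norm a)\<^sup>2))
     in (1 / (1 - cdot z a)) *s (a - p - s *s (z - p)))"

definition d_ph :: "complex ^ 'd \<Rightarrow> complex ^ 'd \<Rightarrow> real"
  where "d_ph z w = norm (ball_aut z w)"

definition sym_dist_list :: "(complex ^ 'd) list \<Rightarrow> (complex ^ 'd) list \<Rightarrow> real"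
  where "sym_dist_list xs ys =
    Min ((\<lambda>\<sigma>. Max ((\<lambda>j. d_ph (xs ! j) (ys ! \<sigma> j)) ` {..<length xs})) ` {\<sigma>. \<sigma> permutes {..<length xs}})"

text \<open>The value does not depend on the chosen orderings of the two multisets.\<close>

definition sym_dist :: "(complex ^ 'd) multiset \<Rightarrow> (complex ^ 'd) multiset \<Rightarrow> real"
  where "sym_dist X Y = sym_dist_list (SOME xs. mset xs = X) (SOME ys. mset ys = Y)"


section \<open>The spaces and the map\<close>

text \<open>
  The locale \<open>Metric_space\<close> requires a distance to be nonnegative and symmetric also at arguments
  outside the carrier, hence the case distinction.
\<close>

definition dist_topology :: "'a set \<Rightarrow> ('a \<Rightarrow> 'a \<Rightarrow> real) \<Rightarrow> 'a topology"
  where "dist_topology M d =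
    Metric_space.mtopology M (\<lambda>x y. if x \<in> M \<and> y \<in> M then d x y else 0)"

definition projection_topology :: "(complex ^ 'd \<Rightarrow> complex) set \<Rightarrow>
    ((complex ^ 'd \<Rightarrow> complex) \<Rightarrow> (complex ^ 'd \<Rightarrow> complex) \<Rightarrow> complex) \<Rightarrow> nat \<Rightarrow>
    ((complex ^ 'd \<Rightarrow> complex) \<Rightarrow> complex ^ 'd \<Rightarrow> complex) topology"
  where "projection_topology H ip n = dist_topology (coinvariant_projections H ip n) (op_dist H ip)"

definition sym_polyball_topology :: "nat \<Rightarrow> (complex ^ 'd) multiset topology"
  where "sym_polyball_topology n = dist_topology (sym_polyball n) sym_dist"

definition Psi :: "(complex ^ 'd \<Rightarrow> complex) set \<Rightarrow>
    ((complex ^ 'd \<Rightarrow> complex) \<Rightarrow> complex ^ 'd \<Rightarrow> complex) \<Rightarrow> (complex ^ 'd) multiset"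
  where "Psi H P = spectral_multiset (P ` H) (compressed_tuple H P)"


section \<open>The pseudohyperbolic and the symmetric distance\<close>

lemma cdot_simps:
  "cdot (x + y) z = cdot x z + cdot y z" "cdot x (y + z) = cdot x y + cdot x z"
  "cdot (x - y) z = cdot x z - cdot y z" "cdot x (y - z) = cdot x y - cdot x z"
  "cdot (c *s x) y = c * cdot x y" "cdot x (c *s y) = cnj c * cdot x y"
  "cdot 0 x = 0" "cdot x 0 = 0" "cdot (- x) y = - cdot x y" "cdot x (- y) = - cdot x y"
  by (simp_all add: cdot_def algebra_simps sum.distrib sum_subtractf sum_distrib_left sum_negf)

lemma cnj_cdot: "cnj (cdot x y) = cdot y x"
  by (simp add: cdot_def mult.commute)

lemma cdot_self: "cdot x x = complex_of_real ((norm x)\<^sup>2)"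
  by (simp add: cdot_def norm_vec_def L2_set_def sum_nonneg flip: complex_norm_square)

lemma cdot_self_eq_0 [simp]: "cdot x x = 0 \<longleftrightarrow> x = 0"
  by (simp add: cdot_self)

lemma norm_cdot_le: "norm (cdot x y) \<le> norm x * norm y"
proof -
  have "norm (cdot x y) \<le> (\<Sum>i\<in>UNIV. \<bar>norm (x $ i)\<bar> * \<bar>norm (y $ i)\<bar>)"
    unfolding cdot_def by (rule order_trans[OF norm_sum]) (simp add: norm_mult)
  also have "\<dots> \<le> norm x * norm y"
    unfolding norm_vec_def by (rule L2_set_mult_ineq)
  finally show ?thesis .
qed

lemma norm_cdot_less_1:
  assumes "x \<in> unit_ball" "y \<in> unit_ball"
  shows "norm (cdot x y) < 1"
proof -
  have "norm x * norm y \<le> norm x * 1"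
    using assms by (intro mult_left_mono) auto
  also have "\<dots> < 1" using assms by simp
  finally show ?thesis using norm_cdot_le[of x y] by linarith
qed

lemma one_minus_cdot_neq_0:
  assumes "x \<in> unit_ball" "y \<in> unit_ball"
  shows "1 - cdot x y \<noteq> 0"
  using norm_cdot_less_1[OF assms] by force

lemma one_minus_cdot_ball_aut:
  assumes "a \<in> unit_ball" "z \<in> unit_ball" "w \<in> unit_ball"
  shows "1 - cdot (ball_aut a z) (ball_aut a w) =
    (1 - cdot a a) * (1 - cdot z w) / ((1 - cdot z a) * (1 - cdot a w))"
proof (cases "a = 0")
  case True
  then show ?thesis by (simp add: ball_aut_def cdot_simps)
next
  case False
  define s where "s = complex_of_real (sqrt (1 - (norm a)\<^sup>2))"
  have na: "norm a < 1" using assms by simp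
  then have "(norm a)\<^sup>2 \<le> 1" by (simp add: power_le_one)
  then have s: "s * cnj s = 1 - cdot a a"
    by (simp add: s_def cdot_self flip: of_real_mult)
  have nz: "1 - cdot z a \<noteq> 0" "1 - cdot a w \<noteq> 0" "1 - cdot w a \<noteq> 0" "cdot a a \<noteq> 0"
    using one_minus_cdot_neq_0[OF assms(2,1)] one_minus_cdot_neq_0[OF assms(1,3)]
      one_minus_cdot_neq_0[OF assms(3,1)] False by auto
  define p where "p x = (cdot x a / cdot a a) *s a" for x
  define N where "N x = a - p x - s *s (x - p x)" for x
  have cr: "cnj (cdot a a) = cdot a a" by (simp add: cnj_cdot)
  have pp: "cdot (p x) (p y) = cdot x a * cdot a y / cdot a a" "cdot (p x) y = cdot x a * cdot a y / cdot a a" 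
    "cdot x (p y) = cdot x a * cdot a y / cdot a a" "cdot a (p y) = cdot a y" "cdot (p x) a = cdot x a" for x y
    using nz by (simp_all add: p_def cdot_simps cnj_cdot)
  have 1: "cdot (N z) (N w) = cdot a a - cdot a w - cdot z a + cdot z a * cdot a w / cdot a a
     + (s * cnj s) * (cdot z w - cdot z a * cdot a w / cdot a a)"
    unfolding N_def cdot_simps pp using False by (simp add: field_simps)
  have 2: "cdot (N z) (N w) = cdot a a - cdot a w - cdot z a + cdot z a * cdot a w
     + (1 - cdot a a) * cdot z w"
    unfolding 1 s using nz by (simp add: field_simps)
  have 3: "ball_aut a x = (1 / (1 - cdot x a)) *s N x" for x
    by (simp add: ball_aut_def N_def p_def s_def Let_def)
  have 4: "cdot (ball_aut a z) (ball_aut a w) = cdot (N z) (N w) / ((1 - cdot z a) * (1 - cdot a w))"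
    unfolding 3 cdot_simps by (simp add: cnj_cdot)
  have "1 - cdot (ball_aut a z) (ball_aut a w) =
    ((1 - cdot z a) * (1 - cdot a w) - cdot (N z) (N w)) / ((1 - cdot z a) * (1 - cdot a w))"
    unfolding 4 using nz by (simp add: diff_divide_distrib)
  also have "((1 - cdot z a) * (1 - cdot a w) - cdot (N z) (N w)) = (1 - cdot a a) * (1 - cdot z w)"
    unfolding 2 by (simp add: algebra_simps)
  finally show ?thesis .
qed

lemma d_ph_squared:
  assumes "z \<in> unit_ball" "w \<in> unit_ball"
  shows "(d_ph z w)\<^sup>2 = 1 - (1 - (norm z)\<^sup>2) * (1 - (norm w)\<^sup>2) / (norm (1 - cdot z w))\<^sup>2"
proof -
  have "1 - cdot w z = cnj (1 - cdot z w)" by (simp add: cnj_cdot)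
  then have "(1 - cdot w z) * (1 - cdot z w) = complex_of_real ((norm (1 - cdot z w))\<^sup>2)"
    by (metis complex_norm_square mult.commute of_real_power)
  then have "complex_of_real (1 - (d_ph z w)\<^sup>2) =
     complex_of_real ((1 - (norm z)\<^sup>2) * (1 - (norm w)\<^sup>2) / (norm (1 - cdot z w))\<^sup>2)"
    using one_minus_cdot_ball_aut[OF assms(1,2,2)] by (simp add: cdot_self d_ph_def)
  then show ?thesis unfolding of_real_eq_iff by linarith
qed

lemma ball_aut_self: "a \<in> unit_ball \<Longrightarrow> ball_aut a a = 0"
  by (cases "a = 0") (auto simp: ball_aut_def cdot_simps)

lemma ball_aut_0: "ball_aut a 0 = a"
  by (simp add: ball_aut_def cdot_simps)

lemma d_ph_nonneg: "0 \<le> d_ph z w"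
  by (simp add: d_ph_def)

lemma d_ph_less_1:
  assumes "z \<in> unit_ball" "w \<in> unit_ball"
  shows "d_ph z w < 1"
proof -
  have "(norm z)\<^sup>2 < 1" "(norm w)\<^sup>2 < 1"
    using assms by (auto simp: power_less_one_iff)
  then have "(d_ph z w)\<^sup>2 < 1"
    using one_minus_cdot_neq_0[OF assms] d_ph_squared[OF assms] by simp
  then show ?thesis using d_ph_nonneg[of z w] by (simp add: power_less_one_iff)
qed

lemma ball_aut_in_ball: "a \<in> unit_ball \<Longrightarrow> z \<in> unit_ball \<Longrightarrow> ball_aut a z \<in> unit_ball"
  using d_ph_less_1[of a z] by (simp add: d_ph_def)

lemma d_ph_commute:
  assumes "z \<in> unit_ball" "w \<in> unit_ball"
  shows "d_ph z w = d_ph w z"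
proof -
  have "norm (1 - cdot w z) = norm (1 - cdot z w)"
    by (metis cnj_cdot complex_cnj_diff complex_cnj_one complex_mod_cnj)
  then have "(d_ph z w)\<^sup>2 = (d_ph w z)\<^sup>2"
    using assms by (simp add: d_ph_squared mult.commute del: mem_ball_0)
  then show ?thesis by (simp add: d_ph_nonneg)
qed

lemma d_ph_aut:
  assumes "a \<in> unit_ball" "z \<in> unit_ball" "w \<in> unit_ball"
  shows "d_ph (ball_aut a z) (ball_aut a w) = d_ph z w"
proof -
  have inv: "1 - (norm (ball_aut a x))\<^sup>2 = 
    (1 - (norm a)\<^sup>2) * (1 - (norm x)\<^sup>2) / (norm (1 - cdot a x))\<^sup>2" if "x \<in> unit_ball" for x
    using d_ph_squared[OF assms(1) that] by (simp add: d_ph_def)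
  have n: "norm (1 - cdot (ball_aut a z) (ball_aut a w)) = 
      (1 - (norm a)\<^sup>2) * norm (1 - cdot z w) / (norm (1 - cdot a z) * norm (1 - cdot a w))"
  proof -
    have "norm (1 - cdot z a) = norm (1 - cdot a z)"
      by (metis cnj_cdot complex_cnj_diff complex_cnj_one complex_mod_cnj)
    moreover have "norm (1 - cdot a a) = 1 - (norm a)\<^sup>2"
    proof -
      have "1 - cdot a a = complex_of_real (1 - (norm a)\<^sup>2)" by (simp add: cdot_self)
      moreover have "(norm a)\<^sup>2 \<le> 1" using assms by (simp add: power_le_one)
      ultimately show ?thesis by (simp only: norm_of_real)
    qed
    ultimately show ?thesis
      by (simp add: one_minus_cdot_ball_aut[OF assms] norm_mult norm_divide)
  qed
  have pos: "1 - (norm a)\<^sup>2 > 0" using assms by (simp add: power_less_one_iff)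
  have nz: "norm (1 - cdot a z) \<noteq> 0" "norm (1 - cdot a w) \<noteq> 0" "norm (1 - cdot z w) \<noteq> 0"
    using assms one_minus_cdot_neq_0 by auto
  define A where "A = 1 - (norm a)\<^sup>2"
  define p q r where "p = norm (1 - cdot a z)" and "q = norm (1 - cdot a w)" and "r = norm (1 - cdot z w)"
  have "(d_ph (ball_aut a z) (ball_aut a w))\<^sup>2 = (d_ph z w)\<^sup>2"
    unfolding d_ph_squared[OF ball_aut_in_ball[OF assms(1,2)] ball_aut_in_ball[OF assms(1,3)]]
      d_ph_squared[OF assms(2,3)] n inv[OF assms(2)] inv[OF assms(3)]
    unfolding A_def[symmetric] p_def[symmetric] q_def[symmetric] r_def[symmetric]
    using pos nz unfolding A_def[symmetric] p_def[symmetric] q_def[symmetric] r_def[symmetric]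
    by (simp add: divide_simps power2_eq_square)
  then show ?thesis by (simp add: d_ph_nonneg)
qed

lemma d_ph_le_add:
  assumes "x \<in> unit_ball" "y \<in> unit_ball"
  shows "d_ph x y \<le> norm x + norm y"
proof -
  define a b where "a = norm x" and "b = norm y"
  have ab: "0 \<le> a" "a < 1" "0 \<le> b" "b < 1" using assms by (auto simp: a_def b_def)
  have D: "norm (1 - cdot x y) \<le> 1 + a * b"
    using norm_triangle_ineq4[of 1 "cdot x y"] norm_cdot_le[of x y] by (simp add: a_def b_def)
  have D0: "0 < norm (1 - cdot x y)" using one_minus_cdot_neq_0[OF assms] by simp
  have "(1 - a\<^sup>2) * (1 - b\<^sup>2) \<ge> 0" using ab by (simp add: power_le_one)
  then have "(1 - a\<^sup>2) * (1 - b\<^sup>2) / (norm (1 - cdot x y))\<^sup>2 \<ge> (1 - a\<^sup>2) * (1 - b\<^sup>2) / (1 + a * b)\<^sup>2"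
    using D D0 ab by (intro divide_left_mono mult_pos_pos power_mono) (auto intro: add_pos_nonneg)
  moreover have "1 - (1 - a\<^sup>2) * (1 - b\<^sup>2) / (1 + a * b)\<^sup>2 = ((a + b) / (1 + a * b))\<^sup>2"
  proof -
    have "1 + a * b \<noteq> 0" using ab by (smt (verit) mult_nonneg_nonneg)
    then have "(1 - a\<^sup>2) * (1 - b\<^sup>2) / (1 + a * b)\<^sup>2 = ((1 + a * b)\<^sup>2 - (a + b)\<^sup>2) / (1 + a * b)\<^sup>2"
      by (intro arg_cong2[where f = "(/)"]) (auto simp: power2_eq_square algebra_simps)
    also have "\<dots> = 1 - ((a + b) / (1 + a * b))\<^sup>2"
      using \<open>1 + a * b \<noteq> 0\<close> by (simp add: diff_divide_distrib power_divide)
    finally show ?thesis by simp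
  qed
  ultimately have "(d_ph x y)\<^sup>2 \<le> ((a + b) / (1 + a * b))\<^sup>2"
    using d_ph_squared[OF assms] by (simp add: a_def b_def)
  then have "d_ph x y \<le> (a + b) / (1 + a * b)"
    by (rule power2_le_imp_le) (use ab in auto)
  also have "\<dots> \<le> a + b"
    using ab by (simp add: divide_le_eq mult_le_cancel_left1 add_pos_nonneg)
  finally show ?thesis by (simp add: a_def b_def)
qed

lemma d_ph_triangle:
  assumes "x \<in> unit_ball" "y \<in> unit_ball" "z \<in> unit_ball"
  shows "d_ph x z \<le> d_ph x y + d_ph y z"
proof -
  have "d_ph x z = d_ph (ball_aut y x) (ball_aut y z)"
    using assms by (simp add: d_ph_aut del: mem_ball_0)
  also have "\<dots> \<le> d_ph y x + d_ph y z"
    using d_ph_le_add[OF ball_aut_in_ball[OF assms(2,1)] ball_aut_in_ball[OF assms(2,3)]]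
    by (simp only: d_ph_def)
  finally show ?thesis using d_ph_commute assms by metis
qed

lemma d_ph_eq_0_iff:
  assumes "x \<in> unit_ball" "y \<in> unit_ball"
  shows "d_ph x y = 0 \<longleftrightarrow> x = y"
proof
  assume "d_ph x y = 0"
  then have "ball_aut x y = 0" by (simp add: d_ph_def)
  then have "d_ph (ball_aut x y) (ball_aut x x) = 0"
    by (simp add: d_ph_def ball_aut_self[OF assms(1)] ball_aut_0)
  then have 0: "d_ph y x = 0" using d_ph_aut[OF assms assms(1)] by simp
  have e: "(1 - (norm y)\<^sup>2) * (1 - (norm x)\<^sup>2) = (norm (1 - cdot y x))\<^sup>2"
    using d_ph_squared[OF assms(2,1)] 0 one_minus_cdot_neq_0[OF assms(2,1)] by (simp add: field_simps)
  have 1: "norm (1 - cdot y x) \<ge> 1 - norm (cdot y x)"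
    using norm_triangle_ineq2[of 1 "cdot y x"] by simp
  have r: "Re (cdot y x) = inner y x"
    by (simp add: cdot_def inner_vec_def inner_complex_def)
  show "x = y"
  proof -
    have "(1 - norm y * norm x)\<^sup>2 \<le> (norm (1 - cdot y x))\<^sup>2"
      using 1 norm_cdot_le[of y x] norm_cdot_less_1[OF assms(2,1)] assms
      by (intro power_mono) (auto intro: mult_le_one less_imp_le)
    then have "(norm y - norm x)\<^sup>2 \<le> 0"
      unfolding e[symmetric] by (simp add: power2_eq_square algebra_simps)
    then have n: "norm y = norm x" by simp
    have "(norm (1 - cdot y x))\<^sup>2 \<ge> (1 - inner y x)\<^sup>2"
      using abs_Re_le_cmod[of "1 - cdot y x"] r by (simp add: power2_le_iff_abs_le)
    then have "(1 - inner y x)\<^sup>2 \<le> (1 - (norm x)\<^sup>2)\<^sup>2" using e n by (simp add: power2_eq_square)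
    then have "1 - inner y x \<le> 1 - (norm x)\<^sup>2"
      using assms by (intro power2_le_imp_le[of "1 - inner y x"]) (auto simp: power_le_one)
    then have "inner (x - y) (x - y) \<le> 0"
      using n by (simp add: inner_diff inner_commute power2_norm_eq_inner norm_eq_sqrt_inner)
    then show ?thesis by (metis inner_eq_zero_iff inner_ge_zero order_antisym right_minus_eq)
  qed
qed (use assms in \<open>simp add: d_ph_def ball_aut_self\<close>)

lemma sym_dist_le_iff:
  assumes "X \<in> sym_polyball n" "Y \<in> sym_polyball n" "n \<ge> 1"
  shows "sym_dist X Y \<le> r \<longleftrightarrow> rel_mset (\<lambda>x y. d_ph x y \<le> r) X Y"
proof -
  define xs ys where "xs = (SOME xs. mset xs = X)" and "ys = (SOME ys. mset ys = Y)"
  have xs: "mset xs = X" and ys: "mset ys = Y"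
    unfolding xs_def ys_def by (rule someI_ex[OF ex_mset])+
  then have len: "length xs = n" "length ys = n"
    using assms(1,2) size_mset[of xs] size_mset[of ys] by (auto simp: sym_polyball_def)
  have "{\<sigma>. \<sigma> permutes {..<n}} \<noteq> {}" using permutes_id by blast
  then have 1: "sym_dist X Y \<le> r \<longleftrightarrow>
      (\<exists>\<sigma>. \<sigma> permutes {..<n} \<and> (\<forall>j<n. d_ph (xs ! j) (ys ! \<sigma> j) \<le> r))"
    unfolding sym_dist_def sym_dist_list_def xs_def[symmetric] ys_def[symmetric] len
    using assms(3) by (subst Min_le_iff) (auto simp: finite_permutations lessThan_empty_iff)
  show ?thesis
  proof
    assume "sym_dist X Y \<le> r"
    then obtain \<sigma> where \<sigma>: "\<sigma> permutes {..<n}" "\<forall>j<n. d_ph (xs ! j) (ys ! \<sigma> j) \<le> r" using 1 by blast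
    then have "list_all2 (\<lambda>x y. d_ph x y \<le> r) xs (permute_list \<sigma> ys)"
      by (simp add: list_all2_conv_all_nth len permute_list_nth)
    moreover have "mset (permute_list \<sigma> ys) = Y" using \<sigma> len ys by simp
    ultimately show "rel_mset (\<lambda>x y. d_ph x y \<le> r) X Y"
      unfolding rel_mset_def using xs by blast
  next
    assume "rel_mset (\<lambda>x y. d_ph x y \<le> r) X Y"
    then obtain xs' ys' where "mset xs' = X" "mset ys' = Y" "list_all2 (\<lambda>x y. d_ph x y \<le> r) xs' ys'"
      unfolding rel_mset_def by blast
    then obtain zs where zs: "list_all2 (\<lambda>x y. d_ph x y \<le> r) xs zs" "mset zs = Y"
      using list_all2_reorder_left_invariance[of _ xs' ys' xs] xs by auto
    then have "mset zs = mset ys" using ys by simp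
    then obtain \<sigma> where \<sigma>: "\<sigma> permutes {..<length ys}" "permute_list \<sigma> ys = zs"
      by (rule mset_eq_permutation)
    have "d_ph (xs ! j) (ys ! \<sigma> j) \<le> r" if "j < n" for j
    proof -
      have "d_ph (xs ! j) (zs ! j) \<le> r"
        using list_all2_nthD[OF zs(1)] that len(1) by simp
      then show ?thesis
        using permute_list_nth[OF \<sigma>(1), of j] that \<sigma>(2) len(2) by simp
    qed
    then show "sym_dist X Y \<le> r" unfolding 1 using \<sigma>(1) len by auto
  qed
qed

lemma Metric_space_restrict:
  assumes "\<And>x y. x \<in> M \<Longrightarrow> y \<in> M \<Longrightarrow> 0 \<le> d x y"
    and "\<And>x y. x \<in> M \<Longrightarrow> y \<in> M \<Longrightarrow> d x y = d y x"
    and "\<And>x y. x \<in> M \<Longrightarrow> y \<in> M \<Longrightarrow> d x y = 0 \<longleftrightarrow> x = y"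
    and "\<And>x y z. x \<in> M \<Longrightarrow> y \<in> M \<Longrightarrow> z \<in> M \<Longrightarrow> d x z \<le> d x y + d y z"
  shows "Metric_space M (\<lambda>x y. if x \<in> M \<and> y \<in> M then d x y else 0)"
  by (rule Metric_space.intro; simp add: assms(1,3,4); use assms(2) in blast)

lemma Metric_space_sym_polyball:
  assumes "n \<ge> 1"
  shows "Metric_space (sym_polyball n)
    (\<lambda>X Y :: (complex ^ 'd) multiset. if X \<in> sym_polyball n \<and> Y \<in> sym_polyball n then sym_dist X Y else 0)"
proof -
  have rel: "rel_mset (\<lambda>x y. d_ph x y \<le> sym_dist X Y) X Y"
    if "X \<in> sym_polyball n" "Y \<in> sym_polyball n" for X Y :: "(complex ^ 'd) multiset"
    using sym_dist_le_iff[OF that assms, of "sym_dist X Y"] by simp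
  have ball: "x \<in> unit_ball" if "X \<in> sym_polyball n" "x \<in># X" for X and x :: "complex ^ 'd"
    using that unfolding sym_polyball_def by blast
  have nonneg: "sym_dist X Y \<ge> 0"
    if XY: "X \<in> sym_polyball n" "Y \<in> sym_polyball n" for X Y :: "(complex ^ 'd) multiset"
  proof (rule ccontr)
    assume "\<not> ?thesis"
    then have "\<not> d_ph x y \<le> sym_dist X Y" for x y :: "complex ^ 'd"
      using d_ph_nonneg[of x y] by linarith
    then have "rel_mset (\<lambda>x y. False) X Y"
      using multiset.rel_mono_strong[OF rel[OF XY], of "\<lambda>x y. False"] by blast
    moreover have "size X = n" using XY by (simp add: sym_polyball_def)
    ultimately obtain xs ys :: "(complex ^ 'd) list"
      where "size (mset xs) = n" and *: "list_all2 (\<lambda>x y. False) xs ys"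
      unfolding rel_mset_def by blast
    then have "0 < length xs" using assms by simp
    then show False using list_all2_nthD[OF *] by blast
  qed
  have comm: "sym_dist Y X \<le> sym_dist X Y"
    if XY: "X \<in> sym_polyball n" "Y \<in> sym_polyball n" for X Y :: "(complex ^ 'd) multiset"
  proof -
    have "rel_mset (\<lambda>x y. d_ph x y \<le> sym_dist X Y)\<inverse>\<inverse> Y X"
      unfolding multiset.rel_conversep using rel[OF XY] by (rule conversepI)
    then have "rel_mset (\<lambda>x y. d_ph x y \<le> sym_dist X Y) Y X"
      by (rule multiset.rel_mono_strong)
        (use d_ph_commute[OF ball[OF XY(1)] ball[OF XY(2)]] in auto)
    then show ?thesis by (rule sym_dist_le_iff[OF XY(2,1) assms, THEN iffD2])
  qed
  have tri: "sym_dist X Z \<le> sym_dist X Y + sym_dist Y Z"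
    if XYZ: "X \<in> sym_polyball n" "Y \<in> sym_polyball n" "Z \<in> sym_polyball n"
    for X Y Z :: "(complex ^ 'd) multiset"
  proof -
    have "rel_mset (\<lambda>x y. y \<in># Y \<and> d_ph x y \<le> sym_dist X Y) X Y"
      by (rule multiset.rel_mono_strong[OF rel[OF XYZ(1,2)]]) auto
    then have "rel_mset ((\<lambda>x y. y \<in># Y \<and> d_ph x y \<le> sym_dist X Y) OO (\<lambda>x y. d_ph x y \<le> sym_dist Y Z)) X Z"
      unfolding multiset.rel_compp using rel[OF XYZ(2,3)] by (rule relcomppI)
    then have "rel_mset (\<lambda>x y. d_ph x y \<le> sym_dist X Y + sym_dist Y Z) X Z"
    proof (rule multiset.rel_mono_strong)
      fix x z assume "x \<in># X" "z \<in># Z"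
        "((\<lambda>x y. y \<in># Y \<and> d_ph x y \<le> sym_dist X Y) OO (\<lambda>x y. d_ph x y \<le> sym_dist Y Z)) x z"
      then obtain y where "y \<in># Y" "d_ph x y \<le> sym_dist X Y" "d_ph y z \<le> sym_dist Y Z" by blast
      then show "d_ph x z \<le> sym_dist X Y + sym_dist Y Z"
        using d_ph_triangle[OF ball[OF XYZ(1) \<open>x \<in># X\<close>] ball[OF XYZ(2)] ball[OF XYZ(3) \<open>z \<in># Z\<close>], of y]
        by linarith
    qed
    then show ?thesis by (rule sym_dist_le_iff[OF XYZ(1,3) assms, THEN iffD2])
  qed
  have zero: "sym_dist X Y = 0 \<longleftrightarrow> X = Y"
    if XY: "X \<in> sym_polyball n" "Y \<in> sym_polyball n" for X Y :: "(complex ^ 'd) multiset"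
  proof
    assume "sym_dist X Y = 0"
    have "rel_mset (=) X Y"
    proof (rule multiset.rel_mono_strong[OF rel[OF XY]])
      fix x y assume "x \<in># X" "y \<in># Y" "d_ph x y \<le> sym_dist X Y"
      then show "x = y"
        using d_ph_eq_0_iff[OF ball[OF XY(1)] ball[OF XY(2)], of x y] d_ph_nonneg[of x y]
          \<open>sym_dist X Y = 0\<close> by linarith
    qed
    then show "X = Y" by (simp add: multiset.rel_eq)
  next
    assume "X = Y"
    have "rel_mset (\<lambda>x y. d_ph x y \<le> 0) X X"
    proof (rule multiset.rel_refl_strong)
      fix z assume "z \<in># X"
      then show "d_ph z z \<le> 0"
        using d_ph_eq_0_iff[OF ball[OF XY(1)] ball[OF XY(1)], of z z] by simp
    qed
    then show "sym_dist X Y = 0"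
      using sym_dist_le_iff[OF XY assms, of 0] nonneg[OF XY] \<open>X = Y\<close> by simp
  qed
  show ?thesis
  proof (rule Metric_space_restrict)
    fix X Y :: "(complex ^ 'd) multiset"
    assume XY: "X \<in> sym_polyball n" "Y \<in> sym_polyball n"
    show "0 \<le> sym_dist X Y" by (rule nonneg[OF XY])
    show "sym_dist X Y = sym_dist Y X" by (rule order_antisym[OF comm[OF XY(2,1)] comm[OF XY]])
    show "sym_dist X Y = 0 \<longleftrightarrow> X = Y" by (rule zero[OF XY])
  qed (rule tri)
qed


section \<open>Inner product spaces of functions\<close>

context
  fixes H :: "('a \<Rightarrow> complex) set" and ip
  assumes ipo: "inner_product_on H ip" and sub: "cfun.subspace H"
begin

lemma ip_axioms:
  "\<And>f g h. f \<in> H \<Longrightarrow> g \<in> H \<Longrightarrow> h \<in> H \<Longrightarrow> ip (f + g) h = ip f h + ip g h"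
  "\<And>c f g. f \<in> H \<Longrightarrow> g \<in> H \<Longrightarrow> ip (fscale c f) g = c * ip f g"
  "\<And>f g. f \<in> H \<Longrightarrow> g \<in> H \<Longrightarrow> ip g f = cnj (ip f g)"
  "\<And>f. f \<in> H \<Longrightarrow> f \<noteq> 0 \<Longrightarrow> Re (ip f f) > 0"
proof -
  note * = ipo[unfolded inner_product_on_def]
  show "\<And>f g h. f \<in> H \<Longrightarrow> g \<in> H \<Longrightarrow> h \<in> H \<Longrightarrow> ip (f + g) h = ip f h + ip g h"
    by (rule *[THEN conjunct1, rule_format])
  show "\<And>c f g. f \<in> H \<Longrightarrow> g \<in> H \<Longrightarrow> ip (fscale c f) g = c * ip f g"
    by (rule *[THEN conjunct2, THEN conjunct1, rule_format])
  show "\<And>f g. f \<in> H \<Longrightarrow> g \<in> H \<Longrightarrow> ip g f = cnj (ip f g)"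
    by (rule *[THEN conjunct2, THEN conjunct2, THEN conjunct1, rule_format])
  show "\<And>f. f \<in> H \<Longrightarrow> f \<noteq> 0 \<Longrightarrow> Re (ip f f) > 0"
    by (rule *[THEN conjunct2, THEN conjunct2, THEN conjunct2, rule_format])
qed

lemmas ip_cnj = ip_axioms(3)

lemma ip_rules:
  assumes "f \<in> H" "g \<in> H" "h \<in> H"
  shows "ip (f + g) h = ip f h + ip g h" "ip (f - g) h = ip f h - ip g h"
    "ip (fscale c f) g = c * ip f g"
    "ip f (g + h) = ip f g + ip f h" "ip f (g - h) = ip f g - ip f h"
    "ip f (fscale c g) = cnj c * ip f g"
proof -
  note add = ip_axioms(1) and sc = ip_axioms(2) and cj = ip_axioms(3)
  have diff: "ip (f - g) h = ip f h - ip g h" if "f \<in> H" "g \<in> H" "h \<in> H" for f g h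
  proof -
    have "f - g = f + fscale (-1) g" by (simp add: fscale_def fun_eq_iff)
    moreover have m: "fscale (-1) g \<in> H" by (rule cfun.subspace_scale[OF sub that(2)])
    ultimately show ?thesis by (simp only: add[OF that(1) m that(3)] sc[OF that(2,3)]) simp
  qed
  have mem: "g + h \<in> H" "g - h \<in> H" "fscale c g \<in> H"
    by (rule cfun.subspace_add[OF sub] cfun.subspace_diff[OF sub] cfun.subspace_scale[OF sub] assms)+
  show "ip (f + g) h = ip f h + ip g h" "ip (f - g) h = ip f h - ip g h"
    "ip (fscale c f) g = c * ip f g"
    by (rule add[OF assms] diff[OF assms] sc[OF assms(1,2)])+
  show "ip f (g + h) = ip f g + ip f h"
    unfolding cj[OF mem(1) assms(1)] cj[OF assms(2,1)] cj[OF assms(3,1)] add[OF assms(2,3,1)] by simp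
  show "ip f (g - h) = ip f g - ip f h"
    unfolding cj[OF mem(2) assms(1)] cj[OF assms(2,1)] cj[OF assms(3,1)] diff[OF assms(2,3,1)] by simp
  show "ip f (fscale c g) = cnj c * ip f g"
    unfolding cj[OF mem(3) assms(1)] cj[OF assms(2,1)] sc[OF assms(2,1)] by simp
qed

lemma ip_zero: "f \<in> H \<Longrightarrow> ip 0 f = 0"
proof -
  assume f: "f \<in> H"
  have "ip (f - f) f = 0" using ip_rules(2)[OF f f f] by simp
  then show ?thesis by simp
qed

lemma ip_self_nonneg: "f \<in> H \<Longrightarrow> 0 \<le> Re (ip f f)"
  using ip_axioms(4)[of f] ip_zero[of f] by (cases "f = 0") (auto intro: less_imp_le)

lemma fnorm_nonneg: "f \<in> H \<Longrightarrow> 0 \<le> fnorm ip f"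
  using ip_self_nonneg by (simp add: fnorm_def)

lemma fnorm_squared: "f \<in> H \<Longrightarrow> (fnorm ip f)\<^sup>2 = Re (ip f f)"
  using ip_self_nonneg by (simp add: fnorm_def)

lemma ip_self: "f \<in> H \<Longrightarrow> ip f f = complex_of_real ((fnorm ip f)\<^sup>2)"
  using ip_cnj[of f f] by (simp add: fnorm_squared complex_eq_iff)

lemma fnorm_eq_0_iff: "f \<in> H \<Longrightarrow> fnorm ip f = 0 \<longleftrightarrow> f = 0"
  using ip_axioms(4)[of f] ip_zero[of 0] by (cases "f = 0") (auto simp: fnorm_def)

lemma fnorm_scale: 
  assumes "f \<in> H" shows "fnorm ip (fscale c f) = cmod c * fnorm ip f"
proof -
  have m: "fscale c f \<in> H" by (rule cfun.subspace_scale[OF sub], rule assms(1))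
  have "ip (fscale c f) (fscale c f) = (c * cnj c) * ip f f"
    using ip_rules(3)[OF assms m m] ip_rules(6)[OF assms assms assms] by simp
  also have "\<dots> = complex_of_real ((cmod c * fnorm ip f)\<^sup>2)"
    by (simp add: ip_self[OF assms] power_mult_distrib complex_norm_square[symmetric])
  finally show ?thesis
    by (simp add: fnorm_def[of ip "fscale c f"] abs_mult fnorm_nonneg[OF assms])
qed

lemma ip_Cauchy_Schwarz:
  assumes "f \<in> H" "g \<in> H"
  shows "cmod (ip f g) \<le> fnorm ip f * fnorm ip g"
proof (cases "g = 0")
  case True
  then show ?thesis using ip_cnj[of g f] ip_zero[OF assms(1)] assms fnorm_eq_0_iff[of g] by simp
next
  case False
  define c where "c = ip f g / ip g g"
  define G where "G = (fnorm ip g)\<^sup>2"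
  have G: "ip g g = complex_of_real G" "G > 0"
    using False assms by (auto simp: G_def ip_self fnorm_eq_0_iff)
  have cg: "fscale c g \<in> H" by (rule cfun.subspace_scale[OF sub], rule assms(2))
  have m: "f - fscale c g \<in> H" by (rule cfun.subspace_diff[OF sub assms(1) cg])
  have "ip (f - fscale c g) (f - fscale c g) =
      ip f f - cnj c * ip f g - (c * ip g f - c * cnj c * ip g g)"
    using ip_rules(2)[OF assms(1) cg m] ip_rules(5)[OF assms(1) assms(1) cg] ip_rules(5)[OF cg assms(1) cg]
      ip_rules(6)[OF assms(1,2,2)] ip_rules(3)[OF assms(2,1,1)] ip_rules(3)[OF assms(2) cg cg] ip_rules(6)[OF assms(2,2,2)]
    by (simp add: algebra_simps)
  also have "\<dots> = ip f f - ip f g * cnj (ip f g) / ip g g"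
    using G ip_cnj[OF assms] by (simp add: c_def)
  also have "\<dots> = complex_of_real ((fnorm ip f)\<^sup>2 - (cmod (ip f g))\<^sup>2 / G)"
    by (simp add: complex_norm_square[symmetric] ip_self[OF assms(1)] G)
  finally have "Re (ip (f - fscale c g) (f - fscale c g)) = (fnorm ip f)\<^sup>2 - (cmod (ip f g))\<^sup>2 / G"
    by simp
  then have "(cmod (ip f g))\<^sup>2 / G \<le> (fnorm ip f)\<^sup>2" using ip_self_nonneg[OF m] by linarith
  then have "(cmod (ip f g))\<^sup>2 \<le> (fnorm ip f * fnorm ip g)\<^sup>2"
    using G(2) by (simp add: divide_le_eq power_mult_distrib G_def)
  then show ?thesis by (rule power2_le_imp_le) (simp add: fnorm_nonneg assms)
qed

lemma fnorm_triangle: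
  assumes "f \<in> H" "g \<in> H"
  shows "fnorm ip (f + g) \<le> fnorm ip f + fnorm ip g"
proof -
  have m: "f + g \<in> H" by (rule cfun.subspace_add[OF sub assms])
  have "(fnorm ip (f + g))\<^sup>2 = (fnorm ip f)\<^sup>2 + (fnorm ip g)\<^sup>2 + 2 * Re (ip f g)"
    using ip_rules(1)[OF assms m] ip_rules(4)[OF assms(1) assms] ip_rules(4)[OF assms(2) assms] ip_cnj[OF assms]
    by (simp add: fnorm_squared m assms)
  also have "\<dots> \<le> (fnorm ip f + fnorm ip g)\<^sup>2"
    using ip_Cauchy_Schwarz[OF assms] complex_Re_le_cmod[of "ip f g"]
    by (simp add: power2_eq_square algebra_simps)
  finally show ?thesis by (rule power2_le_imp_le) (simp add: fnorm_nonneg assms)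
qed

lemma fnorm_diff_commute:
  assumes "f \<in> H" "g \<in> H"
  shows "fnorm ip (f - g) = fnorm ip (g - f)"
proof -
  have "g - f \<in> H" by (rule cfun.subspace_diff[OF sub assms(2,1)])
  moreover have "f - g = fscale (-1) (g - f)" by (simp add: fscale_def fun_eq_iff)
  ultimately show ?thesis using fnorm_scale[of "g - f" "-1"] by simp
qed

lemma fnorm_diff_triangle:
  assumes "f \<in> H" "g \<in> H" "h \<in> H"
  shows "fnorm ip (f - h) \<le> fnorm ip (f - g) + fnorm ip (g - h)"
  using fnorm_triangle[OF cfun.subspace_diff[OF sub assms(1,2)] cfun.subspace_diff[OF sub assms(2,3)]]
  by simp

lemma Metric_space_bounded_operators:
  assumes M: "M \<subseteq> bounded_operators H ip"
  shows "Metric_space M (\<lambda>S T. if S \<in> M \<and> T \<in> M then op_dist H ip S T else 0)"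
proof (rule Metric_space_restrict)
  let ?B = "{f \<in> H. fnorm ip f \<le> 1}"
  have mem: "T f \<in> H" if "T \<in> M" "f \<in> H" for T f
    using that M by (auto simp: bounded_operators_def)
  have zero: "(0 :: 'a \<Rightarrow> complex) \<in> H" by (rule cfun.subspace_0[OF sub])
  then have zB: "0 \<in> ?B" using fnorm_eq_0_iff[OF zero] by simp
  have bdd: "bdd_above ((\<lambda>f. fnorm ip (S f - T f)) ` ?B)" if ST: "S \<in> M" "T \<in> M" for S T
  proof -
    obtain C where C: "\<And>f. f \<in> H \<Longrightarrow> fnorm ip (S f) \<le> C * fnorm ip f"
      using ST M unfolding bounded_operators_def by blast
    obtain D where D: "\<And>f. f \<in> H \<Longrightarrow> fnorm ip (T f) \<le> D * fnorm ip f"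
      using ST M unfolding bounded_operators_def by blast
    have "fnorm ip (S f - T f) \<le> \<bar>C\<bar> + \<bar>D\<bar>" if f: "f \<in> ?B" for f
    proof -
      have fH: "f \<in> H" and f1: "fnorm ip f \<le> 1" using f by auto
      have "fnorm ip (S f - T f) \<le> fnorm ip (S f - 0) + fnorm ip (0 - T f)"
        by (rule fnorm_diff_triangle) (use mem ST fH zero in auto)
      also have "fnorm ip (0 - T f) = fnorm ip (T f - 0)"
        by (rule fnorm_diff_commute) (use mem ST fH zero in auto)
      finally have 1: "fnorm ip (S f - T f) \<le> fnorm ip (S f) + fnorm ip (T f)" by (simp only: diff_zero)
      have 2: "c * fnorm ip f \<le> \<bar>c\<bar>" for c
        using mult_mono[of c "\<bar>c\<bar>" "fnorm ip f" 1] fnorm_nonneg[OF fH] f1 by simp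
      show ?thesis using 1 C[OF fH] D[OF fH] 2[of C] 2[of D] by linarith
    qed
    then show ?thesis by (intro bdd_aboveI2) auto
  qed
  have upper: "fnorm ip (S f - T f) \<le> op_dist H ip S T" if "S \<in> M" "T \<in> M" "f \<in> ?B" for S T f
    unfolding op_dist_def using that by (intro cSUP_upper bdd) auto
  have least: "op_dist H ip S T \<le> r" if "\<And>f. f \<in> ?B \<Longrightarrow> fnorm ip (S f - T f) \<le> r" for S T r
    unfolding op_dist_def using that zB by (intro cSUP_least) auto
  show nonneg: "0 \<le> op_dist H ip S T" if ST: "S \<in> M" "T \<in> M" for S T
  proof -
    have "S 0 - T 0 \<in> H" by (rule cfun.subspace_diff[OF sub mem[OF ST(1) zero] mem[OF ST(2) zero]])
    then have "0 \<le> fnorm ip (S 0 - T 0)" by (rule fnorm_nonneg)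
    also have "\<dots> \<le> op_dist H ip S T" by (rule upper[OF ST zB])
    finally show ?thesis .
  qed
  show "op_dist H ip S T = op_dist H ip T S" if "S \<in> M" "T \<in> M" for S T
    unfolding op_dist_def
    by (rule arg_cong[of _ _ Sup], rule image_cong) (use mem that fnorm_diff_commute in auto)
  show "op_dist H ip S U \<le> op_dist H ip S T + op_dist H ip T U" if "S \<in> M" "T \<in> M" "U \<in> M" for S T U
  proof (rule least)
    fix f assume f: "f \<in> ?B"
    then have "fnorm ip (S f - U f) \<le> fnorm ip (S f - T f) + fnorm ip (T f - U f)"
      using mem that by (intro fnorm_diff_triangle) auto
    then show "fnorm ip (S f - U f) \<le> op_dist H ip S T + op_dist H ip T U"
      using upper[OF that(1,2) f] upper[OF that(2,3) f] by linarith
  qed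
  show "op_dist H ip S T = 0 \<longleftrightarrow> S = T" if ST: "S \<in> M" "T \<in> M" for S T
  proof
    assume 0: "op_dist H ip S T = 0"
    have ext: "S \<in> extensional H" "T \<in> extensional H"
      using ST M by (auto simp: bounded_operators_def PiE_def)
    show "S = T"
    proof (rule extensionalityI[OF ext])
      fix f assume f: "f \<in> H"
      define c where "c = complex_of_real (1 / (1 + fnorm ip f))"
      have n: "fnorm ip f \<ge> 0" by (rule fnorm_nonneg[OF f])
      have m: "fscale c f \<in> H" by (rule cfun.subspace_scale[OF sub], rule f)
      have "fnorm ip (fscale c f) = fnorm ip f / (1 + fnorm ip f)"
        unfolding fnorm_scale[OF f] c_def norm_of_real using n by simp
      also have "\<dots> \<le> 1" using n by simp
      finally have "fnorm ip (S (fscale c f) - T (fscale c f)) \<le> 0"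
        using upper[OF ST, of "fscale c f"] m 0 by simp
      moreover have d: "S (fscale c f) - T (fscale c f) \<in> H"
        by (rule cfun.subspace_diff[OF sub mem[OF ST(1) m] mem[OF ST(2) m]])
      ultimately have "S (fscale c f) - T (fscale c f) = 0"
        using fnorm_nonneg[OF d] fnorm_eq_0_iff[OF d] by linarith
      moreover have "S (fscale c f) = fscale c (S f)" "T (fscale c f) = fscale c (T f)"
        using ST M f unfolding bounded_operators_def by blast+
      moreover have "c \<noteq> 0" using n unfolding c_def of_real_eq_0_iff by simp
      ultimately show "S f = T f" by (simp add: fscale_def fun_eq_iff)
    qed
  next
    assume "S = T"
    then have "op_dist H ip S T \<le> 0"
      using fnorm_eq_0_iff[OF zero] by (intro least) simp
    then show "op_dist H ip S T = 0" using nonneg[OF ST] by linarith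
  qed
qed

end

lemma Metric_space_coinvariant_projections:
  assumes "drury_arveson_space H ip"
  shows "Metric_space (coinvariant_projections H ip n)
    (\<lambda>S T. if S \<in> coinvariant_projections H ip n \<and> T \<in> coinvariant_projections H ip n
      then op_dist H ip S T else 0)"
  using assms
  by (intro Metric_space_bounded_operators)
    (auto simp: drury_arveson_space_def rkhs_def coinvariant_projections_def)

lemma topspace_projection_topology:
  assumes "drury_arveson_space H ip"
  shows "topspace (projection_topology H ip n) = coinvariant_projections H ip n"
  unfolding projection_topology_def dist_topology_def
  by (rule Metric_space.topspace_mtopology[OF Metric_space_coinvariant_projections[OF assms]])

lemma topspace_sym_polyball_topology:
  assumes "n \<ge> 1"
  shows "topspace (sym_polyball_topology n) = sym_polyball n"
  unfolding sym_polyball_topology_def dist_topology_def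
  by (rule Metric_space.topspace_mtopology[OF Metric_space_sym_polyball[OF assms]])


section \<open>Existence of the Drury-Arveson space\<close>

definition l2_space :: "('i \<Rightarrow> complex) set"
  where "l2_space = {x. (\<lambda>i. (cmod (x i))\<^sup>2) summable_on UNIV}"

definition l2_ip :: "('i \<Rightarrow> complex) \<Rightarrow> ('i \<Rightarrow> complex) \<Rightarrow> complex"
  where "l2_ip x y = (\<Sum>\<^sub>\<infinity>i. x i * cnj (y i))"

lemma l2_subspace: "cfun.subspace l2_space"
proof (rule cfun.subspaceI)
  show "0 \<in> l2_space" by (simp add: l2_space_def)
next
  fix x y :: "'i \<Rightarrow> complex" assume x: "x \<in> l2_space" and y: "y \<in> l2_space"
  have "(cmod (x i + y i))\<^sup>2 \<le> 2 * (cmod (x i))\<^sup>2 + 2 * (cmod (y i))\<^sup>2" for i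
  proof -
    have "(cmod (x i + y i))\<^sup>2 \<le> (cmod (x i) + cmod (y i))\<^sup>2"
      by (simp add: norm_triangle_ineq power_mono)
    also have "\<dots> \<le> 2 * (cmod (x i))\<^sup>2 + 2 * (cmod (y i))\<^sup>2"
      using zero_le_power2[of "cmod (x i) - cmod (y i)"] by (simp add: power2_eq_square algebra_simps)
    finally show ?thesis .
  qed
  moreover have "(\<lambda>i. 2 * (cmod (x i))\<^sup>2 + 2 * (cmod (y i))\<^sup>2) summable_on UNIV"
    using x y by (intro summable_on_add summable_on_cmult_right) (simp_all add: l2_space_def)
  ultimately have "(\<lambda>i. (cmod (x i + y i))\<^sup>2) summable_on UNIV"
    by (intro summable_on_comparison_test[where g = "\<lambda>i. (cmod (x i + y i))\<^sup>2"]) auto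
  then show "x + y \<in> l2_space" by (simp add: l2_space_def)
next
  fix c and x :: "'i \<Rightarrow> complex" assume x: "x \<in> l2_space"
  have "(\<lambda>i. (cmod c)\<^sup>2 * (cmod (x i))\<^sup>2) summable_on UNIV"
    using x by (intro summable_on_cmult_right) (simp add: l2_space_def)
  then show "fscale c x \<in> l2_space"
    by (simp add: l2_space_def fscale_def norm_mult power_mult_distrib)
qed

lemma l2_mult_summable:
  assumes "x \<in> l2_space" "y \<in> l2_space"
  shows "(\<lambda>i. x i * cnj (y i)) summable_on UNIV"
proof (rule abs_summable_summable, rule summable_on_comparison_test)
  show "(\<lambda>i. (cmod (x i))\<^sup>2 + (cmod (y i))\<^sup>2) summable_on UNIV"
    using assms by (intro summable_on_add) (simp_all add: l2_space_def)
  show "norm (x i * cnj (y i)) \<le> (cmod (x i))\<^sup>2 + (cmod (y i))\<^sup>2" for i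
  proof -
    have "2 * (cmod (x i) * cmod (y i)) \<le> (cmod (x i))\<^sup>2 + (cmod (y i))\<^sup>2"
      using zero_le_power2[of "cmod (x i) - cmod (y i)"] by (simp add: power2_eq_square algebra_simps)
    moreover have "0 \<le> cmod (x i) * cmod (y i)" by simp
    ultimately have "cmod (x i) * cmod (y i) \<le> (cmod (x i))\<^sup>2 + (cmod (y i))\<^sup>2" by linarith
    then show ?thesis by (simp add: norm_mult)
  qed
qed simp

lemma l2_ip_self:
  assumes "x \<in> l2_space"
  shows "l2_ip x x = complex_of_real (\<Sum>\<^sub>\<infinity>i. (cmod (x i))\<^sup>2)"
proof -
  have "((\<lambda>i. (cmod (x i))\<^sup>2) has_sum (\<Sum>\<^sub>\<infinity>i. (cmod (x i))\<^sup>2)) UNIV"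
    using assms by (intro has_sum_infsum) (simp add: l2_space_def)
  then have "((\<lambda>i. complex_of_real ((cmod (x i))\<^sup>2)) has_sum complex_of_real (\<Sum>\<^sub>\<infinity>i. (cmod (x i))\<^sup>2)) UNIV"
    by (rule has_sum_of_real_iff[THEN iffD2])
  then show ?thesis
    unfolding l2_ip_def complex_norm_square[symmetric] by (rule infsumI)
qed

lemma fnorm_l2_squared: "x \<in> l2_space \<Longrightarrow> (fnorm l2_ip x)\<^sup>2 = (\<Sum>\<^sub>\<infinity>i. (cmod (x i))\<^sup>2)"
  by (simp add: fnorm_def l2_ip_self infsum_nonneg)

lemma l2_inner_product: "inner_product_on l2_space l2_ip"
  unfolding inner_product_on_def
proof (intro conjI ballI allI impI)
  fix f g h :: "'i \<Rightarrow> complex" assume "f \<in> l2_space" "g \<in> l2_space" "h \<in> l2_space"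
  then show "l2_ip (f + g) h = l2_ip f h + l2_ip g h"
    by (simp add: l2_ip_def algebra_simps infsum_add l2_mult_summable)
next
  fix c and f g :: "'i \<Rightarrow> complex"
  show "l2_ip (fscale c f) g = c * l2_ip f g"
    by (simp add: l2_ip_def fscale_def mult.assoc infsum_cmult_right')
next
  fix f g :: "'i \<Rightarrow> complex"
  show "l2_ip g f = cnj (l2_ip f g)"
    by (simp add: l2_ip_def mult.commute flip: infsum_cnj)
next
  fix f :: "'i \<Rightarrow> complex" assume f: "f \<in> l2_space" "f \<noteq> 0"
  then obtain i where i: "f i \<noteq> 0" by (auto simp: fun_eq_iff)
  have "sum (\<lambda>i. (cmod (f i))\<^sup>2) {i} \<le> (\<Sum>\<^sub>\<infinity>i. (cmod (f i))\<^sup>2)"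
    by (rule finite_sum_le_infsum) (use f in \<open>auto simp: l2_space_def\<close>)
  moreover have "0 < sum (\<lambda>i. (cmod (f i))\<^sup>2) {i}" using i by simp
  ultimately show "0 < Re (l2_ip f f)" unfolding l2_ip_self[OF f(1)] Re_complex_of_real by linarith
qed

lemma l2_complete: "complete_on l2_space l2_ip"
  unfolding complete_on_def
proof (intro allI impI, elim conjE)
  fix s :: "nat \<Rightarrow> 'i \<Rightarrow> complex"
  assume s: "range s \<subseteq> l2_space"
    and cauchy: "\<forall>e>0. \<exists>N. \<forall>i\<ge>N. \<forall>j\<ge>N. fnorm l2_ip (s i - s j) < e"
  have sm: "s i \<in> l2_space" for i using s by blast
  have dm: "s i - s j \<in> l2_space" for i j by (rule cfun.subspace_diff[OF l2_subspace sm sm])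
  have fin: "(\<Sum>k\<in>F. (cmod (s i k - s j k))\<^sup>2) \<le> (fnorm l2_ip (s i - s j))\<^sup>2" if "finite F" for F i j
  proof -
    have "(\<Sum>k\<in>F. (cmod ((s i - s j) k))\<^sup>2) \<le> (fnorm l2_ip (s i - s j))\<^sup>2"
      unfolding fnorm_l2_squared[OF dm]
      by (rule finite_sum_le_infsum) (use dm[of i j] that in \<open>auto simp: l2_space_def\<close>)
    then show ?thesis by simp
  qed
  have nn: "0 \<le> fnorm l2_ip (s i - s j)" for i j
    by (rule fnorm_nonneg[OF l2_inner_product l2_subspace dm])
  have "\<exists>L. (\<lambda>i. s i k) \<longlonglongrightarrow> L" for k
  proof -
    have "cmod (s i k - s j k) \<le> fnorm l2_ip (s i - s j)" for i j
      by (rule power2_le_imp_le[OF _ nn]) (use fin[of "{k}" i j] in simp)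
    then have "Cauchy (\<lambda>i. s i k)"
      unfolding Cauchy_def dist_norm using cauchy by (meson le_less_trans)
    then show ?thesis using Cauchy_convergent convergent_def by blast
  qed
  then obtain x where x: "\<And>k. (\<lambda>i. s i k) \<longlonglongrightarrow> x k" by metis
  have main: "\<exists>N. \<forall>i\<ge>N. s i - x \<in> l2_space \<and> fnorm l2_ip (s i - x) \<le> e" if e: "e > 0" for e
  proof -
    obtain N where N: "\<And>i j. i \<ge> N \<Longrightarrow> j \<ge> N \<Longrightarrow> fnorm l2_ip (s i - s j) < e" using cauchy e by blast
    have "s i - x \<in> l2_space \<and> fnorm l2_ip (s i - x) \<le> e" if i: "i \<ge> N" for i
    proof -
      have le: "(\<Sum>k\<in>F. (cmod ((s i - x) k))\<^sup>2) \<le> e\<^sup>2" if F: "finite F" for F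
      proof (rule LIMSEQ_le_const2)
        show "(\<lambda>j. \<Sum>k\<in>F. (cmod (s i k - s j k))\<^sup>2) \<longlonglongrightarrow> (\<Sum>k\<in>F. (cmod ((s i - x) k))\<^sup>2)"
          unfolding minus_apply by (intro tendsto_intros x)
        have "(\<Sum>k\<in>F. (cmod (s i k - s j k))\<^sup>2) \<le> e\<^sup>2" if "j \<ge> N" for j
          using fin[OF F, of i j] power_mono[OF less_imp_le[OF N[OF i that]] nn, of 2] by linarith
        then show "\<exists>M. \<forall>j\<ge>M. (\<Sum>k\<in>F. (cmod (s i k - s j k))\<^sup>2) \<le> e\<^sup>2" by blast
      qed
      have m: "s i - x \<in> l2_space"
        unfolding l2_space_def mem_Collect_eq
        by (rule nonneg_bdd_above_summable_on) (auto intro!: bdd_aboveI2 le simp del: minus_apply)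
      have "(fnorm l2_ip (s i - x))\<^sup>2 \<le> e\<^sup>2"
        unfolding fnorm_l2_squared[OF m]
        by (rule infsum_le_finite_sums) (use m le in \<open>auto simp: l2_space_def\<close>)
      then show ?thesis using m e by (auto intro: power2_le_imp_le)
    qed
    then show ?thesis by blast
  qed
  obtain N where "s N - x \<in> l2_space" using main[of 1] by auto
  then have "s N - (s N - x) \<in> l2_space" by (rule cfun.subspace_diff[OF l2_subspace sm])
  then have xm: "x \<in> l2_space" by simp
  have "(\<lambda>i. fnorm l2_ip (s i - x)) \<longlonglongrightarrow> 0"
  proof (rule LIMSEQ_I)
    fix r :: real assume "r > 0"
    then obtain N where N: "\<And>i. i \<ge> N \<Longrightarrow> s i - x \<in> l2_space \<and> fnorm l2_ip (s i - x) \<le> r / 2"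
      using main[of "r / 2"] by auto
    have "norm (fnorm l2_ip (s i - x) - 0) < r" if "i \<ge> N" for i
      using N[OF that] fnorm_nonneg[OF l2_inner_product l2_subspace, of "s i - x"] \<open>r > 0\<close> by auto
    then show "\<exists>N. \<forall>i\<ge>N. norm (fnorm l2_ip (s i - x) - 0) < r" by blast
  qed
  then show "\<exists>f\<in>l2_space. (\<lambda>i. fnorm l2_ip (s i - f)) \<longlonglongrightarrow> 0" using xm by blast
qed

text \<open>A feature map into a sequence space induces a reproducing kernel Hilbert space.\<close>

lemma rkhs_exists:
  fixes \<Phi> :: "'a \<Rightarrow> 'i \<Rightarrow> complex"
  assumes \<Phi>: "\<And>z. z \<in> X \<Longrightarrow> \<Phi> z \<in> l2_space"
    and K: "\<And>z w. z \<in> X \<Longrightarrow> w \<in> X \<Longrightarrow> K z w = l2_ip (\<Phi> w) (\<Phi> z)"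
  shows "\<exists>H ip. rkhs X K H ip"
proof -
  note rules = ip_rules[OF l2_inner_product l2_subspace]
  define S where "S = {x \<in> l2_space. \<forall>y\<in>l2_space. (\<forall>z\<in>X. l2_ip y (\<Phi> z) = 0) \<longrightarrow> l2_ip x y = 0}"
  define F where "F x = (\<lambda>z. if z \<in> X then l2_ip x (\<Phi> z) else 0)" for x
  define G where "G = inv_into S F"
  define H where "H = F ` S"
  define ip where "ip f g = l2_ip (G f) (G g)" for f g
  have Sl2: "x \<in> l2_space" if "x \<in> S" for x using that by (simp add: S_def)
  have Sorth: "l2_ip x y = 0" if "x \<in> S" "y \<in> l2_space" "\<And>z. z \<in> X \<Longrightarrow> l2_ip y (\<Phi> z) = 0" for x y
    using that by (simp add: S_def)
  have SI: "x \<in> S" if "x \<in> l2_space"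
    "\<And>y. y \<in> l2_space \<Longrightarrow> (\<And>z. z \<in> X \<Longrightarrow> l2_ip y (\<Phi> z) = 0) \<Longrightarrow> l2_ip x y = 0" for x
    using that by (simp add: S_def)
  have sub: "cfun.subspace S"
  proof (rule cfun.subspaceI)
    show "0 \<in> S"
      by (rule SI[OF cfun.subspace_0[OF l2_subspace] ip_zero[OF l2_inner_product l2_subspace]])
    show "x + y \<in> S" if "x \<in> S" "y \<in> S" for x y
      by (rule SI[OF cfun.subspace_add[OF l2_subspace Sl2[OF that(1)] Sl2[OF that(2)]]])
        (simp only: rules(1)[OF Sl2[OF that(1)] Sl2[OF that(2)]] Sorth[OF that(1)] Sorth[OF that(2)] add_0)
    show "fscale c x \<in> S" if "x \<in> S" for c x
      by (rule SI[OF cfun.subspace_scale[OF l2_subspace Sl2[OF that]]])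
        (simp only: rules(3)[OF Sl2[OF that] _ Sl2[OF that]] Sorth[OF that] mult_zero_right)
  qed
  have Fadd: "F (x + y) = F x + F y" if "x \<in> S" "y \<in> S" for x y
    using rules(1)[OF Sl2[OF that(1)] Sl2[OF that(2)] \<Phi>] by (simp add: F_def fun_eq_iff)
  have Fdiff: "F (x - y) = F x - F y" if "x \<in> S" "y \<in> S" for x y
    using rules(2)[OF Sl2[OF that(1)] Sl2[OF that(2)] \<Phi>] by (simp add: F_def fun_eq_iff)
  have Fscale: "F (fscale c x) = fscale c (F x)" if "x \<in> S" for c x
    using rules(3)[OF Sl2[OF that] \<Phi> Sl2[OF that]] by (simp add: F_def fun_eq_iff fscale_def)
  have inj: "inj_on F S"
  proof (rule inj_onI)
    fix x y assume xy: "x \<in> S" "y \<in> S" "F x = F y"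
    have d: "x - y \<in> S" by (rule cfun.subspace_diff[OF sub xy(1,2)])
    have "F (x - y) = 0" using Fdiff[OF xy(1,2)] xy(3) by simp
    then have "F (x - y) z = 0" for z by simp
    then have "l2_ip (x - y) (\<Phi> z) = 0" if "z \<in> X" for z
      using that unfolding F_def by metis
    then have "l2_ip (x - y) (x - y) = 0" by (rule Sorth[OF d Sl2[OF d]])
    then have "fnorm l2_ip (x - y) = 0" unfolding fnorm_def by simp
    then have "x - y = 0" using fnorm_eq_0_iff[OF l2_inner_product l2_subspace Sl2[OF d]] by blast
    then show "x = y" by simp
  qed
  have GF: "G (F x) = x" if "x \<in> S" for x
    unfolding G_def by (rule inv_into_f_f[OF inj that])
  have ipF: "ip (F x) (F y) = l2_ip x y" if "x \<in> S" "y \<in> S" for x y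
    by (simp only: ip_def GF[OF that(1)] GF[OF that(2)])
  have Hsub: "cfun.subspace H"
  proof (rule cfun.subspaceI)
    show "0 \<in> H"
    proof -
      have "F 0 = F (0 - 0)" by simp
      also have "\<dots> = 0" using Fdiff[OF cfun.subspace_0[OF sub] cfun.subspace_0[OF sub]] by simp
      finally show ?thesis unfolding H_def using cfun.subspace_0[OF sub] by (metis imageI)
    qed
    show "f + g \<in> H" if "f \<in> H" "g \<in> H" for f g
    proof -
      obtain x y where xy: "x \<in> S" "y \<in> S" "f = F x" "g = F y" using \<open>f \<in> H\<close> \<open>g \<in> H\<close> by (auto simp: H_def)
      show ?thesis unfolding xy(3,4) Fadd[OF xy(1,2), symmetric] H_def
        by (rule imageI, rule cfun.subspace_add[OF sub xy(1,2)])
    qed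
    show "fscale c f \<in> H" if "f \<in> H" for c f
    proof -
      obtain x where x: "x \<in> S" "f = F x" using \<open>f \<in> H\<close> by (auto simp: H_def)
      show ?thesis unfolding x(2) Fscale[OF x(1), symmetric] H_def
        by (rule imageI, rule cfun.subspace_scale[OF sub x(1)])
    qed
  qed
  have ipo: "inner_product_on H ip"
    unfolding inner_product_on_def H_def ball_simps
  proof (intro conjI ballI allI impI)
    fix x y z assume S: "x \<in> S" "y \<in> S" "z \<in> S"
    show "ip (F x + F y) (F z) = ip (F x) (F z) + ip (F y) (F z)"
      unfolding Fadd[OF S(1,2), symmetric] ipF[OF S(1,3)] ipF[OF S(2,3)] ipF[OF cfun.subspace_add[OF sub S(1,2)] S(3)]
      by (rule rules(1)[OF S[THEN Sl2]])
  next
    fix c x y assume S: "x \<in> S" "y \<in> S"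
    show "ip (fscale c (F x)) (F y) = c * ip (F x) (F y)"
      unfolding Fscale[OF S(1), symmetric] ipF[OF S] ipF[OF cfun.subspace_scale[OF sub S(1)] S(2)]
      by (rule rules(3)[OF S(1)[THEN Sl2] S(2)[THEN Sl2] S(1)[THEN Sl2]])
  next
    fix x y assume S: "x \<in> S" "y \<in> S"
    show "ip (F y) (F x) = cnj (ip (F x) (F y))"
      unfolding ipF[OF S] ipF[OF S(2,1)] by (rule ip_cnj[OF l2_inner_product l2_subspace S[THEN Sl2]])
  next
    fix x assume S: "x \<in> S" and "F x \<noteq> 0"
    then have "x \<noteq> 0" using Fdiff[OF S S] by auto
    then show "0 < Re (ip (F x) (F x))"
      unfolding ipF[OF S S] by (rule ip_axioms(4)[OF l2_inner_product l2_subspace Sl2[OF S]])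
  qed
  have fnF: "fnorm ip (F x) = fnorm l2_ip x" if "x \<in> S" for x
    unfolding fnorm_def ipF[OF that that] ..
  have complete: "complete_on H ip"
    unfolding complete_on_def
  proof (intro allI impI, elim conjE)
    fix s :: "nat \<Rightarrow> 'a \<Rightarrow> complex"
    assume s: "range s \<subseteq> H" and cauchy: "\<forall>e>0. \<exists>N. \<forall>i\<ge>N. \<forall>j\<ge>N. fnorm ip (s i - s j) < e"
    have "\<exists>x. x \<in> S \<and> s i = F x" for i using s by (auto simp: H_def)
    then obtain t where t: "\<And>i. t i \<in> S" "\<And>i. s i = F (t i)" by metis
    have st: "fnorm ip (s i - s j) = fnorm l2_ip (t i - t j)" for i j
      unfolding t(2) Fdiff[OF t(1) t(1), symmetric] by (rule fnF[OF cfun.subspace_diff[OF sub t(1) t(1)]])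
    have "\<exists>x\<in>l2_space. (\<lambda>i. fnorm l2_ip (t i - x)) \<longlonglongrightarrow> 0"
      by (rule l2_complete[unfolded complete_on_def, rule_format])
        (use t(1) Sl2 cauchy in \<open>auto simp: st\<close>)
    then obtain x where x: "x \<in> l2_space" "(\<lambda>i. fnorm l2_ip (t i - x)) \<longlonglongrightarrow> 0" by blast
    have xS: "x \<in> S"
    proof (rule SI[OF x(1)])
      fix y assume y: "y \<in> l2_space" "\<And>z. z \<in> X \<Longrightarrow> l2_ip y (\<Phi> z) = 0"
      have "cmod (l2_ip x y) \<le> fnorm l2_ip (t i - x) * fnorm l2_ip y" for i
      proof -
        have "l2_ip (t i - x) y = - l2_ip x y"
          using rules(2)[OF Sl2[OF t(1)] x(1) y(1), of i] Sorth[OF t(1)[of i] y] by simp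
        then show ?thesis
          using ip_Cauchy_Schwarz[OF l2_inner_product l2_subspace
              cfun.subspace_diff[OF l2_subspace Sl2[OF t(1)] x(1)] y(1), of i] by simp
      qed
      moreover have "(\<lambda>i. fnorm l2_ip (t i - x) * fnorm l2_ip y) \<longlonglongrightarrow> 0 * fnorm l2_ip y"
        by (intro tendsto_intros x(2))
      ultimately have "cmod (l2_ip x y) \<le> 0 * fnorm l2_ip y"
        by (intro LIMSEQ_le_const) auto
      then show "l2_ip x y = 0" by simp
    qed
    have "fnorm ip (s i - F x) = fnorm l2_ip (t i - x)" for i
      unfolding t(2) Fdiff[OF t(1) xS, symmetric] by (rule fnF[OF cfun.subspace_diff[OF sub t(1) xS]])
    then show "\<exists>f\<in>H. (\<lambda>i. fnorm ip (s i - f)) \<longlonglongrightarrow> 0"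
      using x(2) unfolding H_def by (intro bexI[OF _ imageI[OF xS]]) simp
  qed
  have \<Phi>S: "\<Phi> w \<in> S" if w: "w \<in> X" for w
  proof (rule SI[OF \<Phi>[OF w]])
    fix y assume y: "y \<in> l2_space" "\<And>z. z \<in> X \<Longrightarrow> l2_ip y (\<Phi> z) = 0"
    show "l2_ip (\<Phi> w) y = 0"
      using ip_cnj[OF l2_inner_product l2_subspace y(1) \<Phi>[OF w]] y(2)[OF w] by simp
  qed
  have kF: "kernel_at X K w = F (\<Phi> w)" if "w \<in> X" for w
    unfolding kernel_at_def F_def using K that by (simp add: fun_eq_iff)
  have "rkhs X K H ip"
    unfolding rkhs_def
  proof (intro conjI Hsub ipo complete ballI allI impI)
    show "f z = 0" if "f \<in> H" "z \<notin> X" for f z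
      using that by (auto simp: H_def F_def)
    show "kernel_at X K w \<in> H" if "w \<in> X" for w
      unfolding kF[OF that] H_def by (rule imageI[OF \<Phi>S[OF that]])
    show "ip f (kernel_at X K w) = f w" if "w \<in> X" "f \<in> H" for w f
    proof -
      obtain x where x: "x \<in> S" "f = F x" using \<open>f \<in> H\<close> by (auto simp: H_def)
      show ?thesis
        unfolding kF[OF \<open>w \<in> X\<close>] x(2) ipF[OF x(1) \<Phi>S[OF \<open>w \<in> X\<close>]]
        using \<open>w \<in> X\<close> by (simp add: F_def)
    qed
  qed
  then show ?thesis by blast
qed

lemma finite_words: "finite {u :: 'd::finite list. length u = n}"
  using finite_lists_length_eq[of "UNIV :: 'd set" n] by simp

lemma sum_words:
  fixes c :: "'d::finite \<Rightarrow> 'b::comm_ring_1"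
  shows "(\<Sum>u | length u = n. prod_list (map c u)) = (\<Sum>j\<in>UNIV. c j) ^ n"
proof (induction n)
  case 0
  then show ?case by simp
next
  case (Suc n)
  have "{u :: 'd list. length u = Suc n} = (\<lambda>(j, u). j # u) ` (UNIV \<times> {u. length u = n})"
    by (auto simp: length_Suc_conv image_iff)
  moreover have "inj_on (\<lambda>(j, u). j # u) (UNIV \<times> {u :: 'd list. length u = n})"
    by (auto simp: inj_on_def)
  ultimately have "(\<Sum>u | length u = Suc n. prod_list (map c u)) =
      (\<Sum>(j, u)\<in>UNIV \<times> {u. length u = n}. c j * prod_list (map c u))"
    by (simp add: sum.reindex case_prod_unfold)
  also have "\<dots> = (\<Sum>j\<in>UNIV. c j) * (\<Sum>u | length u = n. prod_list (map c u))"
    by (simp add: sum_product sum.cartesian_product)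
  finally show ?case using Suc by simp
qed

lemma sum_short_words:
  fixes c :: "'d::finite \<Rightarrow> 'b::comm_ring_1"
  shows "(\<Sum>u | length u < n. prod_list (map c u)) = (\<Sum>m<n. (\<Sum>j\<in>UNIV. c j) ^ m)"
proof -
  have "{u :: 'd list. length u < n} = (\<Union>m<n. {u. length u = m})" by auto
  then have "(\<Sum>u | length u < n. prod_list (map c u)) =
      (\<Sum>m<n. \<Sum>u | length u = m. prod_list (map c u))"
    by (simp only:, intro sum.UNION_disjoint) (auto simp: finite_words)
  then show ?thesis by (simp add: sum_words)
qed

lemma finite_short_words: "finite {u :: 'd::finite list. length u < n}"
proof -
  have "{u :: 'd list. length u < n} = (\<Union>m<n. {u. length u = m})" by auto
  then show ?thesis by (simp add: finite_words)
qed

lemma finite_subset_short_words: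
  assumes "finite F"
  shows "\<exists>N. \<forall>n\<ge>N. F \<subseteq> {u :: 'd::finite list. length u < n}"
proof -
  have "u \<in> F \<Longrightarrow> length u < Suc (Max (length ` F))" for u
    using assms by (simp add: le_imp_less_Suc)
  then show ?thesis by (intro exI[of _ "Suc (Max (length ` F))"]) force
qed

theorem drury_arveson_space_exists:
  "\<exists>H ip. drury_arveson_space (H :: (complex ^ 'd \<Rightarrow> complex) set) ip"
  unfolding drury_arveson_space_def
proof (rule rkhs_exists)
  define \<Phi> :: "complex ^ 'd \<Rightarrow> 'd list \<Rightarrow> complex"
    where "\<Phi> w u = prod_list (map (\<lambda>j. cnj (w $ j)) u)" for w u
  show mem: "\<Phi> z \<in> l2_space" if z: "z \<in> unit_ball" for z
  proof -
    define q where "q = (\<Sum>j\<in>UNIV. (cmod (z $ j))\<^sup>2)"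
    have q: "q = (norm z)\<^sup>2" by (simp add: q_def norm_vec_def L2_set_def sum_nonneg)
    then have q01: "0 \<le> q" "q < 1" using z by (auto simp: power_less_one_iff)
    have sq: "(cmod (\<Phi> z u))\<^sup>2 = prod_list (map (\<lambda>j. (cmod (z $ j))\<^sup>2) u)" for u
      unfolding \<Phi>_def by (induction u) (auto simp: norm_mult power_mult_distrib)
    have "(\<Sum>u\<in>F. (cmod (\<Phi> z u))\<^sup>2) \<le> 1 / (1 - q)" if F: "finite F" for F
    proof -
      obtain n where n: "F \<subseteq> {u. length u < n}" using finite_subset_short_words[OF F] by blast
      have "(\<Sum>u\<in>F. (cmod (\<Phi> z u))\<^sup>2) \<le> (\<Sum>u | length u < n. (cmod (\<Phi> z u))\<^sup>2)"
        by (rule sum_mono2[OF finite_short_words n]) simp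
      also have "\<dots> = (\<Sum>m<n. q ^ m)" unfolding sq sum_short_words q_def ..
      also have "\<dots> \<le> (\<Sum>m. q ^ m)"
        by (rule sum_le_suminf) (use q01 in \<open>auto intro: summable_geometric\<close>)
      also have "\<dots> = 1 / (1 - q)" using q01 by (intro suminf_geometric) simp
      finally show ?thesis .
    qed
    then show ?thesis
      unfolding l2_space_def mem_Collect_eq
      by (intro nonneg_bdd_above_summable_on) (auto intro!: bdd_aboveI2)
  qed
  show "da_kernel z w = l2_ip (\<Phi> w) (\<Phi> z)" if zw: "z \<in> unit_ball" "w \<in> unit_ball" for z w
  proof -
    have prod: "\<Phi> w u * cnj (\<Phi> z u) = prod_list (map (\<lambda>j. z $ j * cnj (w $ j)) u)" for u
      unfolding \<Phi>_def by (induction u) (auto simp: algebra_simps)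
    have "((\<lambda>u. \<Phi> w u * cnj (\<Phi> z u)) has_sum l2_ip (\<Phi> w) (\<Phi> z)) UNIV"
      unfolding l2_ip_def by (rule has_sum_infsum[OF l2_mult_summable[OF mem[OF zw(2)] mem[OF zw(1)]]])
    moreover have "filterlim (\<lambda>n. {u :: 'd list. length u < n}) (finite_subsets_at_top UNIV) sequentially"
      unfolding filterlim_finite_subsets_at_top eventually_sequentially
      using finite_subset_short_words finite_short_words by (metis subset_UNIV)
    ultimately have "(\<lambda>n. \<Sum>u | length u < n. \<Phi> w u * cnj (\<Phi> z u)) \<longlonglongrightarrow> l2_ip (\<Phi> w) (\<Phi> z)"
      unfolding has_sum_def by (rule filterlim_compose)
    then have "(\<lambda>n. \<Sum>m<n. cdot z w ^ m) \<longlonglongrightarrow> l2_ip (\<Phi> w) (\<Phi> z)"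
      unfolding prod sum_short_words cdot_def .
    moreover have "(\<lambda>n. \<Sum>m<n. cdot z w ^ m) \<longlonglongrightarrow> 1 / (1 - cdot z w)"
      using geometric_sums[OF norm_cdot_less_1[OF zw]] by (simp add: sums_def)
    ultimately show ?thesis unfolding da_kernel_def by (rule LIMSEQ_unique[rotated])
  qed
qed

end

theory Submission
  imports Defs "HOL-Computational_Algebra.Fundamental_Theorem_Algebra"
begin

text \<open>
  Let \<open>V = P ` H\<close> be an \<open>n\<close>-dimensional coinvariant subspace. Coinvariance makes the compressions of
  the coordinate multiplications to \<open>V\<close> commute, so \<open>V\<close> has an orthonormal basis
  \<open>e\<^sub>0, \<dots>, e\<^sub>n\<^sub>-\<^sub>1\<close> in which all of them are triangular: \<open>\<langle>z\<^sub>j e\<^sub>i, e\<^sub>l\<rangle> = 0\<close> for \<open>i < l\<close>. Such a basis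
  is called a Schur basis below; it exists by \<open>orthonormal_triangular_basis\<close>. Its \<open>n\<close> diagonal points
  \<open>\<lambda>\<^sub>i = (\<langle>z\<^sub>j e\<^sub>i, e\<^sub>i\<rangle>)\<^sub>j\<close> are, with multiplicities, the value of the spectral map at \<open>P\<close>, for every choice
  of the Schur basis: the root subspace of a point has as many dimensions as there are indices \<open>i\<close>
  whose diagonal point it is (\<open>spectral_multiset_eq\<close>, \<open>Psi_eq_schur_diagonal\<close>).
  
  The diagonal points lie in the ball because multiplication by the linear form \<open>\<langle>\<cdot>, b\<rangle>\<close> is bounded
  by \<open>norm b\<close>. For a unit vector \<open>f\<close> with \<open>\<lambda> = (\<langle>z\<^sub>j f, f\<rangle>)\<^sub>j\<close> the function \<open>F = \<langle>\<cdot>, \<lambda>\<rangle> f\<close> satisfies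
  \<open>\<langle>F, f\<rangle> = |\<lambda>|\<^sup>2\<close> and has norm at most \<open>|\<lambda>|\<close>, which gives \<open>|\<lambda>| \<le> 1\<close>, and equality would force \<open>F = f\<close>, which is
  impossible inside the ball (\<open>linear_form_multiplier\<close>, \<open>compression_in_ball\<close>).
  
  Continuity of the spectral map is a compactness argument. If \<open>Q\<^sub>k\<close> tends to \<open>P\<close> and \<open>e\<^sup>k\<close> is a
  Schur basis for \<open>Q\<^sub>k\<close>, then \<open>e\<^sup>k\<^sub>i\<close> is close to \<open>P e\<^sup>k\<^sub>i\<close>, which stays in the unit ball of the
  finite-dimensional space \<open>V\<close>. So a subsequence of the bases converges, and the limit is a Schur basis for
  \<open>P\<close>, because orthonormality and triangularity are closed conditions (\<open>schur_basis_limit\<close>). Along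
  this subsequence the diagonal points converge index by index, which is convergence in the symmetric
  distance.
  
  If the kernel function at \<open>\<lambda>\<close> lies in \<open>V\<close>, then evaluating the triangular relations at \<open>\<lambda>\<close> shows that
  \<open>\<lambda>\<close> is the diagonal point of the first \<open>e\<^sub>i\<close> that does not vanish at \<open>\<lambda>\<close>. Hence the value of the
  spectral map at the projection onto the span of \<open>n\<close> kernel functions is the set of their \<open>n\<close> points
  (\<open>Psi_kernel_span\<close>), and the restricted map is a bijection. For the continuity of its inverse, kernel
  functions depend continuously on their points, and the coefficients of a combination of kernel
  functions are controlled by its norm because functions in the space interpolate. A small displacement of
  the points therefore moves the span, and with it the projection, only a little (\<open>projections_close\<close>).
\<close>

section \<open>Common eigenvectors modulo an invariant subspace\<close>

definition endomorphism_on ::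
  "('a \<Rightarrow> complex) set \<Rightarrow> (('a \<Rightarrow> complex) \<Rightarrow> 'a \<Rightarrow> complex) \<Rightarrow> bool"
  where "endomorphism_on V T \<longleftrightarrow>
    (\<forall>x\<in>V. T x \<in> V) \<and> (\<forall>x\<in>V. \<forall>y\<in>V. T (x + y) = T x + T y) \<and>
    (\<forall>c. \<forall>x\<in>V. T (fscale c x) = fscale c (T x))"

lemma endomorphism_onD:
  assumes "endomorphism_on V T"
  shows "x \<in> V \<Longrightarrow> T x \<in> V" "x \<in> V \<Longrightarrow> y \<in> V \<Longrightarrow> T (x + y) = T x + T y"
    "x \<in> V \<Longrightarrow> T (fscale c x) = fscale c (T x)"
  using assms by (auto simp: endomorphism_on_def)

lemma endomorphism_on_diff:
  assumes "endomorphism_on V T" "cfun.subspace V" "x \<in> V" "y \<in> V"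
  shows "T (x - y) = T x - T y"
proof -
  have *: "x - y = x + fscale (-1) y" "T x - T y = T x + fscale (-1) (T y)"
    by (simp_all add: fscale_def fun_eq_iff)
  show ?thesis unfolding *
    using endomorphism_onD[OF assms(1)] assms(3,4) cfun.subspace_scale[OF assms(2)] by metis
qed

lemma endomorphism_on_zero:
  assumes "endomorphism_on V T" "cfun.subspace V"
  shows "T 0 = 0"
  using endomorphism_on_diff[OF assms cfun.subspace_0 cfun.subspace_0, OF assms(2,2)] by simp

lemma endomorphism_on_sum:
  assumes "endomorphism_on V T" "cfun.subspace V" "\<And>i. i \<in> I \<Longrightarrow> x i \<in> V"
  shows "T (\<Sum>i\<in>I. fscale (c i) (x i)) = (\<Sum>i\<in>I. fscale (c i) (T (x i)))"
  using assms(3)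
proof (induction I rule: infinite_finite_induct)
  case (insert a F)
  have "fscale (c a) (x a) \<in> V" "(\<Sum>i\<in>F. fscale (c i) (x i)) \<in> V"
    using insert.prems by (auto intro!: cfun.subspace_scale[OF assms(2)] cfun.subspace_sum[OF assms(2)])
  then have "T (fscale (c a) (x a) + (\<Sum>i\<in>F. fscale (c i) (x i))) =
      fscale (c a) (T (x a)) + (\<Sum>i\<in>F. fscale (c i) (T (x i)))"
    using insert.IH insert.prems by (simp only: endomorphism_onD[OF assms(1)] insert_iff simp_thms)
  then show ?case
    by (simp only: sum.insert[OF insert.hyps(1,2)])
qed (simp_all add: endomorphism_on_zero[OF assms(1,2)])

lemma endomorphism_on_funpow: "endomorphism_on V T \<Longrightarrow> u \<in> V \<Longrightarrow> (T ^^ i) u \<in> V"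
  by (induction i) (auto simp: endomorphism_on_def)

definition poly_apply ::
  "(('a \<Rightarrow> complex) \<Rightarrow> 'a \<Rightarrow> complex) \<Rightarrow> complex poly \<Rightarrow> ('a \<Rightarrow> complex) \<Rightarrow> 'a \<Rightarrow> complex"
  where "poly_apply T p u = (\<Sum>i\<le>degree p. fscale (coeff p i) ((T ^^ i) u))"

lemma fscale_simps [simp]: "fscale 0 f = 0" "fscale 1 f = f" "fscale c 0 = 0"
  by (simp_all add: fscale_def fun_eq_iff)

lemma poly_apply_upto:
  assumes "degree p \<le> N"
  shows "poly_apply T p u = (\<Sum>i\<le>N. fscale (coeff p i) ((T ^^ i) u))"
  unfolding poly_apply_def
  by (rule sum.mono_neutral_left) (use assms in \<open>auto simp: coeff_eq_0\<close>)

lemma poly_apply_mem: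
  "endomorphism_on V T \<Longrightarrow> cfun.subspace V \<Longrightarrow> u \<in> V \<Longrightarrow> poly_apply T p u \<in> V"
  unfolding poly_apply_def
  by (intro cfun.subspace_sum cfun.subspace_scale endomorphism_on_funpow)

text \<open>
  Splitting off a linear factor of an annihilating polynomial produces an eigenvector; this is the
  computation behind that step.
\<close>

lemma poly_apply_linear_factor:
  assumes "endomorphism_on V T" "cfun.subspace V" "u \<in> V"
  shows "poly_apply T ([:- r, 1:] * q) u = T (poly_apply T q u) - fscale r (poly_apply T q u)"
proof -
  define N where "N = degree q"
  have deg: "degree ([:- r, 1:] * q) \<le> Suc N"
    using degree_mult_le[of "[:- r, 1:]" q] by (simp add: N_def)
  have co: "coeff ([:- r, 1:] * q) i = coeff (pCons 0 q) i - r * coeff q i" for i by simp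
  have "poly_apply T ([:- r, 1:] * q) u =
      (\<Sum>i\<le>Suc N. fscale (coeff (pCons 0 q) i) ((T ^^ i) u)) -
      (\<Sum>i\<le>Suc N. fscale r (fscale (coeff q i) ((T ^^ i) u)))"
    unfolding poly_apply_upto[OF deg] co
    by (simp add: cfun.scale_left_diff_distrib sum_subtractf del: sum.atMost_Suc)
  also have "(\<Sum>i\<le>Suc N. fscale (coeff (pCons 0 q) i) ((T ^^ i) u)) =
      (\<Sum>i\<le>N. fscale (coeff q i) (T ((T ^^ i) u)))"
    by (subst sum.atMost_Suc_shift) simp
  also have "\<dots> = T (poly_apply T q u)"
    unfolding poly_apply_def N_def
    by (rule endomorphism_on_sum[OF assms(1,2), symmetric]) (rule endomorphism_on_funpow[OF assms(1,3)])
  also have "(\<Sum>i\<le>Suc N. fscale r (fscale (coeff q i) ((T ^^ i) u))) = fscale r (poly_apply T q u)"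
    using poly_apply_upto[of q "Suc N" T u] by (simp only: cfun.scale_sum_right N_def)
  finally show ?thesis .
qed

text \<open>
  Among the \<open>card B + 1\<close> vectors \<open>u, T u, T\<^sup>2 u, \<dots>\<close> of a space spanned by \<open>B\<close>, two coincide or there is
  a linear relation. Both cases give a polynomial.
\<close>

lemma annihilating_polynomial:
  assumes "endomorphism_on V T" "u \<in> V" "finite B" "V \<subseteq> cfun.span B"
  shows "\<exists>p. p \<noteq> 0 \<and> poly_apply T p u = 0"
proof (cases "inj_on (\<lambda>i. (T ^^ i) u) {..card B}")
  case True
  define S where "S = (\<lambda>i. (T ^^ i) u) ` {..card B}"
  have "card S = Suc (card B)" unfolding S_def by (simp add: card_image[OF True])
  moreover have "S \<subseteq> cfun.span B"
    using endomorphism_on_funpow[OF assms(1,2)] assms(4) by (auto simp: S_def)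
  ultimately have "cfun.dependent S"
    using cfun.independent_span_bound[OF assms(3), of S] by auto
  then obtain c v where c: "v \<in> S" "c v \<noteq> 0" "(\<Sum>v\<in>S. fscale (c v) v) = 0"
    using cfun.dependent_finite[of S] by (auto simp: S_def)
  define p where "p = (\<Sum>i\<le>card B. monom (c ((T ^^ i) u)) i)"
  have co: "coeff p i = (if i \<le> card B then c ((T ^^ i) u) else 0)" for i
    by (simp add: p_def coeff_sum if_distrib cong: if_cong)
  have "degree p \<le> card B" by (rule degree_le) (simp add: co)
  then have "poly_apply T p u = (\<Sum>i\<le>card B. fscale (c ((T ^^ i) u)) ((T ^^ i) u))"
    by (simp add: poly_apply_upto co)
  also have "\<dots> = (\<Sum>v\<in>S. fscale (c v) v)"
    unfolding S_def by (simp add: sum.reindex[OF True])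
  finally have "poly_apply T p u = 0" using c(3) by simp
  moreover have "p \<noteq> 0"
  proof -
    obtain i where "i \<le> card B" "v = (T ^^ i) u" using c(1) by (auto simp: S_def)
    then have "coeff p i \<noteq> 0" using c(2) by (simp add: co)
    then show ?thesis by auto
  qed
  ultimately show ?thesis by blast
next
  case False
  then obtain i k where ik: "i < k" "(T ^^ i) u = (T ^^ k) u"
    unfolding inj_on_def by (metis linorder_neqE_nat)
  define p :: "complex poly" where "p = monom 1 k - monom 1 i"
  have "degree p \<le> k"
    unfolding p_def using ik by (intro degree_diff_le) (auto simp: degree_monom_eq)
  then have "poly_apply T p u = (\<Sum>l\<le>k. fscale (coeff p l) ((T ^^ l) u))"
    by (rule poly_apply_upto)
  also have "\<dots> = (\<Sum>l\<in>{i, k}. fscale (coeff p l) ((T ^^ l) u))"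
    by (rule sum.mono_neutral_right) (use ik in \<open>auto simp: p_def\<close>)
  also have "\<dots> = 0" using ik by (simp add: p_def fscale_def fun_eq_iff)
  finally have "poly_apply T p u = 0" .
  moreover have "coeff p k = 1" using ik by (simp add: p_def)
  then have "p \<noteq> 0" by auto
  ultimately show ?thesis by blast
qed

text \<open>
  This is the existence of an eigenvector in the quotient \<open>V / W\<close>. Take \<open>u\<close> outside \<open>W\<close> and a nonzero
  polynomial that maps \<open>u\<close> into \<open>W\<close>, and split off linear factors one at a time: the last vector outside
  \<open>W\<close> is an eigenvector modulo \<open>W\<close>.
\<close>

lemma eigenvector_modulo:
  assumes T: "endomorphism_on V T" and sub: "cfun.subspace V" "cfun.subspace W"
    and fin: "finite B" "V \<subseteq> cfun.span B" and "\<not> V \<subseteq> W"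
  shows "\<exists>c. \<exists>v\<in>V - W. T v - fscale c v \<in> W"
proof -
  obtain u where u: "u \<in> V" "u \<notin> W" using assms(6) by blast
  have "\<exists>c. \<exists>v\<in>V - W. T v - fscale c v \<in> W" if "p \<noteq> 0" "poly_apply T p u \<in> W" for p
    using that
  proof (induction "degree p" arbitrary: p)
    case 0
    then obtain a where a: "p = [:a:]" using degree_eq_zeroE by (metis)
    then have "a \<noteq> 0" "fscale a u \<in> W" using 0 by (auto simp: poly_apply_def)
    then have "fscale (1 / a) (fscale a u) \<in> W" using cfun.subspace_scale[OF sub(2)] by blast
    then have "u \<in> W" using \<open>a \<noteq> 0\<close> by (simp add: fscale_def)
    then show ?case using u by blast
  next
    case (Suc m)
    then have "\<not> constant (poly p)" by (simp add: constant_degree)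
    then obtain r where "poly p r = 0" using fundamental_theorem_of_algebra by blast
    then obtain q where q: "p = [:- r, 1:] * q" using poly_eq_0_iff_dvd by (metis dvdE)
    then have q0: "q \<noteq> 0" using Suc by auto
    have "degree p = Suc (degree q)" unfolding q using q0 by (subst degree_mult_eq) auto
    then have dq: "m = degree q" using Suc by simp
    show ?case
    proof (cases "poly_apply T q u \<in> W")
      case True
      then show ?thesis using Suc.hyps(1)[OF dq q0] by blast
    next
      case False
      have "T (poly_apply T q u) - fscale r (poly_apply T q u) \<in> W"
        using Suc.prems(2) poly_apply_linear_factor[OF T sub(1) u(1), of r q] q by simp
      then show ?thesis using False poly_apply_mem[OF T sub(1) u(1)] by blast
    qed
  qed
  moreover obtain p where "p \<noteq> 0" "poly_apply T p u = 0"
    using annihilating_polynomial[OF T u(1) fin] by blast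
  ultimately show ?thesis using cfun.subspace_0[OF sub(2)] by metis
qed

text \<open>
  The vectors on which one operator acts as a given scalar modulo \<open>W\<close> form a subspace that the operators
  commuting with it preserve. So the common eigenvector is found by shrinking \<open>V\<close>, one operator at a
  time.
\<close>

lemma common_eigenvector_modulo:
  assumes "finite J" and sub: "cfun.subspace V" "cfun.subspace W"
    and T: "\<And>j. j \<in> J \<Longrightarrow> endomorphism_on V (T j)" "\<And>j x. j \<in> J \<Longrightarrow> x \<in> W \<Longrightarrow> T j x \<in> W"
    and comm: "\<And>i j x. i \<in> J \<Longrightarrow> j \<in> J \<Longrightarrow> x \<in> V \<Longrightarrow> T i (T j x) = T j (T i x)"
    and fin: "finite B" "V \<subseteq> cfun.span B" and W: "W \<subseteq> V" "\<not> V \<subseteq> W"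
  shows "\<exists>c. \<exists>v\<in>V - W. \<forall>j\<in>J. T j v - fscale (c j) v \<in> W"
  using assms
proof (induction J arbitrary: V rule: finite_induct)
  case empty
  then show ?case by auto
next
  case (insert a J)
  note Ta = insert.prems(3)[of a, simplified]
  obtain b where b: "\<exists>v\<in>V - W. T a v - fscale b v \<in> W"
    using eigenvector_modulo[OF Ta insert.prems(1,2,6,7,9)] by blast
  define V' where "V' = {v \<in> V. T a v - fscale b v \<in> W}"
  have V'V: "V' \<subseteq> V" by (auto simp: V'_def)
  have sV': "cfun.subspace V'"
  proof (rule cfun.subspaceI)
    show "0 \<in> V'"
      using cfun.subspace_0[OF insert.prems(1)] cfun.subspace_0[OF insert.prems(2)] endomorphism_on_zero[OF Ta insert.prems(1)] by (simp add: V'_def)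
  next
    fix x y assume xy: "x \<in> V'" "y \<in> V'"
    have "T a (x + y) - fscale b (x + y) = (T a x - fscale b x) + (T a y - fscale b y)"
      using endomorphism_onD(2)[OF Ta] xy by (simp add: V'_def cfun.scale_right_distrib)
    then show "x + y \<in> V'"
      using xy cfun.subspace_add[OF insert.prems(1)] cfun.subspace_add[OF insert.prems(2)]
      by (simp add: V'_def)
  next
    fix c x assume x: "x \<in> V'"
    have "T a (fscale c x) - fscale b (fscale c x) = fscale c (T a x - fscale b x)"
      using endomorphism_onD(3)[OF Ta] x by (simp add: V'_def cfun.scale_right_diff_distrib mult.commute)
    then show "fscale c x \<in> V'"
      using x cfun.subspace_scale[OF insert.prems(1)] cfun.subspace_scale[OF insert.prems(2)]
      by (simp add: V'_def)
  qed
  have inv: "T j x \<in> V'" if j: "j \<in> J" and x: "x \<in> V'" for j x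
  proof -
    note Tj = insert.prems(3)[of j, OF insertI2[OF j]]
    have xV: "x \<in> V" "T a x \<in> V" "fscale b x \<in> V"
      using x endomorphism_onD(1)[OF Ta] cfun.subspace_scale[OF insert.prems(1)] by (auto simp: V'_def)
    have "T a (T j x) - fscale b (T j x) = T j (T a x - fscale b x)"
      using insert.prems(5)[of a j x] j xV(1)
      by (simp only: endomorphism_on_diff[OF Tj insert.prems(1) xV(2,3)]
          endomorphism_onD(3)[OF Tj xV(1)] insert_iff simp_thms)
    also have "\<dots> \<in> W" using insert.prems(4)[of j] j x by (auto simp: V'_def)
    finally show ?thesis using endomorphism_onD(1)[OF Tj xV(1)] by (simp add: V'_def)
  qed
  have "\<exists>c. \<exists>v\<in>V' - W. \<forall>j\<in>J. T j v - fscale (c j) v \<in> W"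
  proof (rule insert.IH[OF sV' insert.prems(2)])
    show "endomorphism_on V' (T j)" if "j \<in> J" for j
      using insert.prems(3)[of j] that inv V'V unfolding endomorphism_on_def by blast
    show "T j x \<in> W" if "j \<in> J" "x \<in> W" for j x using insert.prems(4) that by blast
    show "T i (T j x) = T j (T i x)" if "i \<in> J" "j \<in> J" "x \<in> V'" for i j x
      using insert.prems(5) that V'V by blast
    show "finite B" by fact
    show "V' \<subseteq> cfun.span B" using V'V insert.prems(7) by blast
    show "W \<subseteq> V'"
    proof
      fix x assume x: "x \<in> W"
      then have "T a x - fscale b x \<in> W"
        using insert.prems(4) cfun.subspace_diff[OF insert.prems(2)] cfun.subspace_scale[OF insert.prems(2)] by simp
      then show "x \<in> V'" using x insert.prems(8) by (auto simp: V'_def)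
    qed
    show "\<not> V' \<subseteq> W" using b by (auto simp: V'_def)
  qed
  then obtain c v where v: "v \<in> V' - W" "\<forall>j\<in>J. T j v - fscale (c j) v \<in> W" by blast
  then have "\<forall>j\<in>insert a J. T j v - fscale ((c(a := b)) j) v \<in> W"
    by (auto simp: V'_def)
  then show ?case using v(1) V'V by blast
qed


section \<open>Hilbert spaces of functions\<close>

locale function_hilbert_space =
  fixes H :: "('a \<Rightarrow> complex) set" and ip :: "('a \<Rightarrow> complex) \<Rightarrow> ('a \<Rightarrow> complex) \<Rightarrow> complex"
  assumes inner_product: "inner_product_on H ip"
    and subspace: "cfun.subspace H"
    and complete: "complete_on H ip"
begin

lemmas H_zero = cfun.subspace_0[OF subspace]
lemmas H_add = cfun.subspace_add[OF subspace]
lemmas H_diff = cfun.subspace_diff[OF subspace]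
lemmas H_scale = cfun.subspace_scale[OF subspace]
lemmas ip_add_left = ip_rules(1)[OF inner_product subspace]
lemmas ip_diff_left = ip_rules(2)[OF inner_product subspace]
lemmas ip_scale_left = ip_axioms(2)[OF inner_product subspace]
lemmas ip_add_right = ip_rules(4)[OF inner_product subspace]
lemmas ip_diff_right = ip_rules(5)[OF inner_product subspace]
lemmas ip_conj = ip_cnj[OF inner_product subspace]
lemmas ip_zero_left = ip_zero[OF inner_product subspace]
lemmas norm_nonneg = fnorm_nonneg[OF inner_product subspace]
lemmas norm_squared = fnorm_squared[OF inner_product subspace]
lemmas norm_eq_0_iff = fnorm_eq_0_iff[OF inner_product subspace]
lemmas norm_scale = fnorm_scale[OF inner_product subspace]
lemmas ip_self_norm = ip_self[OF inner_product subspace]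
lemmas Cauchy_Schwarz = ip_Cauchy_Schwarz[OF inner_product subspace]
lemmas norm_triangle = fnorm_triangle[OF inner_product subspace]
lemmas norm_diff_commute = fnorm_diff_commute[OF inner_product subspace]
lemmas norm_diff_triangle = fnorm_diff_triangle[OF inner_product subspace]

lemma ip_scale_right:
  assumes "f \<in> H" "g \<in> H" shows "ip f (fscale c g) = cnj c * ip f g"
  using ip_rules(6)[OF inner_product subspace assms assms(2)] .

lemma ip_zero_right: "f \<in> H \<Longrightarrow> ip f 0 = 0"
  using ip_conj[OF H_zero, of f] ip_zero_left[of f] by simp

lemma norm_zero: "fnorm ip 0 = 0"
  using norm_eq_0_iff[OF H_zero] by simp

lemma norm_add_squared:
  assumes "f \<in> H" "g \<in> H"
  shows "(fnorm ip (f + g))\<^sup>2 = (fnorm ip f)\<^sup>2 + (fnorm ip g)\<^sup>2 + 2 * Re (ip f g)"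
  using ip_add_left[OF assms H_add[OF assms]] ip_add_right[OF assms(1) assms]
    ip_add_right[OF assms(2) assms] ip_conj[OF assms]
  by (simp add: norm_squared assms H_add[OF assms])

lemma norm_diff_squared:
  assumes "f \<in> H" "g \<in> H"
  shows "(fnorm ip (f - g))\<^sup>2 = (fnorm ip f)\<^sup>2 + (fnorm ip g)\<^sup>2 - 2 * Re (ip f g)"
  using ip_diff_left[OF assms H_diff[OF assms]] ip_diff_right[OF assms(1) assms]
    ip_diff_right[OF assms(2) assms] ip_conj[OF assms]
  by (simp add: norm_squared assms H_diff[OF assms])

lemma H_sum: "(\<And>i. i \<in> I \<Longrightarrow> x i \<in> H) \<Longrightarrow> (\<Sum>i\<in>I. fscale (c i) (x i)) \<in> H"
  by (intro cfun.subspace_sum[OF subspace] H_scale)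

lemma ip_sum_left:
  assumes "\<And>i. i \<in> I \<Longrightarrow> x i \<in> H" "h \<in> H"
  shows "ip (\<Sum>i\<in>I. fscale (c i) (x i)) h = (\<Sum>i\<in>I. c i * ip (x i) h)"
  using assms(1)
proof (induction I rule: infinite_finite_induct)
  case (insert a F)
  have m: "x a \<in> H" "(\<Sum>i\<in>F. fscale (c i) (x i)) \<in> H" using insert.prems H_sum[of F x c] by auto
  show ?case
    unfolding sum.insert[OF insert.hyps(1,2)]
    unfolding ip_add_left[OF H_scale[OF m(1)] m(2) assms(2)] ip_scale_left[OF m(1) assms(2)]
    using insert.IH insert.prems by simp
qed (simp_all add: ip_zero_left[OF assms(2)])

lemma ip_sum_right:
  assumes "\<And>i. i \<in> I \<Longrightarrow> x i \<in> H" "h \<in> H"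
  shows "ip h (\<Sum>i\<in>I. fscale (c i) (x i)) = (\<Sum>i\<in>I. cnj (c i) * ip h (x i))"
proof -
  have "ip h (\<Sum>i\<in>I. fscale (c i) (x i)) = cnj (\<Sum>i\<in>I. c i * ip (x i) h)"
    using ip_conj[OF H_sum[of I x c] assms(2)] ip_sum_left[of I x h c] assms by simp
  also have "\<dots> = (\<Sum>i\<in>I. cnj (c i) * ip h (x i))"
    unfolding cnj_sum using ip_conj[OF assms(1) assms(2)] by (intro sum.cong) simp_all
  finally show ?thesis .
qed

lemma norm_sum_le:
  assumes "\<And>i. i \<in> I \<Longrightarrow> x i \<in> H"
  shows "fnorm ip (\<Sum>i\<in>I. fscale (c i) (x i)) \<le> (\<Sum>i\<in>I. cmod (c i) * fnorm ip (x i))"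
  using assms
proof (induction I rule: infinite_finite_induct)
  case (insert a F)
  have m: "x a \<in> H" "(\<Sum>i\<in>F. fscale (c i) (x i)) \<in> H" using insert.prems H_sum[of F x c] by auto
  show ?case
    unfolding sum.insert[OF insert.hyps(1,2)]
    using norm_triangle[OF H_scale[OF m(1)] m(2), of "c a"] insert.IH insert.prems
    unfolding norm_scale[OF m(1)] by (meson add_left_mono insertI2 order_trans)
qed (simp_all add: norm_zero)

lemma ip_tendsto:
  assumes "\<And>k. f k \<in> H" "\<And>k. g k \<in> H" "f' \<in> H" "g' \<in> H"
    and "(\<lambda>k. fnorm ip (f k - f')) \<longlonglongrightarrow> 0" "(\<lambda>k. fnorm ip (g k - g')) \<longlonglongrightarrow> 0"
  shows "(\<lambda>k. ip (f k) (g k)) \<longlonglongrightarrow> ip f' g'"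
proof -
  define a b where "a k = fnorm ip (f k - f')" and "b k = fnorm ip (g k - g')" for k
  have le: "cmod (ip (f k) (g k) - ip f' g') \<le> a k * b k + a k * fnorm ip g' + fnorm ip f' * b k" for k
  proof -
    have m: "f k - f' \<in> H" "g k - g' \<in> H" using assms(1-4) H_diff by auto
    have "ip (f k) (g k) - ip f' g' = ip (f k - f') (g k - g') + ip (f k - f') g' + ip f' (g k - g')"
      using ip_diff_left[OF assms(1)[of k] assms(3) assms(2)[of k]]
        ip_diff_right[OF m(1) assms(2)[of k] assms(4)] ip_diff_right[OF assms(3) assms(2)[of k] assms(4)]
      by simp
    then show ?thesis
      using Cauchy_Schwarz[OF m] Cauchy_Schwarz[OF m(1) assms(4)] Cauchy_Schwarz[OF assms(3) m(2)]
        norm_triangle_ineq[of "ip (f k - f') (g k - g') + ip (f k - f') g'" "ip f' (g k - g')"]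
        norm_triangle_ineq[of "ip (f k - f') (g k - g')" "ip (f k - f') g'"]
      unfolding a_def b_def by simp
  qed
  have "(\<lambda>k. a k * b k + a k * fnorm ip g' + fnorm ip f' * b k) \<longlonglongrightarrow>
      0 * 0 + 0 * fnorm ip g' + fnorm ip f' * 0"
    using assms(5,6) unfolding a_def b_def by (intro tendsto_intros)
  then have lim: "(\<lambda>k. a k * b k + a k * fnorm ip g' + fnorm ip f' * b k) \<longlonglongrightarrow> 0" by simp
  have "(\<lambda>k. ip (f k) (g k) - ip f' g') \<longlonglongrightarrow> 0"
    by (rule Lim_null_comparison[OF _ lim]) (simp add: le)
  then show ?thesis by (rule LIM_zero_cancel)
qed

text \<open>
  The Riesz representation theorem, with the functional given by its graph: that the graph determines
  a functional follows from the bound. In this form it applies to functionals that are prescribed on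
  combinations of kernel functions. The representing vector is the limit of a sequence that minimises
  \<open>\<parallel>u\<parallel>\<^sup>2 - 2 Re l\<close> over the graph; the sequence is Cauchy by the parallelogram law, and at the minimum
  the first variation vanishes.
\<close>

lemma riesz_graph:
  assumes G: "\<And>u l. (u, l) \<in> G \<Longrightarrow> u \<in> H"
      "\<And>u l v a. (u, l) \<in> G \<Longrightarrow> (v, a) \<in> G \<Longrightarrow> (u + v, l + a) \<in> G"
      "\<And>c u l. (u, l) \<in> G \<Longrightarrow> (fscale c u, c * l) \<in> G" "G \<noteq> {}"
    and bound: "\<And>u l. (u, l) \<in> G \<Longrightarrow> cmod l \<le> C * fnorm ip u" and C: "0 \<le> C"
  shows "\<exists>g\<in>H. fnorm ip g \<le> C \<and> (\<forall>u l. (u, l) \<in> G \<longrightarrow> ip u g = l)"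
proof -
  define J where "J p = (fnorm ip (fst p))\<^sup>2 - 2 * Re (snd p)" for p :: "('a \<Rightarrow> complex) \<times> complex"
  define m where "m = Inf (J ` G)"
  have bdd: "bdd_below (J ` G)"
  proof (rule bdd_belowI2)
    fix p assume p: "p \<in> G"
    have "Re (snd p) \<le> C * fnorm ip (fst p)"
      using bound[of "fst p" "snd p"] p complex_Re_le_cmod[of "snd p"] by simp
    moreover have "0 \<le> (fnorm ip (fst p) - C)\<^sup>2" by simp
    ultimately show "- C\<^sup>2 \<le> J p" by (simp add: J_def power2_eq_square algebra_simps)
  qed
  have mle: "m \<le> J p" if "p \<in> G" for p unfolding m_def by (rule cINF_lower[OF bdd that])
  have "\<exists>p\<in>G. J p < m + inverse (real (Suc k))" for k
  proof -
    have "m < m + inverse (real (Suc k))" by simp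
    then show ?thesis unfolding m_def by (simp only: cINF_less_iff[OF G(4) bdd])
  qed
  then obtain p where p: "\<And>k. p k \<in> G" "\<And>k. J (p k) < m + inverse (real (Suc k))" by metis
  define u l where "u k = fst (p k)" and "l k = snd (p k)" for k
  have ul: "(u k, l k) \<in> G" "u k \<in> H" for k
    using p(1)[of k] G(1)[of "u k" "l k"] by (auto simp: u_def l_def)
  have close: "(fnorm ip (u i - u k))\<^sup>2 \<le> 2 * (inverse (real (Suc i)) + inverse (real (Suc k)))" for i k
  proof -
    \<comment> \<open>Parallelogram law: the value of the functional at the midpoint is at least the infimum.\<close>
    have "(fscale (1/2) (u i + u k), (1/2) * (l i + l k)) \<in> G" using G(2,3) ul by blast
    from mle[OF this] have "4 * m \<le> (fnorm ip (u i + u k))\<^sup>2 - 4 * Re (l i + l k)"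
      by (simp add: J_def norm_scale[OF H_add[OF ul(2) ul(2)]] power_divide del: plus_complex.simps)
    moreover have "(fnorm ip (u i))\<^sup>2 - 2 * Re (l i) < m + inverse (real (Suc i))"
      "(fnorm ip (u k))\<^sup>2 - 2 * Re (l k) < m + inverse (real (Suc k))"
      using p(2) by (simp_all add: J_def u_def l_def)
    ultimately show ?thesis
      using norm_add_squared[OF ul(2) ul(2), of i k] norm_diff_squared[OF ul(2) ul(2), of i k]
      by (simp del: of_nat_Suc)
  qed
  have "\<exists>N. \<forall>i\<ge>N. \<forall>k\<ge>N. fnorm ip (u i - u k) < e" if e: "e > 0" for e
  proof -
    obtain N where N: "inverse (real (Suc N)) < e\<^sup>2 / 4"
      using reals_Archimedean[of "e\<^sup>2 / 4"] e by auto
    have "fnorm ip (u i - u k) < e" if "i \<ge> N" "k \<ge> N" for i k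
    proof -
      have "inverse (real (Suc i)) \<le> inverse (real (Suc N))" "inverse (real (Suc k)) \<le> inverse (real (Suc N))"
        using that by (auto intro!: le_imp_inverse_le)
      moreover have "2 * (a + b) < r" if "a \<le> c" "b \<le> c" "c < r / 4" for a b c r :: real
        using that by argo
      ultimately have "2 * (inverse (real (Suc i)) + inverse (real (Suc k))) < e\<^sup>2" using N by blast
      then have "(fnorm ip (u i - u k))\<^sup>2 < e\<^sup>2" using close[of i k] by (rule le_less_trans[rotated])
      then show ?thesis by (rule power2_less_imp_less) (use e in simp)
    qed
    then show ?thesis by blast
  qed
  then obtain g where g: "g \<in> H" "(\<lambda>i. fnorm ip (u i - g)) \<longlonglongrightarrow> 0"
    using complete ul(2) unfolding complete_on_def by blast
  have re: "Re (ip g v) = Re a" if va: "(v, a) \<in> G" for v a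
  proof -
    have v: "v \<in> H" using G(1)[OF va] .
    define D where "D = Re (ip g v) - Re a"
    have ineq: "0 \<le> 2 * t * D + t\<^sup>2 * (fnorm ip v)\<^sup>2" for t
    proof -
      have "- inverse (real (Suc k)) \<le> 2 * t * (Re (ip (u k) v) - Re a) + t\<^sup>2 * (fnorm ip v)\<^sup>2" for k
      proof -
        have tv: "fscale (of_real t) v \<in> H" using H_scale[OF v] .
        have "(u k + fscale (of_real t) v, l k + of_real t * a) \<in> G" using G(2,3) ul va by blast
        from mle[OF this]
        have "m \<le> (fnorm ip (u k))\<^sup>2 + t\<^sup>2 * (fnorm ip v)\<^sup>2 + 2 * (t * Re (ip (u k) v)) - 2 * Re (l k) - 2 * (t * Re a)"
          using norm_add_squared[OF ul(2) tv, of k] ip_scale_right[OF ul(2) v, of k "of_real t"]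
            norm_scale[OF v, of "of_real t"]
          by (simp add: J_def power_mult_distrib)
        then show ?thesis using p(2)[of k] by (simp add: J_def u_def l_def algebra_simps)
      qed
      moreover have "(\<lambda>k. ip (u k) v) \<longlonglongrightarrow> ip g v"
        by (rule ip_tendsto) (use ul(2) v g norm_zero in auto)
      then have "(\<lambda>k. 2 * t * (Re (ip (u k) v) - Re a) + t\<^sup>2 * (fnorm ip v)\<^sup>2) \<longlonglongrightarrow>
          2 * t * D + t\<^sup>2 * (fnorm ip v)\<^sup>2"
        unfolding D_def by (intro tendsto_intros)
      moreover have "(\<lambda>k. - inverse (real (Suc k))) \<longlonglongrightarrow> - 0"
        by (intro tendsto_minus LIMSEQ_inverse_real_of_nat)
      ultimately have "- 0 \<le> 2 * t * D + t\<^sup>2 * (fnorm ip v)\<^sup>2" by (intro LIMSEQ_le) blast+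
      then show ?thesis by simp
    qed
    define s where "s = (fnorm ip v)\<^sup>2 + 1"
    have s: "s > 0" unfolding s_def by (simp add: add_nonneg_pos)
    \<comment> \<open>The quadratic inequality is tested near its vertex; adding 1 in \<open>s\<close> avoids division by 0.\<close>
    have "(- D / s)\<^sup>2 * (fnorm ip v)\<^sup>2 \<le> (- D / s)\<^sup>2 * s"
      by (rule mult_left_mono) (simp_all add: s_def)
    then have "0 \<le> 2 * (- D / s) * D + (- D / s)\<^sup>2 * s"
      using ineq[of "- D / s"] by linarith
    also have "\<dots> = - (D\<^sup>2 / s)" using s by (simp add: power2_eq_square field_simps)
    finally have "D\<^sup>2 / s \<le> 0" by simp
    then have "D\<^sup>2 \<le> 0" using s by (simp add: divide_le_0_iff)
    then show ?thesis by (simp add: D_def)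
  qed
  have riesz: "ip v g = a" if va: "(v, a) \<in> G" for v a
  proof -
    have v: "v \<in> H" using G(1)[OF va] .
    have "Re (ip g (fscale \<i> v)) = Re (\<i> * a)" by (rule re[OF G(3)[OF va]])
    then have "Im (ip g v) = - Im a" by (simp add: ip_scale_right[OF g(1) v])
    then show ?thesis using re[OF va] ip_conj[OF g(1) v] by (simp add: complex_eq_iff)
  qed
  have "(fnorm ip g)\<^sup>2 \<le> C * fnorm ip g"
  proof (rule LIMSEQ_le)
    show "(\<lambda>k. cmod (ip (u k) g)) \<longlonglongrightarrow> (fnorm ip g)\<^sup>2"
      using tendsto_norm[OF ip_tendsto[of u "\<lambda>_. g" g g]] ul(2) g norm_zero
      by (simp add: ip_self_norm norm_power norm_nonneg)
    show "(\<lambda>k. C * (fnorm ip (u k - g) + fnorm ip g)) \<longlonglongrightarrow> C * fnorm ip g"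
      using tendsto_mult[OF tendsto_const tendsto_add[OF g(2) tendsto_const]] by simp
    have "cmod (ip (u k) g) \<le> C * (fnorm ip (u k - g) + fnorm ip g)" for k
    proof -
      have "fnorm ip (u k) \<le> fnorm ip (u k - g) + fnorm ip g"
        using norm_triangle[OF H_diff[OF ul(2) g(1)] g(1), of k] by simp
      then show ?thesis
        using bound[OF ul(1), of k] riesz[OF ul(1), of k] mult_left_mono[OF _ C] by fastforce
    qed
    then show "\<exists>N. \<forall>k\<ge>N. cmod (ip (u k) g) \<le> C * (fnorm ip (u k - g) + fnorm ip g)" by blast
  qed
  then have "fnorm ip g \<le> C"
    using norm_nonneg[OF g(1)] C by (cases "fnorm ip g = 0") (auto simp: power2_eq_square)
  then show ?thesis using g(1) riesz by blast
qed

lemma ip_right_eqI: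
  assumes "g \<in> H" "h \<in> H" "\<And>f. f \<in> H \<Longrightarrow> ip f g = ip f h"
  shows "g = h"
proof -
  have m: "g - h \<in> H" by (rule H_diff[OF assms(1,2)])
  have "ip (g - h) (g - h) = 0" using ip_diff_right[OF m assms(1,2)] assms(3)[OF m] by simp
  then have "fnorm ip (g - h) = 0" by (simp add: fnorm_def)
  then show ?thesis using norm_eq_0_iff[OF m] by simp
qed

lemma adjoint_on_eqI:
  assumes "g \<in> H" "h \<in> H" "\<And>f. f \<in> H \<Longrightarrow> ip (T f) g = ip f h"
  shows "adjoint_on H ip T g = h"
proof -
  have "(THE h. h \<in> H \<and> (\<forall>f\<in>H. ip (T f) g = ip f h)) = h"
  proof (rule the_equality)
    fix h' assume h': "h' \<in> H \<and> (\<forall>f\<in>H. ip (T f) g = ip f h')"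
    then show "h' = h" using assms(2,3) by (intro ip_right_eqI) auto
  qed (use assms in blast)
  then show ?thesis using assms(1) by (simp add: adjoint_on_def)
qed

text \<open>
  A value of \<open>adjoint_on\<close> is a definite description, so it has to be shown to exist; the Riesz theorem
  is applied to the functional \<open>f \<mapsto> \<langle>T f, g\<rangle>\<close>.
\<close>

lemma adjoint_on_bounded:
  assumes T: "\<And>f. f \<in> H \<Longrightarrow> T f \<in> H"
      "\<And>f g. f \<in> H \<Longrightarrow> g \<in> H \<Longrightarrow> T (f + g) = T f + T g"
      "\<And>c f. f \<in> H \<Longrightarrow> T (fscale c f) = fscale c (T f)"
      "\<And>f. f \<in> H \<Longrightarrow> fnorm ip (T f) \<le> C * fnorm ip f"
    and g: "g \<in> H"
  shows "adjoint_on H ip T g \<in> H" "f \<in> H \<Longrightarrow> ip (T f) g = ip f (adjoint_on H ip T g)"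
proof -
  have "\<exists>h\<in>H. fnorm ip h \<le> max 0 C * fnorm ip g \<and>
      (\<forall>u l. (u, l) \<in> (\<lambda>f. (f, ip (T f) g)) ` H \<longrightarrow> ip u h = l)"
  proof (rule riesz_graph)
    show "(u + v, l + a) \<in> (\<lambda>f. (f, ip (T f) g)) ` H"
      if ul: "(u, l) \<in> (\<lambda>f. (f, ip (T f) g)) ` H" and va: "(v, a) \<in> (\<lambda>f. (f, ip (T f) g)) ` H" for u l v a
    proof -
      have uv: "u \<in> H" "l = ip (T u) g" "v \<in> H" "a = ip (T v) g" using ul va by auto
      have "l + a = ip (T (u + v)) g"
        unfolding uv T(2)[OF uv(1,3)] ip_add_left[OF T(1)[OF uv(1)] T(1)[OF uv(3)] g] ..
      then show ?thesis using H_add[OF uv(1,3)] by blast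
    qed
    show "(fscale c u, c * l) \<in> (\<lambda>f. (f, ip (T f) g)) ` H"
      if ul: "(u, l) \<in> (\<lambda>f. (f, ip (T f) g)) ` H" for c u l
    proof -
      have u: "u \<in> H" "l = ip (T u) g" using ul by auto
      have "c * l = ip (T (fscale c u)) g"
        unfolding u T(3)[OF u(1)] ip_scale_left[OF T(1)[OF u(1)] g] ..
      then show ?thesis using H_scale[OF u(1)] by blast
    qed
    show "cmod l \<le> max 0 C * fnorm ip g * fnorm ip u"
      if ul: "(u, l) \<in> (\<lambda>f. (f, ip (T f) g)) ` H" for u l
    proof -
      have u: "u \<in> H" "l = ip (T u) g" using ul by auto
      have "cmod l \<le> fnorm ip (T u) * fnorm ip g" unfolding u by (rule Cauchy_Schwarz[OF T(1)[OF u(1)] g])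
      also have "\<dots> \<le> (max 0 C * fnorm ip u) * fnorm ip g"
      proof (rule mult_right_mono[OF _ norm_nonneg[OF g]])
        have "C * fnorm ip u \<le> max 0 C * fnorm ip u" by (rule mult_right_mono[OF _ norm_nonneg[OF u(1)]]) simp
        then show "fnorm ip (T u) \<le> max 0 C * fnorm ip u" using T(4)[OF u(1)] by linarith
      qed
      finally show ?thesis by (simp add: mult_ac)
    qed
    show "(\<lambda>f. (f, ip (T f) g)) ` H \<noteq> {}" using H_zero by blast
  qed (use norm_nonneg[OF g] in auto)
  then obtain h where h: "h \<in> H" "\<And>f. f \<in> H \<Longrightarrow> ip f h = ip (T f) g" by blast
  have "adjoint_on H ip T g = h" by (rule adjoint_on_eqI[OF g h(1)]) (simp add: h(2))
  then show "adjoint_on H ip T g \<in> H" "f \<in> H \<Longrightarrow> ip (T f) g = ip f (adjoint_on H ip T g)"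
    using h by simp_all
qed

definition orthonormal :: "nat \<Rightarrow> (nat \<Rightarrow> 'a \<Rightarrow> complex) \<Rightarrow> bool"
  where "orthonormal n e \<longleftrightarrow> (\<forall>i<n. e i \<in> H) \<and>
    (\<forall>i<n. \<forall>l<n. ip (e i) (e l) = (if i = l then 1 else 0))"

lemma orthonormal_norm: "orthonormal n e \<Longrightarrow> i < n \<Longrightarrow> fnorm ip (e i) = 1"
  by (simp add: orthonormal_def fnorm_def)

lemma orthonormal_mono: "orthonormal n e \<Longrightarrow> m \<le> n \<Longrightarrow> orthonormal m e"
  by (auto simp: orthonormal_def)

lemma orthonormal_span_expansion:
  assumes e: "orthonormal n e" and x: "x \<in> cfun.span (e ` {..<n})"
  shows "x = (\<Sum>i<n. fscale (ip x (e i)) (e i))"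
proof -
  let ?S = "{x \<in> H. x = (\<Sum>i<n. fscale (ip x (e i)) (e i))}"
  have eH: "e i \<in> H" if "i < n" for i using e that by (auto simp: orthonormal_def)
  have "cfun.span (e ` {..<n}) \<subseteq> ?S"
  proof (rule cfun.span_minimal)
    show "e ` {..<n} \<subseteq> ?S"
    proof (rule image_subsetI)
      fix i assume i: "i \<in> {..<n}"
      have "(\<Sum>l<n. fscale (ip (e i) (e l)) (e l)) = (\<Sum>l<n. if l = i then e l else 0)"
        by (rule sum.cong) (use e i in \<open>auto simp: orthonormal_def\<close>)
      then show "e i \<in> ?S" using i eH by simp
    qed
    show "cfun.subspace ?S"
    proof (rule cfun.subspaceI)
      show "0 \<in> ?S" using H_zero eH by (simp add: ip_zero_left)
    next
      fix x y assume xy: "x \<in> ?S" "y \<in> ?S"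
      have "(\<Sum>i<n. fscale (ip (x + y) (e i)) (e i)) =
          (\<Sum>i<n. fscale (ip x (e i)) (e i) + fscale (ip y (e i)) (e i))"
        by (rule sum.cong) (use xy eH in \<open>auto simp: ip_add_left cfun.scale_left_distrib\<close>)
      also have "\<dots> = x + y" unfolding sum.distrib using xy by simp
      finally show "x + y \<in> ?S" using xy H_add by simp
    next
      fix c x assume x: "x \<in> ?S"
      have "(\<Sum>i<n. fscale (ip (fscale c x) (e i)) (e i)) =
          (\<Sum>i<n. fscale c (fscale (ip x (e i)) (e i)))"
        by (rule sum.cong) (use x eH in \<open>auto simp: ip_scale_left\<close>)
      also have "\<dots> = fscale c x" unfolding cfun.scale_sum_right[symmetric] using x by simp
      finally show "fscale c x \<in> ?S" using x H_scale by simp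
    qed
  qed
  then show ?thesis using x by blast
qed

lemma ip_orthonormal_sum:
  assumes e: "orthonormal n e" and "l < n"
  shows "ip (\<Sum>i<n. fscale (c i) (e i)) (e l) = c l"
proof -
  have "ip (\<Sum>i<n. fscale (c i) (e i)) (e l) = (\<Sum>i<n. c i * ip (e i) (e l))"
    by (rule ip_sum_left) (use assms in \<open>auto simp: orthonormal_def\<close>)
  also have "\<dots> = (\<Sum>i<n. if i = l then c i else 0)"
    by (rule sum.cong) (use assms in \<open>auto simp: orthonormal_def\<close>)
  finally show ?thesis using assms by simp
qed

lemma orthonormal_independent:
  assumes e: "orthonormal n e"
  shows "inj_on e {..<n}" "cfun.independent (e ` {..<n})"
proof -
  show inj: "inj_on e {..<n}"
    using e unfolding orthonormal_def inj_on_def by (metis lessThan_iff zero_neq_one)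
  show "cfun.independent (e ` {..<n})"
  proof
    assume "cfun.dependent (e ` {..<n})"
    then obtain c v where c: "v \<in> e ` {..<n}" "c v \<noteq> 0" "(\<Sum>v\<in>e ` {..<n}. fscale (c v) v) = 0"
      using cfun.dependent_finite[of "e ` {..<n}"] by auto
    then obtain l where l: "l < n" "v = e l" by auto
    have "ip (\<Sum>i<n. fscale (c (e i)) (e i)) (e l) = c (e l)" by (rule ip_orthonormal_sum[OF e l(1)])
    moreover have "(\<Sum>i<n. fscale (c (e i)) (e i)) = 0" using c(3) by (simp add: sum.reindex[OF inj])
    moreover have "e l \<in> H" using e l by (auto simp: orthonormal_def)
    ultimately show False using c(2) l by (simp add: ip_zero_left)
  qed
qed

lemma finite_basis:
  assumes "cfun.dim V = n" "n \<ge> 1"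
  shows "\<exists>B. finite B \<and> card B = n \<and> V \<subseteq> cfun.span B"
proof -
  obtain B where B: "V \<subseteq> cfun.span B" "card B = cfun.dim V" by (rule cfun.basis_exists[of V])
  then have "finite B" using assms by (intro card_ge_0_finite) simp
  then show ?thesis using B assms(1) by blast
qed

text \<open>
  A vector outside the span would extend the orthonormal family to \<open>n + 1\<close> independent vectors in a
  space of dimension \<open>n\<close>.
\<close>

lemma orthonormal_expansion:
  assumes e: "orthonormal n e" and V: "\<And>i. i < n \<Longrightarrow> e i \<in> V" "cfun.dim V = n" "n \<ge> 1" "x \<in> V"
  shows "x = (\<Sum>i<n. fscale (ip x (e i)) (e i))"
proof (rule orthonormal_span_expansion[OF e], rule ccontr)
  assume "x \<notin> cfun.span (e ` {..<n})"
  then have ind: "cfun.independent (insert x (e ` {..<n}))" and "x \<notin> e ` {..<n}"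
    by (rule cfun.independent_insertI[OF _ orthonormal_independent(2)[OF e]])
      (metis \<open>x \<notin> cfun.span (e ` {..<n})\<close> cfun.span_base)
  then have card: "card (insert x (e ` {..<n})) = Suc n"
    using card_image[OF orthonormal_independent(1)[OF e]] by simp
  obtain B where B: "finite B" "card B = n" "V \<subseteq> cfun.span B" using finite_basis[OF V(2,3)] by blast
  have "insert x (e ` {..<n}) \<subseteq> cfun.span B" using V(1,4) B(3) by auto
  then show False using cfun.independent_span_bound[OF B(1) ind] card B(2) by simp
qed

text \<open>
  Simultaneous Schur triangularisation. Each new basis vector is a common eigenvector modulo the span of
  the previous ones, made orthogonal to that span and normalised. For \<open>A = 0\<close> this is Gram-Schmidt
  orthonormalisation.
\<close>

theorem orthonormal_triangular_basis:
  fixes A :: "'d::finite \<Rightarrow> ('a \<Rightarrow> complex) \<Rightarrow> 'a \<Rightarrow> complex"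
  assumes V: "cfun.subspace V" "V \<subseteq> H" "cfun.dim V = n" "n \<ge> 1"
    and A: "\<And>j. endomorphism_on V (A j)"
    and comm: "\<And>i j x. x \<in> V \<Longrightarrow> A i (A j x) = A j (A i x)"
  shows "\<exists>e. orthonormal n e \<and> (\<forall>i<n. e i \<in> V) \<and>
    (\<forall>j i l. i < l \<longrightarrow> l < n \<longrightarrow> ip (A j (e i)) (e l) = 0)"
proof -
  obtain B where B: "finite B" "card B = n" "V \<subseteq> cfun.span B" using finite_basis[OF V(3,4)] by blast
  have "\<exists>e. orthonormal k e \<and> (\<forall>i<k. e i \<in> V) \<and> (\<forall>j. \<forall>i<k. A j (e i) \<in> cfun.span (e ` {..i}))"
    if "k \<le> n" for k
    using that
  proof (induction k)
    case 0
    show ?case by (simp add: orthonormal_def)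
  next
    case (Suc k)
    then have "k \<le> n" by simp
    from Suc.IH[OF this] obtain e where e: "orthonormal k e" "\<And>i. i < k \<Longrightarrow> e i \<in> V"
      "\<And>j i. i < k \<Longrightarrow> A j (e i) \<in> cfun.span (e ` {..i})" by blast
    define W where "W = cfun.span (e ` {..<k})"
    have W: "cfun.subspace W" by (simp add: W_def)
    have WV: "W \<subseteq> V" unfolding W_def by (rule cfun.span_minimal[OF _ V(1)]) (use e(2) in auto)
    have AW: "A j x \<in> W" if x: "x \<in> W" for j x
    proof -
      have "x = (\<Sum>i<k. fscale (ip x (e i)) (e i))"
        using orthonormal_span_expansion[OF e(1)] x by (simp add: W_def)
      then have "A j x = A j (\<Sum>i<k. fscale (ip x (e i)) (e i))" by simp
      also have "\<dots> = (\<Sum>i<k. fscale (ip x (e i)) (A j (e i)))"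
        by (rule endomorphism_on_sum[OF A V(1)]) (use e(2) in auto)
      also have "\<dots> \<in> W"
      proof (intro cfun.subspace_sum[OF W] cfun.subspace_scale[OF W])
        fix i assume "i \<in> {..<k}"
        then have "A j (e i) \<in> cfun.span (e ` {..i})" "e ` {..i} \<subseteq> e ` {..<k}" using e(3) by auto
        then show "A j (e i) \<in> W" unfolding W_def using cfun.span_mono by blast
      qed
      finally show ?thesis .
    qed
    have nVW: "\<not> V \<subseteq> W"
    proof
      assume "V \<subseteq> W"
      then have "cfun.dim V \<le> card (e ` {..<k})" unfolding W_def by (intro cfun.dim_le_card) auto
      also have "\<dots> \<le> k" using card_image_le[of "{..<k}" e] by simp
      finally show False using V(3) Suc.prems by simp
    qed
    have "\<exists>c. \<exists>v\<in>V - W. \<forall>j\<in>UNIV. A j v - fscale (c j) v \<in> W"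
      by (rule common_eigenvector_modulo[OF finite V(1) W A AW comm B(1,3) WV nVW])
    then obtain c v where v: "v \<in> V" "v \<notin> W" "\<And>j. A j v - fscale (c j) v \<in> W" by blast
    have vH: "v \<in> H" using v(1) V(2) by blast
    define w where "w = (\<Sum>i<k. fscale (ip v (e i)) (e i))"
    have w: "w \<in> W"
      unfolding w_def W_def by (intro cfun.span_sum cfun.span_scale cfun.span_base) auto
    define y where "y = v - w"
    have vy: "v = y + w" by (simp add: y_def)
    have yV: "y \<in> V" using cfun.subspace_diff[OF V(1) v(1)] w WV by (auto simp: y_def)
    then have yH: "y \<in> H" using V(2) by blast
    have y0: "y \<noteq> 0" using v(2) w vy by auto
    have wH: "w \<in> H" using w WV V(2) by blast
    define r where "r = fnorm ip y"
    have r: "r > 0" using norm_nonneg[OF yH] norm_eq_0_iff[OF yH] y0 by (simp add: r_def)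
    define f where "f = fscale (of_real (1 / r)) y"
    have fV: "f \<in> V" and fH: "f \<in> H" using cfun.subspace_scale[OF V(1) yV] H_scale[OF yH] by (auto simp: f_def)
    have yf: "y = fscale (of_real r) f" using r by (simp add: f_def)
    have orth: "ip f (e i) = 0" if i: "i < k" for i
    proof -
      have eH: "e i \<in> H" using e(1) i by (auto simp: orthonormal_def)
      have "ip y (e i) = 0"
        unfolding y_def using ip_diff_left[OF vH wH eH] ip_orthonormal_sum[OF e(1) i, of "\<lambda>i. ip v (e i)"]
        by (simp add: w_def)
      then show ?thesis unfolding f_def using ip_scale_left[OF yH eH] by simp
    qed
    have ff: "ip f f = 1"
    proof -
      have "fnorm ip f = 1" unfolding f_def norm_scale[OF yH] norm_of_real r_def[symmetric] using r by simp
      then show ?thesis using ip_self_norm[OF fH] by simp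
    qed
    define e' where "e' = e(k := f)"
    have im: "e' ` {..k} = insert f (e ` {..<k})"
      unfolding e'_def by (force simp: image_iff le_less)
    have low: "e' ` {..i} = e ` {..i}" if "i < k" for i using that by (auto simp: e'_def)
    have Wsub: "W \<subseteq> cfun.span (e' ` {..k})" unfolding W_def im by (rule cfun.span_mono) auto
    have fs: "f \<in> cfun.span (e' ` {..k})" unfolding im by (rule cfun.span_base) simp
    have "orthonormal (Suc k) e'"
      unfolding orthonormal_def
    proof (intro conjI allI impI)
      show "e' i \<in> H" if "i < Suc k" for i using e(1) that fH by (auto simp: e'_def orthonormal_def)
      show "ip (e' i) (e' l) = (if i = l then 1 else 0)" if il: "i < Suc k" "l < Suc k" for i l
      proof -
        consider "i < k" "l < k" | "i < k" "l = k" | "i = k" "l < k" | "i = k" "l = k" using il by linarith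
        then show ?thesis
        proof cases
          case 2
          then have "ip (e i) f = cnj (ip f (e i))" using ip_conj[OF fH] e(1) by (auto simp: orthonormal_def)
          then show ?thesis using orth 2 by (simp add: e'_def)
        qed (use e(1) orth ff in \<open>auto simp: e'_def orthonormal_def\<close>)
      qed
    qed
    moreover have "\<forall>i<Suc k. e' i \<in> V" using e(2) fV by (auto simp: e'_def less_Suc_eq)
    moreover have "A j (e' i) \<in> cfun.span (e' ` {..i})" if i: "i < Suc k" for j i
    proof (cases "i < k")
      case True
      then show ?thesis using e(3)[OF True] low[OF True] by (simp add: e'_def)
    next
      case False
      let ?S = "cfun.span (e' ` {..k})"
      have ik: "i = k" using False i by simp
      have "v \<in> ?S" unfolding vy yf using w Wsub fs by (intro cfun.span_add cfun.span_scale) auto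
      then have "(A j v - fscale (c j) v) + fscale (c j) v \<in> ?S"
        using v(3) Wsub by (intro cfun.span_add cfun.span_scale) auto
      then have "A j v \<in> ?S" by simp
      moreover have "A j w \<in> ?S" using AW[OF w] Wsub by blast
      moreover have "A j y = A j v - A j w"
        unfolding y_def using endomorphism_on_diff[OF A V(1) v(1)] w WV by blast
      ultimately have "A j y \<in> ?S" using cfun.span_diff by metis
      moreover have "A j f = fscale (of_real (1 / r)) (A j y)"
        unfolding f_def by (rule endomorphism_onD(3)[OF A yV])
      ultimately have "A j f \<in> ?S" using cfun.span_scale by metis
      then show ?thesis by (simp add: e'_def ik)
    qed
    ultimately show ?case by blast
  qed
  from this[OF order_refl] obtain e where e: "orthonormal n e" "\<And>i. i < n \<Longrightarrow> e i \<in> V"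
    "\<And>j i. i < n \<Longrightarrow> A j (e i) \<in> cfun.span (e ` {..i})" by blast
  have "ip (A j (e i)) (e l) = 0" if il: "i < l" "l < n" for j i l
  proof -
    have "A j (e i) = (\<Sum>m<Suc i. fscale (ip (A j (e i)) (e m)) (e m))"
      using orthonormal_span_expansion[OF orthonormal_mono[OF e(1)], of "Suc i" "A j (e i)"] e(3)[of i j] il
      by (simp add: lessThan_Suc_atMost)
    then have "ip (A j (e i)) (e l) = ip (\<Sum>m<Suc i. fscale (ip (A j (e i)) (e m)) (e m)) (e l)" by simp
    also have "\<dots> = (\<Sum>m<Suc i. ip (A j (e i)) (e m) * ip (e m) (e l))"
      by (rule ip_sum_left) (use e(1) il in \<open>auto simp: orthonormal_def\<close>)
    also have "\<dots> = 0" by (rule sum.neutral) (use e(1) il in \<open>auto simp: orthonormal_def\<close>)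
    finally show ?thesis .
  qed
  then show ?thesis using e by blast
qed

end


section \<open>The spectrum of a triangular tuple\<close>

text \<open>
  A word \<open>(j\<^sub>1, c\<^sub>1) \<dots> (j\<^sub>k, c\<^sub>k)\<close> stands for the product of the operators \<open>A\<^sub>j - c\<close> of its letters.
  The monomials defining root subspaces are words, and so are the products with several different
  scalars that produce root vectors.
\<close>

definition apply_word :: "('d \<Rightarrow> ('a \<Rightarrow> complex) \<Rightarrow> 'a \<Rightarrow> complex) \<Rightarrow> ('d \<times> complex) list \<Rightarrow>
    ('a \<Rightarrow> complex) \<Rightarrow> 'a \<Rightarrow> complex"
  where "apply_word A w = foldr (\<lambda>(j, c) y. A j y - fscale c y) w"

lemma apply_word_simps [simp]:
  "apply_word A [] x = x"
  "apply_word A ((j, c) # w) x = A j (apply_word A w x) - fscale c (apply_word A w x)"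
  "apply_word A (v @ w) x = apply_word A v (apply_word A w x)"
  by (simp_all add: apply_word_def)

lemma tuple_power_eq_apply_word:
  "tuple_power (shifted A l) \<alpha> x =
    apply_word A (concat (map (\<lambda>j. replicate (\<alpha> j) (j, l $ j)) coords)) x"
proof -
  have pow: "(shifted A l j ^^ k) y = apply_word A (replicate k (j, l $ j)) y" for j k y
    by (induction k) (simp_all add: shifted_def)
  have "foldr (\<lambda>j T. (shifted A l j ^^ \<alpha> j) \<circ> T) js id x =
      apply_word A (concat (map (\<lambda>j. replicate (\<alpha> j) (j, l $ j)) js)) x" for js
    by (induction js) (simp_all add: pow)
  then show ?thesis by (simp add: tuple_power_def)
qed

lemma coords: "set (coords :: 'd::finite list) = UNIV" "distinct (coords :: 'd list)"
proof -
  have "\<exists>js :: 'd list. set js = UNIV \<and> distinct js" using finite_distinct_list[OF finite] by blast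
  from someI_ex[OF this] show "set (coords :: 'd list) = UNIV" "distinct (coords :: 'd list)"
    by (simp_all add: coords_def)
qed

lemma length_power_word:
  "length (concat (map (\<lambda>j. replicate (\<alpha> j) (f j)) (coords :: 'd::finite list))) = (\<Sum>j\<in>UNIV. \<alpha> j)"
  by (simp add: length_concat comp_def sum_list_distinct_conv_sum_set coords)

locale triangular_tuple = function_hilbert_space +
  fixes V :: "('a \<Rightarrow> complex) set" and A :: "'d::finite \<Rightarrow> ('a \<Rightarrow> complex) \<Rightarrow> 'a \<Rightarrow> complex"
    and n :: nat and e :: "nat \<Rightarrow> 'a \<Rightarrow> complex"
  assumes V: "cfun.subspace V" "V \<subseteq> H" "cfun.dim V = n" "n \<ge> 1"
    and A: "\<And>j. endomorphism_on V (A j)"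
    and comm: "\<And>i j x. x \<in> V \<Longrightarrow> A i (A j x) = A j (A i x)"
    and e: "orthonormal n e" "\<And>i. i < n \<Longrightarrow> e i \<in> V"
    and triangular: "\<And>j i l. i < l \<Longrightarrow> l < n \<Longrightarrow> ip (A j (e i)) (e l) = 0"
begin

definition diagonal :: "nat \<Rightarrow> complex ^ 'd"
  where "diagonal i = (\<chi> j. ip (A j (e i)) (e i))"

text \<open>
  The levels are the spans of the first \<open>i\<close> basis vectors, described by their vanishing coordinates.
\<close>

definition level :: "nat \<Rightarrow> ('a \<Rightarrow> complex) set"
  where "level i = {x \<in> V. \<forall>l<n. i \<le> l \<longrightarrow> ip x (e l) = 0}"

lemma e_H: "i < n \<Longrightarrow> e i \<in> H"
  using e(1) by (auto simp: orthonormal_def)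

lemma V_H: "x \<in> V \<Longrightarrow> x \<in> H"
  using V(2) by blast

lemma expansion: "x \<in> V \<Longrightarrow> x = (\<Sum>i<n. fscale (ip x (e i)) (e i))"
  by (rule orthonormal_expansion[OF e V(3,4)])

lemma level_0: "x \<in> level 0 \<Longrightarrow> x = 0"
  using expansion[of x] by (simp add: level_def)

lemma top_coordinate:
  assumes "x \<in> V" "x \<noteq> 0"
  obtains i where "i < n" "ip x (e i) \<noteq> 0" "x \<in> level (Suc i)"
proof -
  let ?I = "{i. i < n \<and> ip x (e i) \<noteq> 0}"
  have "?I \<noteq> {}" using level_0[of x] assms by (auto simp: level_def)
  moreover have fin: "finite ?I" by simp
  ultimately have "Max ?I \<in> ?I" by (rule Max_in[rotated])
  moreover have "x \<in> level (Suc (Max ?I))"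
    unfolding level_def
  proof (intro CollectI conjI assms(1) allI impI, rule ccontr)
    fix l assume l: "l < n" "Suc (Max ?I) \<le> l" "ip x (e l) \<noteq> 0"
    then have "l \<le> Max ?I" by (intro Max_ge[OF fin]) simp
    then show False using l(2) by simp
  qed
  ultimately show thesis using that by blast
qed

lemma A_level:
  assumes "x \<in> level (Suc i)" "i < n"
  shows "A j x \<in> level (Suc i)" "ip (A j x) (e i) = diagonal i $ j * ip x (e i)"
proof -
  have x: "x \<in> V" using assms by (simp add: level_def)
  have AV: "A j y \<in> V" if "y \<in> V" for y using endomorphism_onD(1)[OF A that] .
  have coord: "ip (A j x) (e l) = (\<Sum>m<n. ip x (e m) * ip (A j (e m)) (e l))" if l: "l < n" for l
  proof -
    have "A j x = A j (\<Sum>m<n. fscale (ip x (e m)) (e m))" using expansion[OF x] by simp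
    also have "\<dots> = (\<Sum>m<n. fscale (ip x (e m)) (A j (e m)))"
      by (rule endomorphism_on_sum[OF A V(1)]) (use e(2) in auto)
    finally have "ip (A j x) (e l) = ip (\<Sum>m<n. fscale (ip x (e m)) (A j (e m))) (e l)" by simp
    also have "\<dots> = (\<Sum>m<n. ip x (e m) * ip (A j (e m)) (e l))"
      by (rule ip_sum_left) (use AV e(2) V_H e_H l in auto)
    finally show ?thesis .
  qed
  have "ip (A j x) (e l) = 0" if l: "l < n" "Suc i \<le> l" for l
    unfolding coord[OF l(1)]
  proof (rule sum.neutral, rule ballI)
    fix m assume "m \<in> {..<n}"
    then show "ip x (e m) * ip (A j (e m)) (e l) = 0"
      using assms l triangular[of m l j] by (cases "Suc i \<le> m") (auto simp: level_def)
  qed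
  then show "A j x \<in> level (Suc i)" using AV[OF x] by (simp add: level_def)
  have "ip (A j x) (e i) = (\<Sum>m<n. if m = i then diagonal i $ j * ip x (e i) else 0)"
    unfolding coord[OF assms(2)]
  proof (rule sum.cong[OF refl])
    fix m assume m: "m \<in> {..<n}"
    consider "m = i" | "m < i" | "Suc i \<le> m" by linarith
    then show "ip x (e m) * ip (A j (e m)) (e i) = (if m = i then diagonal i $ j * ip x (e i) else 0)"
    proof cases
      case 2
      then show ?thesis using triangular[of m i j] assms(2) by simp
    next
      case 3
      then show ?thesis using assms(1) m by (simp add: level_def)
    qed (simp add: diagonal_def)
  qed
  then show "ip (A j x) (e i) = diagonal i $ j * ip x (e i)" using assms(2) by simp
qed

lemma letter_level:
  assumes x: "x \<in> level (Suc i)" and i: "i < n"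
  shows "A j x - fscale c x \<in> level (Suc i)"
    "ip (A j x - fscale c x) (e i) = (diagonal i $ j - c) * ip x (e i)"
proof -
  have m: "x \<in> V" "A j x \<in> V" "fscale c x \<in> V"
    using x endomorphism_onD(1)[OF A] cfun.subspace_scale[OF V(1)] by (auto simp: level_def)
  have ip: "ip (A j x - fscale c x) (e l) = ip (A j x) (e l) - c * ip x (e l)" if "l < n" for l
    using ip_diff_left[OF m(2,3)[THEN V_H] e_H[OF that]] ip_scale_left[OF V_H[OF m(1)] e_H[OF that]] by simp
  show "A j x - fscale c x \<in> level (Suc i)"
    using A_level(1)[OF x i, of j] x cfun.subspace_diff[OF V(1) m(2,3)] ip by (simp add: level_def)
  show "ip (A j x - fscale c x) (e i) = (diagonal i $ j - c) * ip x (e i)"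
    using ip[OF i] A_level(2)[OF x i] by (simp add: algebra_simps)
qed

text \<open>
  Subtracting the diagonal entry makes a triangular operator lower the level by one.
\<close>

lemma letter_lowers:
  assumes x: "x \<in> level (Suc i)" and i: "i < n" and c: "c = diagonal i $ j"
  shows "A j x - fscale c x \<in> level i"
proof -
  have "A j x - fscale c x \<in> level (Suc i)" "ip (A j x - fscale c x) (e i) = 0"
    using letter_level[OF x i] c by simp_all
  then show ?thesis by (auto simp: level_def Suc_le_eq le_less)
qed

lemma apply_word_level:
  assumes "x \<in> level (Suc i)" "i < n"
  shows "apply_word A w x \<in> level (Suc i) \<and>
    ip (apply_word A w x) (e i) = (\<Prod>(j, c)\<leftarrow>w. diagonal i $ j - c) * ip x (e i)"
proof (induction w)
  case (Cons a w)
  obtain j c where a: "a = (j, c)" by force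
  define y where "y = apply_word A w x"
  have aw: "apply_word A (a # w) x = A j y - fscale c y" by (simp add: a y_def)
  have "ip (apply_word A (a # w) x) (e i) = (\<Prod>(j, c)\<leftarrow>a # w. diagonal i $ j - c) * ip x (e i)"
    unfolding aw using letter_level(2)[OF _ assms(2), of y j c] Cons.IH by (simp add: a y_def)
  moreover have "apply_word A (a # w) x \<in> level (Suc i)"
    unfolding aw using letter_level(1)[OF _ assms(2), of y j c] Cons.IH by (simp add: y_def)
  ultimately show ?case by blast
qed (simp add: assms)

lemma apply_word_endomorphism: "endomorphism_on V (apply_word A w)"
proof (induction w)
  case (Cons a w)
  obtain j c where a: "a = (j, c)" by force
  note IH = endomorphism_onD[OF Cons.IH] and Aj = endomorphism_onD[OF A]
  have "endomorphism_on V (apply_word A ((j, c) # w))"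
    unfolding endomorphism_on_def apply_word_simps
  proof (intro conjI ballI allI)
    fix x assume x: "x \<in> V"
    show "A j (apply_word A w x) - fscale c (apply_word A w x) \<in> V"
      by (intro cfun.subspace_diff[OF V(1)] cfun.subspace_scale[OF V(1)] Aj(1) IH(1) x)
    show "A j (apply_word A w (fscale b x)) - fscale c (apply_word A w (fscale b x)) =
        fscale b (A j (apply_word A w x) - fscale c (apply_word A w x))" for b
      unfolding IH(3)[OF x] Aj(3)[OF IH(1)[OF x]] by (simp add: fscale_def fun_eq_iff algebra_simps)
    show "A j (apply_word A w (x + y)) - fscale c (apply_word A w (x + y)) =
        A j (apply_word A w x) - fscale c (apply_word A w x) +
        (A j (apply_word A w y) - fscale c (apply_word A w y))" if y: "y \<in> V" for y
      unfolding IH(2)[OF x y] Aj(2)[OF IH(1)[OF x] IH(1)[OF y]]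
      by (simp add: fscale_def fun_eq_iff algebra_simps)
  qed
  then show ?case unfolding a .
qed (simp add: endomorphism_on_def)

lemma apply_word_commute:
  assumes "x \<in> V"
  shows "apply_word A w (A j x - fscale c x) = A j (apply_word A w x) - fscale c (apply_word A w x)"
proof (induction w)
  case (Cons a w)
  obtain k b where a: "a = (k, b)" by force
  define y where "y = apply_word A w x"
  have y: "y \<in> V" unfolding y_def by (rule endomorphism_onD(1)[OF apply_word_endomorphism assms])
  have m: "A i y \<in> V" "fscale t y \<in> V" for i t
    using endomorphism_onD(1)[OF A y] cfun.subspace_scale[OF V(1) y] by auto
  have "A k (A j y - fscale c y) - fscale b (A j y - fscale c y) =
      A j (A k y - fscale b y) - fscale c (A k y - fscale b y)"
    unfolding endomorphism_on_diff[OF A V(1) m] endomorphism_onD(3)[OF A y] comm[OF y, of k j]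
    by (simp add: fscale_def fun_eq_iff algebra_simps)
  then show "apply_word A (a # w) (A j x - fscale c x) =
      A j (apply_word A (a # w) x) - fscale c (apply_word A (a # w) x)"
    unfolding a apply_word_simps Cons.IH y_def .
qed simp

text \<open>
  One factor for each position below \<open>i\<close> whose diagonal point differs from \<open>l\<close>. The factor vanishes on the
  diagonal at this position, and its coordinate is chosen so that it does not vanish on the diagonal at the
  positions belonging to \<open>l\<close>.
\<close>

primrec killing_word :: "complex ^ 'd \<Rightarrow> nat \<Rightarrow> ('d \<times> complex) list"
  where "killing_word l 0 = []"
  | "killing_word l (Suc i) = (if diagonal i = l then killing_word l i else
      killing_word l i @ [let j = SOME j. diagonal i $ j \<noteq> l $ j in (j, diagonal i $ j)])"

lemma killing_word_letters: "(j, c) \<in> set (killing_word l i) \<Longrightarrow> c \<noteq> l $ j"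
proof (induction i)
  case (Suc i)
  have "diagonal i $ (SOME j. diagonal i $ j \<noteq> l $ j) \<noteq> l $ (SOME j. diagonal i $ j \<noteq> l $ j)"
    if "diagonal i \<noteq> l"
    using that someI_ex[of "\<lambda>j. diagonal i $ j \<noteq> l $ j"] by (auto simp: vec_eq_iff)
  then show ?case using Suc by (auto simp: Let_def split: if_splits)
qed simp

text \<open>
  The argument of the Cayley-Hamilton theorem: from the top down, each position of the basis is removed by
  a factor that vanishes on the diagonal there. Positions with diagonal point \<open>l\<close> use up a letter of \<open>u\<close>,
  the others a letter of the killing word; commutativity brings the required letter to the front.
\<close>

lemma killing_word_kills:
  assumes "x \<in> level i" "i \<le> n" "set u \<subseteq> range (\<lambda>j. (j, l $ j))"
    "card {m. m < i \<and> diagonal m = l} \<le> length u"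
  shows "apply_word A (u @ killing_word l i) x = 0"
  using assms
proof (induction i arbitrary: x u)
  case 0
  then have "x = 0" using level_0 by simp
  then show "apply_word A (u @ killing_word l 0) x = 0"
    using endomorphism_on_zero[OF apply_word_endomorphism V(1)] by simp
next
  case (Suc i)
  have i: "i < n" using Suc.prems by simp
  have x: "x \<in> V" using Suc.prems by (simp add: level_def)
  show "apply_word A (u @ killing_word l (Suc i)) x = 0"
  proof (cases "diagonal i = l")
    case True
    have "{m. m < Suc i \<and> diagonal m = l} = insert i {m. m < i \<and> diagonal m = l}"
      using True by (auto simp: less_Suc_eq)
    then have card: "Suc (card {m. m < i \<and> diagonal m = l}) \<le> length u" using Suc.prems(4) by simp
    then obtain u' a where u: "u = u' @ [a]" by (cases u rule: rev_cases) auto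
    then obtain j where a: "a = (j, l $ j)" using Suc.prems(3) by auto
    have "A j x - fscale (l $ j) x \<in> level i" using letter_lowers[OF Suc.prems(1) i] True by simp
    then have "apply_word A (u' @ killing_word l i) (A j x - fscale (l $ j) x) = 0"
      by (rule Suc.IH) (use Suc.prems(2,3) card u in auto)
    then show ?thesis using True apply_word_commute[OF x] by (simp add: u a)
  next
    case False
    have "{m. m < Suc i \<and> diagonal m = l} = {m. m < i \<and> diagonal m = l}"
      using False by (auto simp: less_Suc_eq)
    then have "apply_word A (u @ killing_word l i) (A j x - fscale (diagonal i $ j) x) = 0" for j
      by (intro Suc.IH letter_lowers[OF Suc.prems(1) i refl]) (use Suc.prems in simp_all)
    then show ?thesis using False by (simp add: Let_def)
  qed
qed

lemma root_subspaceI: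
  assumes "x \<in> V" "\<And>u. set u \<subseteq> range (\<lambda>j. (j, l $ j)) \<Longrightarrow> length u = n \<Longrightarrow> apply_word A u x = 0"
  shows "x \<in> root_subspace V A l"
  unfolding root_subspace_def
proof (intro INT_I CollectI conjI assms(1))
  fix \<alpha> :: "'d \<Rightarrow> nat" assume "\<alpha> \<in> {\<alpha>. (\<Sum>j\<in>UNIV. \<alpha> j) = cfun.dim V}"
  then show "tuple_power (shifted A l) \<alpha> x = 0"
    unfolding tuple_power_eq_apply_word
    by (intro assms(2)) (auto simp: length_power_word V(3) simp del: length_concat)
qed

lemma root_subspaceD:
  assumes "x \<in> root_subspace V A l"
  shows "x \<in> V" "apply_word A (replicate n (j, l $ j)) x = 0"
proof -
  define \<alpha> where "\<alpha> i = (if i = j then n else 0)" for i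
  have sum: "(\<Sum>i\<in>UNIV. \<alpha> i) = cfun.dim V" by (simp add: \<alpha>_def V(3))
  then have x: "x \<in> V \<and> tuple_power (shifted A l) \<alpha> x = 0"
    using assms by (auto simp: root_subspace_def)
  then show "x \<in> V" by simp
  let ?w = "concat (map (\<lambda>i. replicate (\<alpha> i) (i, l $ i)) coords)"
  have "length ?w = n" unfolding length_power_word using sum V(3) by simp
  moreover have "\<forall>a\<in>set ?w. a = (j, l $ j)" by (auto simp: \<alpha>_def split: if_splits)
  ultimately have "?w = replicate n (j, l $ j)" by (intro replicate_eqI) blast+
  then show "apply_word A (replicate n (j, l $ j)) x = 0"
    using x unfolding tuple_power_eq_apply_word by simp
qed

lemma subspace_root_subspace: "cfun.subspace (root_subspace V A l)"
proof -
  have "tuple_power (shifted A l) \<alpha> = apply_word A (concat (map (\<lambda>j. replicate (\<alpha> j) (j, l $ j)) coords))" for \<alpha>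
    by (rule ext) (rule tuple_power_eq_apply_word)
  then have T: "endomorphism_on V (tuple_power (shifted A l) \<alpha>)" for \<alpha>
    using apply_word_endomorphism by simp
  show ?thesis
    unfolding root_subspace_def
  proof (rule cfun.subspace_Inter, rule ballI, elim imageE, hypsubst)
    fix \<alpha> :: "'d \<Rightarrow> nat"
    show "cfun.subspace {f \<in> V. tuple_power (shifted A l) \<alpha> f = 0}"
      by (rule cfun.subspaceI)
        (use endomorphism_onD[OF T] endomorphism_on_zero[OF T V(1)] cfun.subspace_0[OF V(1)]
          cfun.subspace_add[OF V(1)] cfun.subspace_scale[OF V(1)] in auto)
  qed
qed

text \<open>
  At the topmost nonzero coordinate of \<open>x\<close>, a power of \<open>A\<^sub>j - l\<^sub>j\<close> multiplies by a power of the difference of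
  the diagonal entries. As it annihilates \<open>x\<close>, the diagonal point at that position is \<open>l\<close>.
\<close>

lemma root_subspace_eq_0:
  assumes x: "x \<in> root_subspace V A l" and 0: "\<And>i. i < n \<Longrightarrow> diagonal i = l \<Longrightarrow> ip x (e i) = 0"
  shows "x = 0"
proof (rule ccontr)
  assume "x \<noteq> 0"
  then obtain i where i: "i < n" "ip x (e i) \<noteq> 0" "x \<in> level (Suc i)"
    using top_coordinate root_subspaceD(1)[OF x] by blast
  then obtain j where j: "diagonal i $ j \<noteq> l $ j" using 0 by (auto simp: vec_eq_iff)
  have "ip (apply_word A (replicate n (j, l $ j)) x) (e i) = (diagonal i $ j - l $ j) ^ n * ip x (e i)"
    using apply_word_level[OF i(3,1), of "replicate n (j, l $ j)"] by (simp add: prod_list_replicate)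
  moreover have "\<dots> \<noteq> 0" using i(2) j by simp
  ultimately show False using root_subspaceD(2)[OF x] ip_zero_left[OF e_H[OF i(1)]] by simp
qed

text \<open>
  The killing word for \<open>l\<close>, applied to \<open>e i\<close>, leaves a root vector, and its coordinate at position \<open>i\<close>
  survives.
\<close>

lemma root_vector:
  assumes "i < n" "diagonal i = l"
  shows "\<exists>g. g \<in> root_subspace V A l \<and> g \<in> level (Suc i) \<and> ip g (e i) \<noteq> 0 \<and>
    (\<forall>u. set u \<subseteq> range (\<lambda>j. (j, l $ j)) \<longrightarrow> length u = n \<longrightarrow> apply_word A u g = 0)"
proof -
  define g where "g = apply_word A (killing_word l n) (e i)"
  have ei: "e i \<in> level (Suc i)" "e i \<in> level n"
    using e assms(1) by (auto simp: level_def orthonormal_def)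
  have "{m. m < n \<and> diagonal m = l} \<subseteq> {..<n}" by auto
  then have "card {m. m < n \<and> diagonal m = l} \<le> n" using card_mono[of "{..<n}"] by fastforce
  then have kill: "apply_word A u g = 0" if "set u \<subseteq> range (\<lambda>j. (j, l $ j))" "length u = n" for u
    using killing_word_kills[OF ei(2) order_refl that(1)] that(2) by (simp add: g_def)
  have gV: "g \<in> V" unfolding g_def by (rule endomorphism_onD(1)[OF apply_word_endomorphism e(2)[OF assms(1)]])
  have "ip g (e i) = (\<Prod>(j, c)\<leftarrow>killing_word l n. diagonal i $ j - c)"
    using apply_word_level[OF ei(1) assms(1)] e(1) assms(1) by (simp add: g_def orthonormal_def)
  also have "\<dots> \<noteq> 0"
  proof
    assume "(\<Prod>(j, c)\<leftarrow>killing_word l n. diagonal i $ j - c) = 0"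
    then obtain j c where jc: "(j, c) \<in> set (killing_word l n)" "diagonal i $ j - c = 0"
      by (auto simp: prod_list_zero_iff)
    show False using killing_word_letters[OF jc(1)] jc(2) assms(2) by simp
  qed
  finally have "ip g (e i) \<noteq> 0" .
  moreover have "g \<in> level (Suc i)" using apply_word_level[OF ei(1) assms(1)] by (simp add: g_def)
  ultimately show ?thesis using root_subspaceI[OF gV] kill by blast
qed

text \<open>
  The root vectors at the positions belonging to \<open>l\<close> have different top positions, hence are
  independent. Subtracting multiples of them removes the coordinates of a root vector at these positions,
  from the top down, and then nothing is left.
\<close>

lemma dim_root_subspace: "cfun.dim (root_subspace V A l) = card {i. i < n \<and> diagonal i = l}"
proof -
  let ?R = "root_subspace V A l"
  define I where "I = {i. i < n \<and> diagonal i = l}"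
  have I: "finite I" "\<And>i. i \<in> I \<Longrightarrow> i < n" by (auto simp: I_def)
  have "\<forall>i\<in>I. \<exists>g. g \<in> ?R \<and> g \<in> level (Suc i) \<and> ip g (e i) \<noteq> 0"
    using root_vector[of _ l] unfolding I_def by blast
  then obtain g where g: "\<And>i. i \<in> I \<Longrightarrow> g i \<in> ?R" "\<And>i. i \<in> I \<Longrightarrow> g i \<in> level (Suc i)"
    "\<And>i. i \<in> I \<Longrightarrow> ip (g i) (e i) \<noteq> 0" by metis
  have gH: "g i \<in> H" if "i \<in> I" for i using V_H root_subspaceD(1)[OF g(1)[OF that]] by blast
  have above: "ip (g i) (e k) = 0" if "i \<in> I" "i < k" "k < n" for i k
    using g(2)[OF that(1)] that by (simp add: level_def)
  have inj: "inj_on g I"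
  proof (rule linorder_inj_onI')
    fix i k assume "i \<in> I" "k \<in> I" "i < k"
    then show "g i \<noteq> g k" using above[of i k] g(3)[of k] I(2) by metis
  qed
  have "cfun.independent (g ` I)"
  proof
    assume "cfun.dependent (g ` I)"
    then obtain c v where c: "v \<in> g ` I" "c v \<noteq> 0" "(\<Sum>v\<in>g ` I. fscale (c v) v) = 0"
      using cfun.dependent_finite[of "g ` I"] I(1) by auto
    let ?K = "{i \<in> I. c (g i) \<noteq> 0}"
    have "?K \<noteq> {}" "finite ?K" using c I(1) by auto
    then have K: "Max ?K \<in> ?K" "\<And>i. i \<in> ?K \<Longrightarrow> i \<le> Max ?K" by (auto intro: Max_in Max_ge simp del: mem_Collect_eq)
    define k where "k = Max ?K"
    have k: "k \<in> I" "c (g k) \<noteq> 0" "\<And>i. i \<in> I \<Longrightarrow> k < i \<Longrightarrow> c (g i) = 0"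
      using K unfolding k_def[symmetric] by force+
    have "ip (\<Sum>i\<in>I. fscale (c (g i)) (g i)) (e k) = (\<Sum>i\<in>I. c (g i) * ip (g i) (e k))"
      by (rule ip_sum_left) (use gH e_H I(2) k in auto)
    also have "\<dots> = (\<Sum>i\<in>I. if i = k then c (g k) * ip (g k) (e k) else 0)"
    proof (rule sum.cong[OF refl])
      fix i assume i: "i \<in> I"
      show "c (g i) * ip (g i) (e k) = (if i = k then c (g k) * ip (g k) (e k) else 0)"
        using k(3)[OF i] above[OF i _ I(2)[OF k(1)]] by (cases i k rule: linorder_cases) auto
    qed
    also have "\<dots> = c (g k) * ip (g k) (e k)" using I(1) k(1) by simp
    finally have "ip (\<Sum>i\<in>I. fscale (c (g i)) (g i)) (e k) \<noteq> 0" using k g(3) by simp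
    then show False using c(3) ip_zero_left[OF e_H[OF I(2)[OF k(1)]]] by (simp add: sum.reindex[OF inj])
  qed
  moreover have "?R \<subseteq> cfun.span (g ` I)"
  proof
    fix x assume x: "x \<in> ?R"
    \<comment> \<open>The coordinates at positions in \<open>I\<close> are removed from \<open>n\<close> down to \<open>k\<close>.\<close>
    have "\<exists>s\<in>cfun.span (g ` I). x - s \<in> ?R \<and> (\<forall>i\<in>I. k \<le> i \<longrightarrow> ip (x - s) (e i) = 0)" if "k \<le> n" for k
      using that
    proof (induction rule: inc_induct)
      case base
      have "\<forall>i\<in>I. n \<le> i \<longrightarrow> ip (x - 0) (e i) = 0" using I(2) by fastforce
      then show ?case using x cfun.span_zero[of "g ` I"] by (intro bexI[of _ 0] conjI) simp_all
    next
      case (step k)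
      then obtain s where s: "s \<in> cfun.span (g ` I)" "x - s \<in> ?R"
        "\<And>i. i \<in> I \<Longrightarrow> Suc k \<le> i \<Longrightarrow> ip (x - s) (e i) = 0" by blast
      show ?case
      proof (cases "k \<in> I")
        case False
        then have "\<forall>i\<in>I. k \<le> i \<longrightarrow> ip (x - s) (e i) = 0" using s(3) by (metis le_neq_implies_less Suc_leI)
        then show ?thesis using s by blast
      next
        case True
        define c where "c = ip (x - s) (e k) / ip (g k) (e k)"
        have cg: "fscale c (g k) \<in> ?R" by (rule cfun.subspace_scale[OF subspace_root_subspace g(1)[OF True]])
        have eq: "x - (s + fscale c (g k)) = (x - s) - fscale c (g k)" by (simp add: algebra_simps)
        have "x - (s + fscale c (g k)) \<in> ?R"
          unfolding eq by (rule cfun.subspace_diff[OF subspace_root_subspace s(2) cg])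
        moreover have "s + fscale c (g k) \<in> cfun.span (g ` I)"
          using cfun.span_add[OF s(1) cfun.span_scale[OF cfun.span_base]] True by blast
        moreover have "ip (x - (s + fscale c (g k))) (e i) = 0" if i: "i \<in> I" "k \<le> i" for i
        proof -
          have "ip (x - (s + fscale c (g k))) (e i) = ip (x - s) (e i) - c * ip (g k) (e i)"
            unfolding eq
            using ip_diff_left[OF V_H[OF root_subspaceD(1)[OF s(2)]] V_H[OF root_subspaceD(1)[OF cg]] e_H[OF I(2)[OF i(1)]]]
              ip_scale_left[OF gH[OF True] e_H[OF I(2)[OF i(1)]]] by simp
          also have "\<dots> = 0"
          proof (cases "i = k")
            case True
            then show ?thesis using g(3) i by (simp add: c_def)
          next
            case False
            then show ?thesis using s(3)[OF i(1)] above[OF True _ I(2)[OF i(1)]] i(2) by simp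
          qed
          finally show ?thesis .
        qed
        ultimately show ?thesis by blast
      qed
    qed
    from this[of 0] obtain s where s: "s \<in> cfun.span (g ` I)" "x - s \<in> ?R" "\<And>i. i \<in> I \<Longrightarrow> ip (x - s) (e i) = 0"
      by auto
    have "x - s = 0" by (rule root_subspace_eq_0[OF s(2)]) (use s(3) in \<open>auto simp: I_def\<close>)
    then show "x \<in> cfun.span (g ` I)" using s(1) by simp
  qed
  moreover have "g ` I \<subseteq> ?R" using g(1) by blast
  ultimately show ?thesis
    using cfun.dim_unique[of "g ` I" ?R "card I"] card_image[OF inj] by (simp add: I_def)
qed

text \<open>
  A root vector becomes a common eigenvector under a longest word in the operators \<open>A\<^sub>j - l\<^sub>j\<close> that does not
  annihilate it.
\<close>

lemma joint_spectrum_eq: "joint_spectrum V A = diagonal ` {..<n}"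
proof (intro set_eqI iffI)
  fix l assume l: "l \<in> joint_spectrum V A"
  define E where "E = (\<Inter>j. {f \<in> V. shifted A l j f = 0})"
  have "0 \<in> E"
    using cfun.subspace_0[OF V(1)] endomorphism_on_zero[OF A V(1)] by (simp add: shifted_def E_def)
  moreover have "E \<noteq> {0}" using l by (simp add: joint_spectrum_def E_def)
  ultimately obtain f where f: "f \<noteq> 0" "f \<in> E" by blast
  then have "f \<in> V \<and> shifted A l j f = 0" for j unfolding E_def INT_iff mem_Collect_eq by blast
  then have fV: "f \<in> V" and eig: "A j f - fscale (l $ j) f = 0" for j unfolding shifted_def by blast+
  obtain i where i: "i < n" "ip f (e i) \<noteq> 0" "f \<in> level (Suc i)" using top_coordinate[OF fV f(1)] .
  have "(diagonal i $ j - l $ j) * ip f (e i) = 0" for j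
    using letter_level(2)[OF i(3,1), of j "l $ j"] eig[of j] ip_zero_left[OF e_H[OF i(1)]] by simp
  then have "diagonal i = l" using i(2) by (simp add: vec_eq_iff)
  then show "l \<in> diagonal ` {..<n}" using i(1) by auto
next
  fix l assume "l \<in> diagonal ` {..<n}"
  then obtain i where i: "i < n" "diagonal i = l" by auto
  obtain g where g: "g \<in> root_subspace V A l" "ip g (e i) \<noteq> 0"
    "\<And>u. set u \<subseteq> range (\<lambda>j. (j, l $ j)) \<Longrightarrow> length u = n \<Longrightarrow> apply_word A u g = 0"
    using root_vector[OF i] by blast
  define Q where "Q m \<longleftrightarrow> (\<exists>u. set u \<subseteq> range (\<lambda>j. (j, l $ j)) \<and> length u = m \<and> apply_word A u g \<noteq> 0)" for m
  have "g \<noteq> 0" using g(2) ip_zero_left[OF e_H[OF i(1)]] by auto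
  then have "Q 0" by (simp add: Q_def)
  moreover have "\<not> Q n" using g(3) by (auto simp: Q_def)
  ultimately obtain m where m: "Q m" "\<not> Q (Suc m)" by (metis nat_induct)
  then obtain u where u: "set u \<subseteq> range (\<lambda>j. (j, l $ j))" "length u = m" "apply_word A u g \<noteq> 0"
    by (auto simp: Q_def)
  have "A j (apply_word A u g) - fscale (l $ j) (apply_word A u g) = 0" for j
  proof (rule ccontr)
    assume "\<not> ?thesis"
    then have "apply_word A ((j, l $ j) # u) g \<noteq> 0" by simp
    then have "Q (Suc m)" unfolding Q_def using u by (intro exI[of _ "(j, l $ j) # u"]) auto
    then show False using m by blast
  qed
  moreover have "apply_word A u g \<in> V"
    by (rule endomorphism_onD(1)[OF apply_word_endomorphism root_subspaceD(1)[OF g(1)]])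
  ultimately have "apply_word A u g \<in> (\<Inter>j. {f \<in> V. shifted A l j f = 0})" by (simp add: shifted_def)
  then have "(\<Inter>j. {f \<in> V. shifted A l j f = 0}) \<noteq> {0}" using u(3) by (metis singletonD)
  then show "l \<in> joint_spectrum V A" by (simp add: joint_spectrum_def)
qed

theorem spectral_multiset_eq: "spectral_multiset V A = image_mset diagonal (mset_set {..<n})"
proof (rule multiset_eqI)
  fix x
  have "count (spectral_multiset V A) x =
      (\<Sum>l\<in>diagonal ` {..<n}. if l = x then card {i. i < n \<and> diagonal i = x} else 0)"
    unfolding spectral_multiset_def joint_spectrum_eq count_sum
    by (rule sum.cong) (auto simp: dim_root_subspace)
  also have "\<dots> = card {i. i < n \<and> diagonal i = x}"
  proof (cases "x \<in> diagonal ` {..<n}")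
    case False
    then have "{i. i < n \<and> diagonal i = x} = {}" by auto
    then show ?thesis using False by simp
  qed simp
  also have "{i. i < n \<and> diagonal i = x} = diagonal -` {x} \<inter> {..<n}" by auto
  also have "card \<dots> = count (image_mset diagonal (mset_set {..<n})) x"
    by (simp add: count_image_mset)
  finally show "count (spectral_multiset V A) x = count (image_mset diagonal (mset_set {..<n})) x" .
qed

end


section \<open>Multiplication by coordinates on the Drury-Arveson space\<close>

abbreviation da_kernel_at :: "complex ^ 'd \<Rightarrow> complex ^ 'd \<Rightarrow> complex"
  where "da_kernel_at \<equiv> kernel_at unit_ball da_kernel"

abbreviation coord_mult :: "'d \<Rightarrow> (complex ^ 'd \<Rightarrow> complex) \<Rightarrow> complex ^ 'd \<Rightarrow> complex"
  where "coord_mult j f \<equiv> (\<lambda>z. z $ j) * f"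

text \<open>
  For a linear combination \<open>u\<close> of kernel functions, \<open>U j\<close> is the image of \<open>u\<close> under the adjoint of
  multiplication by the \<open>j\<close>-th coordinate. It is a relation because \<open>u\<close> does not come with a
  representation as a combination.
\<close>

inductive backward_shifts ::
  "(complex ^ 'd \<Rightarrow> complex) \<Rightarrow> ('d \<Rightarrow> complex ^ 'd \<Rightarrow> complex) \<Rightarrow> bool" where
  kernel: "w \<in> unit_ball \<Longrightarrow> backward_shifts (da_kernel_at w) (\<lambda>j. fscale (cnj (w $ j)) (da_kernel_at w))"
| add: "backward_shifts u U \<Longrightarrow> backward_shifts v V \<Longrightarrow> backward_shifts (u + v) (\<lambda>j. U j + V j)"
| scale: "backward_shifts u U \<Longrightarrow> backward_shifts (fscale c u) (\<lambda>j. fscale c (U j))"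

locale drury_arveson =
  fixes H :: "(complex ^ 'd \<Rightarrow> complex) set"
    and ip :: "(complex ^ 'd \<Rightarrow> complex) \<Rightarrow> (complex ^ 'd \<Rightarrow> complex) \<Rightarrow> complex"
  assumes drury_arveson: "drury_arveson_space H ip"

sublocale drury_arveson \<subseteq> function_hilbert_space H ip
  using drury_arveson by unfold_locales (simp_all add: drury_arveson_space_def rkhs_def)

context drury_arveson
begin

lemma vanishes: "f \<in> H \<Longrightarrow> z \<notin> unit_ball \<Longrightarrow> f z = 0"
  using drury_arveson unfolding drury_arveson_space_def rkhs_def by blast

lemma kernel_H: "w \<in> unit_ball \<Longrightarrow> da_kernel_at w \<in> H"
  using drury_arveson unfolding drury_arveson_space_def rkhs_def by blast

lemma ip_kernel: "w \<in> unit_ball \<Longrightarrow> f \<in> H \<Longrightarrow> ip f (da_kernel_at w) = f w"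
  using drury_arveson unfolding drury_arveson_space_def rkhs_def by blast

lemma kernel_apply: "z \<in> unit_ball \<Longrightarrow> da_kernel_at w z = 1 / (1 - cdot z w)"
  by (simp add: kernel_at_def da_kernel_def)

lemma ip_kernel_left: "w \<in> unit_ball \<Longrightarrow> f \<in> H \<Longrightarrow> ip (da_kernel_at w) f = cnj (f w)"
  using ip_conj[OF _ kernel_H, of f w] ip_kernel by simp

lemma backward_shifts_H: "backward_shifts u U \<Longrightarrow> u \<in> H \<and> (\<forall>j. U j \<in> H)"
proof (induction rule: backward_shifts.induct)
  case (kernel w)
  show ?case using H_scale[OF kernel_H[OF kernel]] kernel_H[OF kernel] by blast
next
  case (add u U v V)
  then show ?case using H_add by blast
next
  case (scale u U c)
  then show ?case using H_scale by blast
qed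

lemma backward_shifts_apply:
  assumes "backward_shifts u U" "w \<in> unit_ball"
  shows "(\<Sum>j\<in>UNIV. w $ j * U j w) = u w - u 0"
  using assms(1)
proof (induction rule: backward_shifts.induct)
  case (kernel v)
  have "(\<Sum>j\<in>UNIV. w $ j * fscale (cnj (v $ j)) (da_kernel_at v) w) = cdot w v * da_kernel_at v w"
    by (simp add: fscale_def cdot_def sum_distrib_right mult.assoc)
  also have "\<dots> = da_kernel_at v w - da_kernel_at v 0"
    using one_minus_cdot_neq_0[OF assms(2) kernel] assms(2)
    by (simp add: kernel_apply cdot_simps field_simps)
  finally show ?case .
next
  case (add u U v V)
  have "(\<Sum>j\<in>UNIV. w $ j * (U j + V j) w) = (\<Sum>j\<in>UNIV. w $ j * U j w) + (\<Sum>j\<in>UNIV. w $ j * V j w)"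
    by (simp add: distrib_left sum.distrib)
  then show ?case unfolding add.IH by simp
next
  case (scale u U c)
  have "(\<Sum>j\<in>UNIV. w $ j * fscale c (U j) w) = c * (\<Sum>j\<in>UNIV. w $ j * U j w)"
    by (simp add: fscale_def sum_distrib_left mult.left_commute)
  then show ?case unfolding scale.IH by (simp add: fscale_def algebra_simps)
qed

text \<open>
  On kernel functions this is the identity \<open>\<langle>z, w\<rangle> k(z, w) = k(z, w) - 1\<close>. It says that the coordinate
  multiplications form a row contraction whose defect is the projection onto the constants.
\<close>

lemma backward_shifts_ip:
  assumes "backward_shifts u U" "backward_shifts v V"
  shows "(\<Sum>j\<in>UNIV. ip (U j) (V j)) = ip u v - u 0 * cnj (v 0)"
  using assms(2)
proof (induction rule: backward_shifts.induct)
  case (kernel w)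
  have uU: "u \<in> H" "U j \<in> H" for j using backward_shifts_H[OF assms(1)] by auto
  have "(\<Sum>j\<in>UNIV. ip (U j) (fscale (cnj (w $ j)) (da_kernel_at w))) = (\<Sum>j\<in>UNIV. w $ j * U j w)"
    by (simp only: ip_scale_right[OF uU(2) kernel_H[OF kernel]] ip_kernel[OF kernel uU(2)] complex_cnj_cnj)
  also have "\<dots> = u w - u 0" by (rule backward_shifts_apply[OF assms(1) kernel])
  finally show ?case unfolding ip_kernel[OF kernel uU(1)] by (simp add: kernel_apply cdot_simps)
next
  case (add v V v' V')
  have m: "u \<in> H" "U j \<in> H" "v \<in> H" "V j \<in> H" "v' \<in> H" "V' j \<in> H" for j
    using backward_shifts_H[OF assms(1)] backward_shifts_H[OF add.hyps(1)] backward_shifts_H[OF add.hyps(2)] by auto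
  show ?case
    unfolding ip_add_right[OF m(2) m(4) m(6)] ip_add_right[OF m(1,3,5)] sum.distrib add.IH
    by (simp add: algebra_simps)
next
  case (scale v V c)
  have m: "u \<in> H" "U j \<in> H" "v \<in> H" "V j \<in> H" for j
    using backward_shifts_H[OF assms(1)] backward_shifts_H[OF scale.hyps(1)] by auto
  show ?case
    unfolding ip_scale_right[OF m(2) m(4)] ip_scale_right[OF m(1,3)] sum_distrib_left[symmetric] scale.IH
    by (simp add: fscale_def algebra_simps)
qed

lemma backward_shifts_norm:
  assumes "backward_shifts u U"
  shows "(\<Sum>j\<in>UNIV. (fnorm ip (U j))\<^sup>2) \<le> (fnorm ip u)\<^sup>2"
proof -
  have m: "u \<in> H" "U j \<in> H" for j using backward_shifts_H[OF assms] by auto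
  have "complex_of_real (\<Sum>j\<in>UNIV. (fnorm ip (U j))\<^sup>2) = complex_of_real ((fnorm ip u)\<^sup>2 - (cmod (u 0))\<^sup>2)"
    using backward_shifts_ip[OF assms assms]
    unfolding ip_self_norm[OF m(1)] ip_self_norm[OF m(2)] complex_norm_square[symmetric] by simp
  then have "(\<Sum>j\<in>UNIV. (fnorm ip (U j))\<^sup>2) = (fnorm ip u)\<^sup>2 - (cmod (u 0))\<^sup>2"
    unfolding of_real_eq_iff .
  then show ?thesis by simp
qed

text \<open>
  The product is obtained as the Riesz representative of the functional \<open>u \<mapsto> \<Sum>\<^sub>j b\<^sub>j \<langle>U j, f\<rangle>\<close> on
  combinations of kernel functions, which is bounded because \<open>\<Sum>\<^sub>j \<parallel>U j\<parallel>\<^sup>2 \<le> \<parallel>u\<parallel>\<^sup>2\<close>. That it is the product can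
  be seen on the kernel functions themselves.
\<close>

theorem linear_form_multiplier:
  assumes f: "f \<in> H"
  shows "(\<lambda>z. cdot z b) * f \<in> H" "fnorm ip ((\<lambda>z. cdot z b) * f) \<le> norm b * fnorm ip f"
proof -
  define l where "l U = (\<Sum>j\<in>UNIV. b $ j * ip (U j) f)" for U :: "'d \<Rightarrow> complex ^ 'd \<Rightarrow> complex"
  have "\<exists>g\<in>H. fnorm ip g \<le> norm b * fnorm ip f \<and>
      (\<forall>u a. (u, a) \<in> {(u, l U) | u U. backward_shifts u U} \<longrightarrow> ip u g = a)"
  proof (rule riesz_graph)
    show "u \<in> H" if "(u, a) \<in> {(u, l U) | u U. backward_shifts u U}" for u a
      using that backward_shifts_H by blast
    show "(u + v, a + a') \<in> {(u, l U) | u U. backward_shifts u U}"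
      if ua: "(u, a) \<in> {(u, l U) | u U. backward_shifts u U}" and va: "(v, a') \<in> {(u, l U) | u U. backward_shifts u U}"
      for u v a a'
    proof -
      obtain U where U: "a = l U" "backward_shifts u U" using ua by blast
      obtain V where V: "a' = l V" "backward_shifts v V" using va by blast
      note UV = U(1) V(1) U(2) V(2)
      have m: "U j \<in> H" "V j \<in> H" for j using backward_shifts_H UV(3,4) by auto
      have "a + a' = l (\<lambda>j. U j + V j)"
        unfolding UV(1,2) l_def ip_add_left[OF m f] by (simp add: algebra_simps sum.distrib)
      then show ?thesis using backward_shifts.add[OF UV(3,4)] by blast
    qed
    show "(fscale c u, c * a) \<in> {(u, l U) | u U. backward_shifts u U}"
      if ua: "(u, a) \<in> {(u, l U) | u U. backward_shifts u U}" for c u a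
    proof -
      obtain U where U: "a = l U" "backward_shifts u U" using ua by blast
      have m: "U j \<in> H" for j using backward_shifts_H U(2) by auto
      have "c * a = l (\<lambda>j. fscale c (U j))"
        unfolding U(1) l_def ip_scale_left[OF m f] by (simp add: sum_distrib_left algebra_simps)
      then show ?thesis using backward_shifts.scale[OF U(2)] by blast
    qed
    show "{(u, l U) | u U. backward_shifts u U} \<noteq> {}"
      using backward_shifts.kernel[of 0] by auto
    show "cmod a \<le> norm b * fnorm ip f * fnorm ip u"
      if ua: "(u, a) \<in> {(u, l U) | u U. backward_shifts u U}" for u a
    proof -
      obtain U where U: "a = l U" "backward_shifts u U" using ua by blast
      have m: "u \<in> H" "U j \<in> H" for j using backward_shifts_H U(2) by auto
      have "cmod a \<le> (\<Sum>j\<in>UNIV. cmod (b $ j) * (fnorm ip (U j) * fnorm ip f))"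
        unfolding U(1) l_def
        by (rule order_trans[OF norm_sum]) (simp add: norm_mult sum_mono mult_left_mono Cauchy_Schwarz m f)
      also have "\<dots> = (\<Sum>j\<in>UNIV. \<bar>cmod (b $ j)\<bar> * \<bar>fnorm ip (U j)\<bar>) * fnorm ip f"
        by (simp add: sum_distrib_right norm_nonneg m mult.assoc)
      also have "\<dots> \<le> (norm b * L2_set (\<lambda>j. fnorm ip (U j)) UNIV) * fnorm ip f"
        unfolding norm_vec_def by (intro mult_right_mono L2_set_mult_ineq norm_nonneg f)
      also have "\<dots> \<le> (norm b * fnorm ip u) * fnorm ip f"
        unfolding L2_set_def
        by (intro mult_right_mono mult_left_mono norm_nonneg f norm_ge_zero real_le_lsqrt
            backward_shifts_norm U(2) sum_nonneg m)
      finally show ?thesis by (simp add: mult_ac)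
    qed
    show "0 \<le> norm b * fnorm ip f" by (simp add: norm_nonneg f)
  qed
  then obtain g where g: "g \<in> H" "fnorm ip g \<le> norm b * fnorm ip f"
    "\<And>u U. backward_shifts u U \<Longrightarrow> ip u g = l U" by blast
  have "g z = ((\<lambda>z. cdot z b) * f) z" for z
  proof (cases "z \<in> unit_ball")
    case True
    have "cnj (g z) = (\<Sum>j\<in>UNIV. b $ j * ip (fscale (cnj (z $ j)) (da_kernel_at z)) f)"
      using g(3)[OF backward_shifts.kernel[OF True]] ip_kernel_left[OF True g(1)] by (simp add: l_def)
    also have "\<dots> = cnj (cdot z b * f z)"
      unfolding ip_scale_left[OF kernel_H[OF True] f] ip_kernel_left[OF True f]
      by (simp add: cdot_def sum_distrib_left mult_ac)
    finally have "g z = cdot z b * f z" unfolding complex_cnj_cancel_iff .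
    then show ?thesis by simp
  next
    case False
    then show ?thesis using vanishes[OF g(1) False] vanishes[OF f False] by simp
  qed
  then have "g = (\<lambda>z. cdot z b) * f" by (rule ext)
  then show "(\<lambda>z. cdot z b) * f \<in> H" "fnorm ip ((\<lambda>z. cdot z b) * f) \<le> norm b * fnorm ip f"
    using g by auto
qed

lemma sum_function_apply: "(\<Sum>i\<in>I. f i) x = (\<Sum>i\<in>I. (f i x :: complex))"
  by (induction I rule: infinite_finite_induct) auto

lemma coord_as_cdot: "(\<lambda>z. z $ j) = (\<lambda>z :: complex ^ 'd. cdot z (axis j 1))"
  by (simp add: cdot_def axis_def if_distrib cong: if_cong)

lemma coord_mult_H: "f \<in> H \<Longrightarrow> coord_mult j f \<in> H"
  unfolding coord_as_cdot by (rule linear_form_multiplier(1))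

lemma coord_mult_norm: "f \<in> H \<Longrightarrow> fnorm ip (coord_mult j f) \<le> fnorm ip f"
  using linear_form_multiplier(2)[of f "axis j 1"] unfolding coord_as_cdot by simp

lemma coord_mult_add: "coord_mult j (f + g) = coord_mult j f + coord_mult j g"
  by (simp add: fun_eq_iff algebra_simps)

lemma coord_mult_diff: "coord_mult j (f - g) = coord_mult j f - coord_mult j g"
  by (simp add: fun_eq_iff algebra_simps)

lemma coord_mult_scale: "coord_mult j (fscale c f) = fscale c (coord_mult j f)"
  by (simp add: fun_eq_iff fscale_def)

lemma coord_mult_tendsto:
  assumes "\<And>k. f k \<in> H" "g \<in> H" "(\<lambda>k. fnorm ip (f k - g)) \<longlonglongrightarrow> 0"
  shows "(\<lambda>k. fnorm ip (coord_mult j (f k) - coord_mult j g)) \<longlonglongrightarrow> 0"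
proof (rule tendsto_sandwich[OF _ _ tendsto_const assms(3)])
  show "\<forall>\<^sub>F k in sequentially. 0 \<le> fnorm ip (coord_mult j (f k) - coord_mult j g)"
    using norm_nonneg[OF H_diff[OF coord_mult_H[OF assms(1)] coord_mult_H[OF assms(2)]]] by simp
  show "\<forall>\<^sub>F k in sequentially. fnorm ip (coord_mult j (f k) - coord_mult j g) \<le> fnorm ip (f k - g)"
    unfolding coord_mult_diff[symmetric] using coord_mult_norm[OF H_diff[OF assms(1,2)]] by simp
qed

text \<open>
  Multiplication by the form \<open>\<langle>\<cdot>, l\<rangle>\<close> gives a function \<open>F\<close> of norm at most \<open>norm l\<close> with
  \<open>\<langle>F, f\<rangle> = (norm l)\<^sup>2\<close>. Hence \<open>norm l \<le> 1\<close>. If \<open>norm l = 1\<close>, this is equality in the Cauchy-Schwarz inequality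
  and \<open>F = f\<close>, so the form takes the value 1 where \<open>f\<close> does not vanish, but inside the ball its values
  have modulus less than 1.
\<close>

theorem compression_in_ball:
  fixes l :: "complex ^ 'd"
  assumes f: "f \<in> H" "ip f f = 1" and l: "\<And>j. l $ j = ip (coord_mult j f) f"
  shows "l \<in> unit_ball"
proof -
  let ?F = "(\<lambda>z. cdot z l) * f"
  have f1: "fnorm ip f = 1" using f(2) by (simp add: fnorm_def)
  have F: "?F \<in> H" "fnorm ip ?F \<le> norm l" using linear_form_multiplier[OF f(1), of l] f1 by simp_all
  have "?F = (\<Sum>j\<in>UNIV. fscale (cnj (l $ j)) (coord_mult j f))"
    by (rule ext) (simp add: sum_function_apply fscale_def cdot_def sum_distrib_left sum_distrib_right mult_ac)
  then have "ip ?F f = (\<Sum>j\<in>UNIV. cnj (l $ j) * ip (coord_mult j f) f)"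
    using ip_sum_left[OF coord_mult_H[OF f(1)] f(1)] by simp
  also have "\<dots> = cdot l l" by (simp add: cdot_def l mult.commute)
  finally have ipF: "ip ?F f = complex_of_real ((norm l)\<^sup>2)" by (simp add: cdot_self)
  then have "(norm l)\<^sup>2 \<le> norm l"
    using Cauchy_Schwarz[OF F(1) f(1)] F(2) f1 by (simp add: norm_power)
  then have le: "norm l \<le> 1"
    by (cases "norm l = 0") (simp_all add: power2_eq_square)
  have "norm l \<noteq> 1"
  proof
    assume l1: "norm l = 1"
    have "(fnorm ip (?F - f))\<^sup>2 \<le> 0"
      unfolding norm_diff_squared[OF F(1) f(1)] ipF f1 l1
      using F(2) norm_nonneg[OF F(1)] l1 by (simp add: power_le_one)
    then have "?F - f = 0" using norm_eq_0_iff[OF H_diff[OF F(1) f(1)]] by simp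
    then have eq: "cdot z l * f z = f z" for z by (simp add: fun_eq_iff)
    have "f z = 0" for z
    proof (cases "z \<in> unit_ball")
      case True
      have "cmod (cdot z l) \<le> norm z" using norm_cdot_le[of z l] l1 by simp
      then have "cdot z l \<noteq> 1" using True by auto
      then show ?thesis using eq[of z] by simp
    qed (rule vanishes[OF f(1)])
    then have "f = 0" by (simp add: fun_eq_iff)
    then show False using f1 norm_zero by simp
  qed
  then show ?thesis using le by simp
qed

end


section \<open>Coinvariant projections\<close>

context drury_arveson
begin

text \<open>
  The triangularity is stated with the multiplications themselves instead of their compressions, which
  have the same inner products on the range. This turns it into a condition on vectors of \<open>H\<close> that
  can be passed to the limit while the projection varies.
\<close>

definition schur_basis :: "((complex ^ 'd \<Rightarrow> complex) \<Rightarrow> complex ^ 'd \<Rightarrow> complex) \<Rightarrow> nat \<Rightarrow>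
    (nat \<Rightarrow> complex ^ 'd \<Rightarrow> complex) \<Rightarrow> bool"
  where "schur_basis P n e \<longleftrightarrow> orthonormal n e \<and> (\<forall>i<n. e i \<in> P ` H) \<and>
    (\<forall>j i l. i < l \<longrightarrow> l < n \<longrightarrow> ip (coord_mult j (e i)) (e l) = 0)"

definition schur_diagonal :: "(nat \<Rightarrow> complex ^ 'd \<Rightarrow> complex) \<Rightarrow> nat \<Rightarrow> complex ^ 'd"
  where "schur_diagonal e i = (\<chi> j. ip (coord_mult j (e i)) (e i))"

end

locale coinvariant_projection = drury_arveson H ip
  for H :: "(complex ^ 'd \<Rightarrow> complex) set" and ip +
  fixes P :: "(complex ^ 'd \<Rightarrow> complex) \<Rightarrow> complex ^ 'd \<Rightarrow> complex" and n :: nat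
  assumes P: "P \<in> coinvariant_projections H ip n" and n: "n \<ge> 1"
begin

lemma P_H: "f \<in> H \<Longrightarrow> P f \<in> H"
  and P_add: "f \<in> H \<Longrightarrow> g \<in> H \<Longrightarrow> P (f + g) = P f + P g"
  and P_scale: "f \<in> H \<Longrightarrow> P (fscale c f) = fscale c (P f)"
  and P_bounded: "\<exists>C. \<forall>f\<in>H. fnorm ip (P f) \<le> C * fnorm ip f"
  using P by (auto simp: coinvariant_projections_def bounded_operators_def)

lemma P_idem: "f \<in> H \<Longrightarrow> P (P f) = P f"
proof -
  assume f: "f \<in> H"
  have "compose H P P = P" using P by (simp add: coinvariant_projections_def)
  then have "compose H P P f = P f" by simp
  then show ?thesis using f by (simp add: compose_def)
qed

lemma P_selfadjoint: "f \<in> H \<Longrightarrow> g \<in> H \<Longrightarrow> ip (P f) g = ip f (P g)"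
proof -
  assume fg: "f \<in> H" "g \<in> H"
  obtain C where C: "\<And>f. f \<in> H \<Longrightarrow> fnorm ip (P f) \<le> C * fnorm ip f" using P_bounded by blast
  have "adjoint_on H ip P = P" using P by (simp add: coinvariant_projections_def)
  then show ?thesis using adjoint_on_bounded(2)[of P C, OF P_H P_add P_scale C fg(2,1)] by simp
qed

lemma P_diff: "f \<in> H \<Longrightarrow> g \<in> H \<Longrightarrow> P (f - g) = P f - P g"
  using P_H P_add P_scale by (intro endomorphism_on_diff[OF _ subspace]) (auto simp: endomorphism_on_def)

lemma norm_P_le: "f \<in> H \<Longrightarrow> fnorm ip (P f) \<le> fnorm ip f"
proof -
  assume f: "f \<in> H"
  have "(fnorm ip (P f))\<^sup>2 = Re (ip f (P f))"
    unfolding norm_squared[OF P_H[OF f]] using P_selfadjoint[OF f P_H[OF f]] P_idem[OF f] by simp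
  also have "\<dots> \<le> fnorm ip f * fnorm ip (P f)"
    using Cauchy_Schwarz[OF f P_H[OF f]] complex_Re_le_cmod[of "ip f (P f)"] by linarith
  finally show ?thesis
    using norm_nonneg[OF P_H[OF f]] norm_nonneg[OF f]
    by (cases "fnorm ip (P f) = 0") (simp_all add: power2_eq_square)
qed

lemma range_H: "P ` H \<subseteq> H"
  using P_H by blast

lemma P_range: "x \<in> P ` H \<Longrightarrow> P x = x"
  using P_idem by auto

lemma range_subspace: "cfun.subspace (P ` H)"
proof (rule cfun.subspaceI)
  show "0 \<in> P ` H" using P_scale[OF H_zero, of 0] H_zero by (metis fscale_simps(1) imageI)
  show "x + y \<in> P ` H" if "x \<in> P ` H" "y \<in> P ` H" for x y
    using that P_add H_add by (metis (no_types, lifting) imageE imageI)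
  show "fscale c x \<in> P ` H" if "x \<in> P ` H" for c x
    using that P_scale H_scale by (metis (no_types, lifting) imageE imageI)
qed

lemma dim_range: "cfun.dim (P ` H) = n"
  using P by (simp add: coinvariant_projections_def)

lemma range_eqI:
  assumes "x \<in> P ` H" "y \<in> P ` H" "\<And>g. g \<in> P ` H \<Longrightarrow> ip x g = ip y g"
  shows "x = y"
proof -
  have xy: "x \<in> H" "y \<in> H" using assms range_H by auto
  have "x - y \<in> P ` H" by (rule cfun.subspace_diff[OF range_subspace assms(1,2)])
  then have "ip (x - y) (x - y) = 0"
    using ip_diff_left[OF xy H_diff[OF xy]] assms(3)[of "x - y"] by simp
  then have "fnorm ip (x - y) = 0" by (simp add: fnorm_def)
  then show ?thesis using norm_eq_0_iff[OF H_diff[OF xy]] by simp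
qed

text \<open>
  The adjoint of the multiplication maps \<open>g\<close> into the range again, and this image does not see the
  component of \<open>f\<close> orthogonal to the range.
\<close>

lemma ip_coord_mult_compress:
  assumes f: "f \<in> H" and g: "g \<in> P ` H"
  shows "ip (coord_mult j f) g = ip (coord_mult j (P f)) g"
proof -
  define M where "M = mult_op H (\<lambda>z. z $ j)"
  have M: "M f = coord_mult j f" if "f \<in> H" for f using that by (simp add: M_def mult_op_def)
  have gH: "g \<in> H" using g range_H by blast
  have adj: "adjoint_on H ip M g \<in> H" "\<And>f. f \<in> H \<Longrightarrow> ip (M f) g = ip f (adjoint_on H ip M g)"
    using adjoint_on_bounded[of M 1, OF _ _ _ _ gH] coord_mult_H coord_mult_norm H_add H_scale
    by (simp_all add: M coord_mult_add coord_mult_scale del: plus_fun_apply times_fun_apply)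
  have "(\<lambda>z. z $ j) \<in> multipliers H" using coord_mult_H by (auto simp: multipliers_def)
  then have "compose H P (compose H (adjoint_on H ip M) P) = compose H (adjoint_on H ip M) P"
    using P unfolding coinvariant_projections_def M_def by blast
  then have "compose H P (compose H (adjoint_on H ip M) P) g = compose H (adjoint_on H ip M) P g" by simp
  then have inv: "P (adjoint_on H ip M g) = adjoint_on H ip M g"
    using gH P_range[OF g] by (simp add: compose_def)
  have "ip (M f) g = ip f (P (adjoint_on H ip M g))" using adj(2)[OF f] inv by simp
  also have "\<dots> = ip (P f) (adjoint_on H ip M g)" by (rule P_selfadjoint[OF f adj(1), symmetric])
  also have "\<dots> = ip (M (P f)) g" by (rule adj(2)[OF P_H[OF f], symmetric])
  finally show ?thesis using M f P_H[OF f] by simp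
qed

text \<open>
  The inner projection can be dropped; therefore the compressions commute, as the multiplications do.
\<close>

lemma P_coord_mult_compress:
  assumes "f \<in> H"
  shows "P (coord_mult j (P f)) = P (coord_mult j f)"
proof (rule range_eqI)
  show "P (coord_mult j (P f)) \<in> P ` H" "P (coord_mult j f) \<in> P ` H"
    using assms coord_mult_H P_H by blast+
  show "ip (P (coord_mult j (P f))) g = ip (P (coord_mult j f)) g" if g: "g \<in> P ` H" for g
  proof -
    have gH: "g \<in> H" using g range_H by blast
    show ?thesis
      using P_selfadjoint[OF coord_mult_H[OF P_H[OF assms]] gH] P_selfadjoint[OF coord_mult_H[OF assms] gH]
        ip_coord_mult_compress[OF assms g] P_range[OF g] by simp
  qed
qed

lemma compressed_tuple_apply: "x \<in> P ` H \<Longrightarrow> compressed_tuple H P j x = P (coord_mult j x)"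
  using range_H by (auto simp: compressed_tuple_def mult_op_def)

lemma compressed_tuple_endomorphism: "endomorphism_on (P ` H) (compressed_tuple H P j)"
  unfolding endomorphism_on_def
proof (intro conjI ballI allI)
  fix x assume x: "x \<in> P ` H"
  then have xH: "x \<in> H" using range_H by blast
  show "compressed_tuple H P j x \<in> P ` H"
    unfolding compressed_tuple_apply[OF x] using coord_mult_H[OF xH] by blast
  show "compressed_tuple H P j (fscale c x) = fscale c (compressed_tuple H P j x)" for c
    unfolding compressed_tuple_apply[OF x] compressed_tuple_apply[OF cfun.subspace_scale[OF range_subspace x]]
      coord_mult_scale by (rule P_scale[OF coord_mult_H[OF xH]])
  fix y assume y: "y \<in> P ` H"
  then have yH: "y \<in> H" using range_H by blast
  show "compressed_tuple H P j (x + y) = compressed_tuple H P j x + compressed_tuple H P j y"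
    unfolding compressed_tuple_apply[OF x] compressed_tuple_apply[OF y]
      compressed_tuple_apply[OF cfun.subspace_add[OF range_subspace x y]] coord_mult_add
    by (rule P_add[OF coord_mult_H[OF xH] coord_mult_H[OF yH]])
qed

lemma compressed_tuple_commute:
  assumes x: "x \<in> P ` H"
  shows "compressed_tuple H P i (compressed_tuple H P j x) = compressed_tuple H P j (compressed_tuple H P i x)"
proof -
  have xH: "x \<in> H" using x range_H by blast
  have *: "compressed_tuple H P i (compressed_tuple H P j x) = P (coord_mult i (coord_mult j x))" for i j
  proof -
    have "P (coord_mult j x) \<in> P ` H" using coord_mult_H[OF xH] by blast
    then show ?thesis
      by (simp only: compressed_tuple_apply[OF x] compressed_tuple_apply P_coord_mult_compress[OF coord_mult_H[OF xH]])
  qed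
  show ?thesis unfolding * by (simp add: mult.left_commute)
qed

lemma ip_compressed_tuple:
  assumes "x \<in> P ` H" "y \<in> P ` H"
  shows "ip (compressed_tuple H P j x) y = ip (coord_mult j x) y"
proof -
  have H: "x \<in> H" "y \<in> H" using assms range_H by auto
  show ?thesis
    unfolding compressed_tuple_apply[OF assms(1)] P_selfadjoint[OF coord_mult_H[OF H(1)] H(2)] P_range[OF assms(2)] ..
qed

lemma schur_basis_exists: "\<exists>e. schur_basis P n e"
proof -
  have "\<exists>e. orthonormal n e \<and> (\<forall>i<n. e i \<in> P ` H) \<and>
      (\<forall>j i l. i < l \<longrightarrow> l < n \<longrightarrow> ip (compressed_tuple H P j (e i)) (e l) = 0)"
    by (rule orthonormal_triangular_basis[OF range_subspace range_H dim_range n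
          compressed_tuple_endomorphism compressed_tuple_commute])
  then obtain e where e: "orthonormal n e" "\<And>i. i < n \<Longrightarrow> e i \<in> P ` H"
    "\<And>j i l. i < l \<Longrightarrow> l < n \<Longrightarrow> ip (compressed_tuple H P j (e i)) (e l) = 0" by blast
  have "ip (coord_mult j (e i)) (e l) = 0" if "i < l" "l < n" for j i l
    using ip_compressed_tuple[OF e(2) e(2), of i l j] e(3)[OF that] that by simp
  then have "schur_basis P n e" unfolding schur_basis_def using e(1,2) by blast
  then show ?thesis by blast
qed

theorem Psi_eq_schur_diagonal:
  assumes e: "schur_basis P n e"
  shows "Psi H P = image_mset (schur_diagonal e) (mset_set {..<n})"
proof -
  have e': "orthonormal n e" "\<And>i. i < n \<Longrightarrow> e i \<in> P ` H"
    "\<And>j i l. i < l \<Longrightarrow> l < n \<Longrightarrow> ip (coord_mult j (e i)) (e l) = 0"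
    using e by (auto simp: schur_basis_def)
  interpret triangular_tuple H ip "P ` H" "compressed_tuple H P" n e
    using range_subspace range_H dim_range n compressed_tuple_endomorphism compressed_tuple_commute e'
      ip_compressed_tuple[OF e'(2) e'(2)]
    by unfold_locales simp_all
  have "diagonal i = schur_diagonal e i" if "i < n" for i
    using ip_compressed_tuple[OF e'(2) e'(2), OF that that]
    by (simp add: diagonal_def schur_diagonal_def vec_eq_iff)
  then have "image_mset diagonal (mset_set {..<n}) = image_mset (schur_diagonal e) (mset_set {..<n})"
    by (intro image_mset_cong) simp
  then show ?thesis unfolding Psi_def spectral_multiset_eq .
qed

lemma schur_diagonal_in_ball:
  assumes "schur_basis P n e" "i < n"
  shows "schur_diagonal e i \<in> unit_ball"
proof (rule compression_in_ball)
  show "e i \<in> H" "ip (e i) (e i) = 1" using assms by (auto simp: schur_basis_def orthonormal_def)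
qed (simp add: schur_diagonal_def)

theorem Psi_in_sym_polyball: "Psi H P \<in> sym_polyball n"
proof -
  obtain e where e: "schur_basis P n e" using schur_basis_exists by blast
  show ?thesis
    unfolding Psi_eq_schur_diagonal[OF e] sym_polyball_def
    using schur_diagonal_in_ball[OF e] by auto
qed

text \<open>
  Evaluation at \<open>l\<close> is the inner product with a vector of the range, so the triangular relations can be
  evaluated at \<open>l\<close>. For the first \<open>e i\<close> that does not vanish at \<open>l\<close>, only the diagonal term of the
  relation survives, and it reads \<open>l\<^sub>j e\<^sub>i(l) = \<langle>z\<^sub>j e\<^sub>i, e\<^sub>i\<rangle> e\<^sub>i(l)\<close>.
\<close>

lemma kernel_in_range_imp_diagonal:
  assumes e: "schur_basis P n e" and l: "l \<in> unit_ball" "da_kernel_at l \<in> P ` H"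
  shows "\<exists>i<n. schur_diagonal e i = l"
proof -
  have eo: "orthonormal n e" "\<And>i. i < n \<Longrightarrow> e i \<in> P ` H" "\<And>i. i < n \<Longrightarrow> e i \<in> H"
    using e range_H by (auto simp: schur_basis_def)
  let ?k = "da_kernel_at l"
  have k: "?k \<in> H" by (rule kernel_H[OF l(1)])
  have exp: "?k = (\<Sum>m<n. fscale (ip ?k (e m)) (e m))"
    by (rule orthonormal_expansion[OF eo(1,2) dim_range n l(2)])
  have "\<exists>i. i < n \<and> e i l \<noteq> 0"
  proof (rule ccontr)
    assume "\<not> ?thesis"
    then have "ip ?k (e m) = 0" if "m < n" for m
      using ip_kernel_left[OF l(1) eo(3)[OF that]] that by simp
    then have "?k = 0" by (subst exp) simp
    then have "?k l = 0" by simp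
    then show False using kernel_apply[OF l(1), of l] one_minus_cdot_neq_0[OF l(1,1)] by simp
  qed
  then obtain i where i: "i < n" "e i l \<noteq> 0" "\<And>m. m < i \<Longrightarrow> \<not> (m < n \<and> e m l \<noteq> 0)"
    using exists_least_iff[of "\<lambda>i. i < n \<and> e i l \<noteq> 0"] by blast
  have "l $ j = ip (coord_mult j (e i)) (e i)" for j
  proof -
    have z: "coord_mult j (e i) \<in> H" by (rule coord_mult_H[OF eo(3)[OF i(1)]])
    have "ip ?k (coord_mult j (e i)) = ip (\<Sum>m<n. fscale (ip ?k (e m)) (e m)) (coord_mult j (e i))"
      using exp by simp
    also have "\<dots> = (\<Sum>m<n. ip ?k (e m) * ip (e m) (coord_mult j (e i)))"
      by (rule ip_sum_left) (use eo(3) z in auto)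
    also have "\<dots> = (\<Sum>m<n. if m = i then ip ?k (e i) * ip (e i) (coord_mult j (e i)) else 0)"
    proof (rule sum.cong[OF refl])
      fix m assume m: "m \<in> {..<n}"
      show "ip ?k (e m) * ip (e m) (coord_mult j (e i)) =
          (if m = i then ip ?k (e i) * ip (e i) (coord_mult j (e i)) else 0)"
      proof (cases m i rule: linorder_cases)
        case less
        then have "ip ?k (e m) = 0" using i(3)[OF less] m ip_kernel_left[OF l(1) eo(3)] by simp
        then show ?thesis using less by simp
      next
        case greater
        then have "ip (coord_mult j (e i)) (e m) = 0" using e m by (auto simp: schur_basis_def)
        then show ?thesis using greater ip_conj[OF z eo(3), of m] m by simp
      qed simp
    qed
    also have "\<dots> = ip ?k (e i) * ip (e i) (coord_mult j (e i))" using i(1) by simp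
    finally have "cnj (l $ j * e i l) = cnj (e i l * ip (coord_mult j (e i)) (e i))"
      unfolding ip_kernel_left[OF l(1) z] ip_kernel_left[OF l(1) eo(3)[OF i(1)]]
        ip_conj[OF z eo(3)[OF i(1)]] by simp
    then have "l $ j * e i l = e i l * ip (coord_mult j (e i)) (e i)" unfolding complex_cnj_cancel_iff .
    then show ?thesis using i(2) by simp
  qed
  then have "schur_diagonal e i = l" by (simp add: schur_diagonal_def vec_eq_iff)
  then show ?thesis using i(1) by blast
qed

text \<open>
  Each of the \<open>n\<close> points is one of the \<open>n\<close> diagonal points, so the diagonal points are these points,
  each once.
\<close>

theorem Psi_kernel_span:
  assumes L: "L \<subseteq> unit_ball" "finite L" "card L = n" and range: "P ` H = cfun.span (da_kernel_at ` L)"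
  shows "Psi H P = mset_set L"
proof -
  obtain e where e: "schur_basis P n e" using schur_basis_exists by blast
  have "L \<subseteq> schur_diagonal e ` {..<n}"
  proof
    fix l assume l: "l \<in> L"
    then have "da_kernel_at l \<in> P ` H" unfolding range by (intro cfun.span_base) blast
    then show "l \<in> schur_diagonal e ` {..<n}" using kernel_in_range_imp_diagonal[OF e] l L(1) by blast
  qed
  moreover have "card (schur_diagonal e ` {..<n}) \<le> n" using card_image_le[of "{..<n}"] by fastforce
  ultimately have eq: "L = schur_diagonal e ` {..<n}" using L(3) by (intro card_seteq) auto
  then have "inj_on (schur_diagonal e) {..<n}" using L(3) by (intro eq_card_imp_inj_on) auto
  then show ?thesis unfolding Psi_eq_schur_diagonal[OF e] eq by (rule image_mset_mset_set)
qed

end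


section \<open>The pseudohyperbolic and the Euclidean distance\<close>

lemma cmod_one_minus_squared: "(cmod (1 - c))\<^sup>2 = 1 - 2 * Re c + (cmod c)\<^sup>2"
  unfolding cmod_power2 by (simp add: power2_eq_square algebra_simps)

lemma norm_diff_cdot: "(norm (x - y))\<^sup>2 = (norm x)\<^sup>2 + (norm y)\<^sup>2 - 2 * Re (cdot x y)"
proof -
  have "Re (cdot x y) = inner x y" by (simp add: cdot_def inner_vec_def inner_complex_def)
  then show ?thesis by (simp add: power2_norm_eq_inner inner_diff inner_commute algebra_simps)
qed

text \<open>
  The bracket on the right is the Gram determinant of \<open>x\<close> and \<open>y\<close>. It lies between 0 and
  \<open>(norm x)\<^sup>2 * (norm (x - y))\<^sup>2\<close>, which is how the two distances are compared in the two lemmas that follow.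
\<close>

lemma d_ph_identity:
  assumes "x \<in> unit_ball" "y \<in> unit_ball"
  shows "(d_ph x y)\<^sup>2 * (cmod (1 - cdot x y))\<^sup>2 =
    (norm (x - y))\<^sup>2 - ((norm x)\<^sup>2 * (norm y)\<^sup>2 - (cmod (cdot x y))\<^sup>2)"
proof -
  have *: "(1 - a / q) * q = q - a" if "q \<noteq> 0" for a q :: real
    using that by (simp add: left_diff_distrib)
  have "(cmod (1 - cdot x y))\<^sup>2 \<noteq> 0" using one_minus_cdot_neq_0[OF assms] by simp
  then have "(d_ph x y)\<^sup>2 * (cmod (1 - cdot x y))\<^sup>2 =
      (cmod (1 - cdot x y))\<^sup>2 - (1 - (norm x)\<^sup>2) * (1 - (norm y)\<^sup>2)"
    unfolding d_ph_squared[OF assms] by (rule *)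
  then show ?thesis
    unfolding cmod_one_minus_squared norm_diff_cdot by (simp add: algebra_simps)
qed

lemma d_ph_le_norm:
  assumes "x \<in> unit_ball" "y \<in> unit_ball"
  shows "d_ph x y * (1 - norm x) \<le> norm (x - y)"
proof (rule power2_le_imp_le)
  have "cmod (cdot x y) \<le> norm x * norm y" by (rule norm_cdot_le)
  also have "\<dots> \<le> norm x" using assms by (simp add: mult_left_le)
  finally have "1 - norm x \<le> cmod (1 - cdot x y)" using norm_triangle_ineq2[of 1 "cdot x y"] by simp
  then have "(1 - norm x)\<^sup>2 \<le> (cmod (1 - cdot x y))\<^sup>2" by (rule power_mono) (use assms in simp)
  then have "(d_ph x y * (1 - norm x))\<^sup>2 \<le> (d_ph x y)\<^sup>2 * (cmod (1 - cdot x y))\<^sup>2"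
    unfolding power_mult_distrib by (rule mult_left_mono) simp
  also have "\<dots> \<le> (norm (x - y))\<^sup>2"
  proof -
    have "(cmod (cdot x y))\<^sup>2 \<le> (norm x * norm y)\<^sup>2" by (rule power_mono[OF norm_cdot_le]) simp
    then show ?thesis unfolding d_ph_identity[OF assms] by (simp add: power_mult_distrib)
  qed
  finally show "(d_ph x y * (1 - norm x))\<^sup>2 \<le> (norm (x - y))\<^sup>2" .
qed simp

lemma norm_le_d_ph:
  assumes "x \<in> unit_ball" "y \<in> unit_ball"
  shows "(1 - (norm x)\<^sup>2) * (norm (x - y))\<^sup>2 \<le> 4 * (d_ph x y)\<^sup>2"
proof -
  define a c where "a = (norm x)\<^sup>2" and "c = cmod (cdot x y)"
  have "0 \<le> (a - c)\<^sup>2" by simp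
  also have "\<dots> = a * a - 2 * (a * c) + c\<^sup>2" by (simp add: power2_eq_square algebra_simps)
  also have "\<dots> \<le> a * a - 2 * (a * Re (cdot x y)) + c\<^sup>2"
    using mult_left_mono[OF complex_Re_le_cmod[of "cdot x y"], of a] by (simp add: a_def c_def)
  finally have "a * (norm y)\<^sup>2 - c\<^sup>2 \<le> a * (norm (x - y))\<^sup>2"
    unfolding norm_diff_cdot a_def[symmetric] by (simp add: algebra_simps)
  then have "(1 - a) * (norm (x - y))\<^sup>2 \<le> (d_ph x y)\<^sup>2 * (cmod (1 - cdot x y))\<^sup>2"
    unfolding d_ph_identity[OF assms] a_def[symmetric] c_def[symmetric] by (simp add: algebra_simps)
  also have "\<dots> \<le> (d_ph x y)\<^sup>2 * 2\<^sup>2"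
  proof (intro mult_left_mono power_mono)
    show "cmod (1 - cdot x y) \<le> 2"
      using norm_triangle_ineq4[of 1 "cdot x y"] norm_cdot_less_1[OF assms] by simp
  qed simp_all
  finally show ?thesis by (simp add: a_def)
qed

lemma tendsto_d_ph_0:
  assumes "x \<in> unit_ball" "\<And>k. y k \<in> unit_ball" "y \<longlonglongrightarrow> x"
  shows "(\<lambda>k. d_ph x (y k)) \<longlonglongrightarrow> 0"
proof (rule tendsto_sandwich)
  have x: "1 - norm x > 0" using assms(1) by simp
  show "\<forall>\<^sub>F k in sequentially. 0 \<le> d_ph x (y k)" by (simp add: d_ph_nonneg)
  show "\<forall>\<^sub>F k in sequentially. d_ph x (y k) \<le> norm (x - y k) / (1 - norm x)"
    using d_ph_le_norm[OF assms(1,2)] x by (simp add: pos_le_divide_eq)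
  have "(\<lambda>k. norm (x - y k) / (1 - norm x)) \<longlonglongrightarrow> norm (x - x) / (1 - norm x)"
    using x by (intro tendsto_intros assms(3)) simp
  then show "(\<lambda>k. norm (x - y k) / (1 - norm x)) \<longlonglongrightarrow> 0" by simp
qed simp

section \<open>Continuity of the spectrum\<close>

lemma rel_mset_image:
  assumes "\<And>i. i \<in># M \<Longrightarrow> R (a i) (b i)"
  shows "rel_mset R (image_mset a M) (image_mset b M)"
  using assms unfolding multiset.rel_map by (intro multiset.rel_refl_strong) blast

lemma bounded_convergent_subsequence_finite:
  fixes c :: "nat \<Rightarrow> 's \<Rightarrow> complex"
  assumes "finite S" "\<And>k s. s \<in> S \<Longrightarrow> cmod (c k s) \<le> B"
  shows "\<exists>r C. strict_mono (r :: nat \<Rightarrow> nat) \<and> (\<forall>s\<in>S. (\<lambda>k. c (r k) s) \<longlonglongrightarrow> C s)"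
  using assms
proof (induction S rule: finite_induct)
  case empty
  show ?case by (intro exI[of _ "\<lambda>k. k"]) (simp add: strict_mono_def)
next
  case (insert a S)
  then obtain r C where r: "strict_mono (r :: nat \<Rightarrow> nat)" "\<And>s. s \<in> S \<Longrightarrow> (\<lambda>k. c (r k) s) \<longlonglongrightarrow> C s"
    by (metis insertCI)
  have "bounded (range (\<lambda>k. c (r k) a))"
    using insert.prems by (intro boundedI[of _ B]) auto
  then obtain t l where t: "strict_mono (t :: nat \<Rightarrow> nat)" "((\<lambda>k. c (r k) a) \<circ> t) \<longlonglongrightarrow> l"
    using bounded_imp_convergent_subsequence by blast
  have "(\<lambda>k. c ((r \<circ> t) k) s) \<longlonglongrightarrow> (C(a := l)) s" if "s \<in> insert a S" for s
  proof (cases "s = a")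
    case True
    then show ?thesis using t(2) by (simp add: comp_def)
  next
    case False
    then have "s \<in> S" using that by simp
    then have "((\<lambda>k. c (r k) s) \<circ> t) \<longlonglongrightarrow> C s" by (intro LIMSEQ_subseq_LIMSEQ r(2) t(1))
    then show ?thesis using False by (simp add: comp_def)
  qed
  moreover have "strict_mono (r \<circ> t)" by (rule strict_mono_o[OF r(1) t(1)])
  ultimately show ?case by blast
qed

context drury_arveson
begin

lemma op_dist_upper:
  assumes "P \<in> coinvariant_projections H ip n" "Q \<in> coinvariant_projections H ip n" "n \<ge> 1"
    and f: "f \<in> H" "fnorm ip f \<le> 1"
  shows "fnorm ip (P f - Q f) \<le> op_dist H ip P Q"
proof -
  interpret P: coinvariant_projection H ip P n using assms by unfold_locales
  interpret Q: coinvariant_projection H ip Q n using assms by unfold_locales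
  have "fnorm ip (P f - Q f) \<le> 2" if "f \<in> H" "fnorm ip f \<le> 1" for f
  proof -
    have "fnorm ip (P f - Q f) \<le> fnorm ip (P f - 0) + fnorm ip (0 - Q f)"
      by (rule norm_diff_triangle[OF P.P_H[OF that(1)] H_zero Q.P_H[OF that(1)]])
    also have "fnorm ip (0 - Q f) = fnorm ip (Q f - 0)"
      by (rule norm_diff_commute[OF H_zero Q.P_H[OF that(1)]])
    finally show ?thesis
      using P.norm_P_le[OF that(1)] Q.norm_P_le[OF that(1)] that(2) unfolding diff_zero by linarith
  qed
  then have "bdd_above ((\<lambda>f. fnorm ip (P f - Q f)) ` {f \<in> H. fnorm ip f \<le> 1})"
    by (intro bdd_aboveI2) blast
  then show ?thesis unfolding op_dist_def using f by (intro cSUP_upper) auto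
qed

lemma op_dist_least:
  assumes "\<And>f. f \<in> H \<Longrightarrow> fnorm ip f \<le> 1 \<Longrightarrow> fnorm ip (P f - Q f) \<le> r"
  shows "op_dist H ip P Q \<le> r"
  unfolding op_dist_def using assms H_zero norm_zero by (intro cSUP_least) auto

text \<open>
  The vectors \<open>P (e k i)\<close> differ from \<open>e k i = Q k (e k i)\<close> by at most the distance of the projections, and
  their coordinates in a fixed basis of the range of \<open>P\<close> are bounded. Hence a subsequence converges.
\<close>

theorem schur_basis_limit:
  assumes P: "P \<in> coinvariant_projections H ip n" and Q: "\<And>k. Q k \<in> coinvariant_projections H ip n"
    and n: "n \<ge> 1" and lim: "(\<lambda>k. op_dist H ip P (Q k)) \<longlonglongrightarrow> 0"
    and e: "\<And>k. schur_basis (Q k) n (e k)"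
  shows "\<exists>r e'. strict_mono (r :: nat \<Rightarrow> nat) \<and> schur_basis P n e' \<and>
    (\<forall>i<n. (\<lambda>k. fnorm ip (e (r k) i - e' i)) \<longlonglongrightarrow> 0)"
proof -
  interpret P: coinvariant_projection H ip P n using P n by unfold_locales
  interpret Q: coinvariant_projection H ip "Q k" n for k using Q n by unfold_locales
  have eo: "orthonormal n (e k)" "\<And>i. i < n \<Longrightarrow> e k i \<in> Q k ` H"
    "\<And>j i l. i < l \<Longrightarrow> l < n \<Longrightarrow> ip (coord_mult j (e k i)) (e k l) = 0" for k
    using e[of k] by (auto simp: schur_basis_def)
  have eH: "e k i \<in> H" if "i < n" for k i using eo(2)[OF that] Q.range_H by blast
  obtain b where "schur_basis P n b" using P.schur_basis_exists by blast
  then have b: "orthonormal n b" "\<And>i. i < n \<Longrightarrow> b i \<in> P ` H" by (auto simp: schur_basis_def)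
  have bH: "b i \<in> H" if "i < n" for i using b(2)[OF that] P.range_H by blast
  define c where "c k s = ip (e k (fst s)) (b (snd s))" for k and s :: "nat \<times> nat"
  have "cmod (c k s) \<le> 1" if "s \<in> {..<n} \<times> {..<n}" for k s
  proof -
    have s: "fst s < n" "snd s < n" using that by auto
    show ?thesis
      using Cauchy_Schwarz[OF eH[OF s(1)] bH[OF s(2)], of k] orthonormal_norm[OF eo(1) s(1), of k]
        orthonormal_norm[OF b(1) s(2)] by (simp add: c_def)
  qed
  then obtain r C where r: "strict_mono (r :: nat \<Rightarrow> nat)"
    and C: "\<And>s. s \<in> {..<n} \<times> {..<n} \<Longrightarrow> (\<lambda>k. c (r k) s) \<longlonglongrightarrow> C s"
    using bounded_convergent_subsequence_finite[of "{..<n} \<times> {..<n}" c 1] by (meson finite_SigmaI finite_lessThan)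
  define e' where "e' i = (\<Sum>l<n. fscale (C (i, l)) (b l))" for i
  have e'P: "e' i \<in> P ` H" for i
    unfolding e'_def
    by (intro cfun.subspace_sum[OF P.range_subspace] cfun.subspace_scale[OF P.range_subspace] b(2)) simp
  then have e'H: "e' i \<in> H" for i using P.range_H by blast
  have limr: "(\<lambda>k. op_dist H ip P (Q (r k))) \<longlonglongrightarrow> 0"
    using LIMSEQ_subseq_LIMSEQ[OF lim r] by (simp add: comp_def)
  have close: "fnorm ip (e k i - e' i) \<le> op_dist H ip P (Q k) + (\<Sum>l<n. cmod (c k (i, l) - C (i, l)))"
    if i: "i < n" for k i
  proof -
    have PeP: "P (e k i) \<in> P ` H" and PeH: "P (e k i) \<in> H" using eH[OF i] P.P_H by blast+
    have "P (e k i) = (\<Sum>l<n. fscale (ip (P (e k i)) (b l)) (b l))"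
      by (rule orthonormal_expansion[OF b P.dim_range n PeP])
    also have "\<dots> = (\<Sum>l<n. fscale (c k (i, l)) (b l))"
      using P.P_selfadjoint[OF eH[OF i] bH] P.P_range[OF b(2)] by (intro sum.cong) (simp_all add: c_def)
    finally have "P (e k i) - e' i = (\<Sum>l<n. fscale (c k (i, l) - C (i, l)) (b l))"
      unfolding e'_def by (simp only: cfun.scale_left_diff_distrib sum_subtractf)
    then have "fnorm ip (P (e k i) - e' i) \<le> (\<Sum>l<n. cmod (c k (i, l) - C (i, l)) * fnorm ip (b l))"
      using norm_sum_le[of "{..<n}" b "\<lambda>l. c k (i, l) - C (i, l)"] bH by simp
    also have "\<dots> = (\<Sum>l<n. cmod (c k (i, l) - C (i, l)))"
      by (rule sum.cong) (simp_all add: orthonormal_norm[OF b(1)])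
    finally have 1: "fnorm ip (P (e k i) - e' i) \<le> (\<Sum>l<n. cmod (c k (i, l) - C (i, l)))" .
    have "fnorm ip (P (e k i) - Q k (e k i)) \<le> op_dist H ip P (Q k)"
      using orthonormal_norm[OF eo(1) i] by (intro op_dist_upper[OF P Q n eH[OF i]]) simp
    then have 2: "fnorm ip (e k i - P (e k i)) \<le> op_dist H ip P (Q k)"
      using norm_diff_commute[OF eH[OF i] PeH] Q.P_range[OF eo(2)[OF i]] by simp
    show ?thesis
      using norm_diff_triangle[OF eH[OF i] PeH e'H] 1 2 by (meson add_mono order_trans)
  qed
  have conv: "(\<lambda>k. fnorm ip (e (r k) i - e' i)) \<longlonglongrightarrow> 0" if i: "i < n" for i
  proof (rule tendsto_sandwich)
    show "\<forall>\<^sub>F k in sequentially. 0 \<le> fnorm ip (e (r k) i - e' i)"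
      using norm_nonneg[OF H_diff[OF eH[OF i] e'H]] by simp
    show "\<forall>\<^sub>F k in sequentially. fnorm ip (e (r k) i - e' i) \<le>
        op_dist H ip P (Q (r k)) + (\<Sum>l<n. cmod (c (r k) (i, l) - C (i, l)))"
      using close[OF i] by simp
    have "(\<lambda>k. op_dist H ip P (Q (r k)) + (\<Sum>l<n. cmod (c (r k) (i, l) - C (i, l)))) \<longlonglongrightarrow>
        0 + (\<Sum>l<n. cmod (C (i, l) - C (i, l)))"
      using i by (intro tendsto_intros limr C) auto
    then show "(\<lambda>k. op_dist H ip P (Q (r k)) + (\<Sum>l<n. cmod (c (r k) (i, l) - C (i, l)))) \<longlonglongrightarrow> 0"
      by simp
  qed simp
  have coord_conv: "(\<lambda>k. fnorm ip (coord_mult j (e (r k) i) - coord_mult j (e' i))) \<longlonglongrightarrow> 0"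
    if i: "i < n" for i j
    by (rule coord_mult_tendsto[OF eH[OF i] e'H conv[OF i]])
  \<comment> \<open>Orthonormality and triangularity are equations between inner products, so they pass to the limit.\<close>
  have "ip (e' i) (e' l) = (if i = l then 1 else 0)" if il: "i < n" "l < n" for i l
  proof (rule LIMSEQ_unique)
    show "(\<lambda>k. ip (e (r k) i) (e (r k) l)) \<longlonglongrightarrow> ip (e' i) (e' l)"
      by (rule ip_tendsto) (use il eH e'H conv in auto)
    show "(\<lambda>k. ip (e (r k) i) (e (r k) l)) \<longlonglongrightarrow> (if i = l then 1 else 0)"
      using eo(1) il by (simp add: orthonormal_def)
  qed
  moreover have "ip (coord_mult j (e' i)) (e' l) = 0" if il: "i < l" "l < n" for j i l
  proof (rule LIMSEQ_unique)
    show "(\<lambda>k. ip (coord_mult j (e (r k) i)) (e (r k) l)) \<longlonglongrightarrow> ip (coord_mult j (e' i)) (e' l)"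
      by (rule ip_tendsto) (use il eH e'H conv coord_conv coord_mult_H in auto)
    show "(\<lambda>k. ip (coord_mult j (e (r k) i)) (e (r k) l)) \<longlonglongrightarrow> 0"
      using eo(3)[OF il] by simp
  qed
  ultimately have "schur_basis P n e'"
    using e'H e'P by (simp add: schur_basis_def orthonormal_def)
  then show ?thesis using r conv by blast
qed

text \<open>
  Otherwise some sequence of projections would tend to \<open>P\<close> while its spectra stay away from that of \<open>P\<close>.
  By the preceding theorem, the diagonal points of a subsequence converge index by index to the diagonal points
  of a Schur basis for \<open>P\<close>.
\<close>

theorem Psi_continuous:
  assumes P: "P \<in> coinvariant_projections H ip n" and n: "n \<ge> 1" and \<epsilon>: "\<epsilon> > 0"
  shows "\<exists>\<delta>>0. \<forall>Q\<in>coinvariant_projections H ip n. op_dist H ip P Q < \<delta> \<longrightarrow> sym_dist (Psi H P) (Psi H Q) < \<epsilon>"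
proof (rule ccontr)
  assume "\<not> ?thesis"
  then have "\<exists>Q\<in>coinvariant_projections H ip n. op_dist H ip P Q < inverse (real (Suc k)) \<and>
      \<not> sym_dist (Psi H P) (Psi H Q) < \<epsilon>" for k
    by (metis inverse_positive_iff_positive of_nat_0_less_iff zero_less_Suc)
  then obtain Q where Q: "\<And>k. Q k \<in> coinvariant_projections H ip n"
    "\<And>k. op_dist H ip P (Q k) < inverse (real (Suc k))"
    "\<And>k. \<not> sym_dist (Psi H P) (Psi H (Q k)) < \<epsilon>" by metis
  interpret P: coinvariant_projection H ip P n using P n by unfold_locales
  interpret Q: coinvariant_projection H ip "Q k" n for k using Q n by unfold_locales
  have lim: "(\<lambda>k. op_dist H ip P (Q k)) \<longlonglongrightarrow> 0"
  proof (rule tendsto_sandwich[OF _ _ tendsto_const LIMSEQ_inverse_real_of_nat])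
    have "0 \<le> op_dist H ip P (Q k)" for k
      using op_dist_upper[OF P Q(1) n H_zero, of k] norm_nonneg[OF H_diff[OF P.P_H[OF H_zero] Q.P_H[OF H_zero]], of k]
        norm_zero by simp
    then show "\<forall>\<^sub>F k in sequentially. 0 \<le> op_dist H ip P (Q k)" by simp
    show "\<forall>\<^sub>F k in sequentially. op_dist H ip P (Q k) \<le> inverse (real (Suc k))"
      using Q(2) less_imp_le by (intro always_eventually allI) blast
  qed
  obtain e where e: "\<And>k. schur_basis (Q k) n (e k)" using Q.schur_basis_exists by metis
  obtain r e' where r: "strict_mono (r :: nat \<Rightarrow> nat)" and e': "schur_basis P n e'"
    and conv: "\<And>i. i < n \<Longrightarrow> (\<lambda>k. fnorm ip (e (r k) i - e' i)) \<longlonglongrightarrow> 0"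
    using schur_basis_limit[OF P Q(1) n lim e] by blast
  have eH: "e k i \<in> H" "e' i \<in> H" if "i < n" for k i
    using e[of k] e' that by (auto simp: schur_basis_def orthonormal_def)
  have "(\<lambda>k. d_ph (schur_diagonal e' i) (schur_diagonal (e (r k)) i)) \<longlonglongrightarrow> 0" if i: "i < n" for i
  proof (rule tendsto_d_ph_0)
    show "schur_diagonal e' i \<in> unit_ball" by (rule P.schur_diagonal_in_ball[OF e' i])
    show "schur_diagonal (e (r k)) i \<in> unit_ball" for k by (rule Q.schur_diagonal_in_ball[OF e i])
    show "(\<lambda>k. schur_diagonal (e (r k)) i) \<longlonglongrightarrow> schur_diagonal e' i"
    proof (rule vec_tendstoI)
      fix j
      have "(\<lambda>k. fnorm ip (coord_mult j (e (r k) i) - coord_mult j (e' i))) \<longlonglongrightarrow> 0"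
        by (rule coord_mult_tendsto[OF eH(1)[OF i] eH(2)[OF i] conv[OF i]])
      then have "(\<lambda>k. ip (coord_mult j (e (r k) i)) (e (r k) i)) \<longlonglongrightarrow> ip (coord_mult j (e' i)) (e' i)"
        using i eH conv[OF i] coord_mult_H by (intro ip_tendsto) auto
      then show "(\<lambda>k. schur_diagonal (e (r k)) i $ j) \<longlonglongrightarrow> schur_diagonal e' i $ j"
        by (simp add: schur_diagonal_def)
    qed
  qed
  then have "\<forall>\<^sub>F k in sequentially. d_ph (schur_diagonal e' i) (schur_diagonal (e (r k)) i) < \<epsilon> / 2"
    if "i \<in> {..<n}" for i
    using that \<epsilon> by (intro order_tendstoD(2)) auto
  then have "\<forall>\<^sub>F k in sequentially. \<forall>i\<in>{..<n}. d_ph (schur_diagonal e' i) (schur_diagonal (e (r k)) i) < \<epsilon> / 2"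
    by (intro eventually_ball_finite) auto
  then obtain k where k: "\<And>i. i < n \<Longrightarrow> d_ph (schur_diagonal e' i) (schur_diagonal (e (r k)) i) < \<epsilon> / 2"
    unfolding eventually_sequentially by auto
  have "rel_mset (\<lambda>x y. d_ph x y \<le> \<epsilon> / 2) (Psi H P) (Psi H (Q (r k)))"
    unfolding P.Psi_eq_schur_diagonal[OF e'] Q.Psi_eq_schur_diagonal[OF e]
    using k less_imp_le by (intro rel_mset_image) auto
  then have "sym_dist (Psi H P) (Psi H (Q (r k))) \<le> \<epsilon> / 2"
    unfolding sym_dist_le_iff[OF P.Psi_in_sym_polyball Q.Psi_in_sym_polyball n] .
  then show False using Q(3)[of "r k"] \<epsilon> by linarith
qed

end


section \<open>Spans of kernel functions\<close>

context drury_arveson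
begin

text \<open>
  Multiply by the affine functions \<open>\<langle>z - l, a - l\<rangle>\<close>, each of which vanishes at \<open>l\<close> and not at \<open>a\<close>.
\<close>

lemma interpolation:
  assumes "finite L" "L \<subseteq> unit_ball" "a \<in> unit_ball" "a \<notin> L"
  shows "\<exists>g\<in>H. g a = 1 \<and> (\<forall>l\<in>L. g l = 0)"
  using assms
proof (induction L rule: finite_induct)
  case empty
  have "da_kernel_at 0 a = 1" using kernel_apply[OF empty(2), of 0] by (simp add: cdot_simps)
  then show ?case using kernel_H[of 0] by auto
next
  case (insert l L)
  then obtain g where g: "g \<in> H" "g a = 1" "\<And>l. l \<in> L \<Longrightarrow> g l = 0" by auto
  define b where "b = a - l"
  have b: "cdot a b - cdot l b \<noteq> 0"
    using insert.prems unfolding cdot_simps(3)[symmetric] b_def[symmetric] cdot_self_eq_0 by (auto simp: b_def)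
  define h where "h = fscale (1 / (cdot a b - cdot l b)) ((\<lambda>z. cdot z b) * g - fscale (cdot l b) g)"
  have "h \<in> H" unfolding h_def by (intro H_scale H_diff linear_form_multiplier(1) g(1))
  moreover have "h a = 1" using b g(2) by (simp add: h_def fscale_def)
  moreover have "\<forall>k\<in>insert l L. h k = 0" using g(3) by (auto simp: h_def fscale_def)
  ultimately show ?case by blast
qed

text \<open>
  The inner product with a function that is 1 at one of the points and 0 at the others picks out one
  coefficient.
\<close>

lemma kernel_coefficients_bounded:
  fixes x :: "nat \<Rightarrow> complex ^ 'd"
  assumes x: "\<And>i. i < n \<Longrightarrow> x i \<in> unit_ball" "inj_on x {..<n}"
  shows "\<exists>G\<ge>0. \<forall>c. \<forall>i<n. cmod (c i) \<le> G * fnorm ip (\<Sum>i<n. fscale (c i) (da_kernel_at (x i)))"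
proof -
  have "\<exists>g\<in>H. g (x i) = 1 \<and> (\<forall>l\<in>x ` ({..<n} - {i}). g l = 0)" if i: "i < n" for i
  proof (rule interpolation)
    show "finite (x ` ({..<n} - {i}))" by blast
  qed (use x i in \<open>auto simp: inj_on_def\<close>)
  then obtain g where g: "\<And>i. i < n \<Longrightarrow> g i \<in> H" "\<And>i. i < n \<Longrightarrow> g i (x i) = 1"
    "\<And>i m. i < n \<Longrightarrow> m < n \<Longrightarrow> m \<noteq> i \<Longrightarrow> g i (x m) = 0"
    by (metis (no_types, lifting) Diff_iff imageI lessThan_iff singletonD)
  define G where "G = (\<Sum>i<n. fnorm ip (g i))"
  have kH: "da_kernel_at (x m) \<in> H" if "m < n" for m using kernel_H x(1) that by blast
  have "cmod (c i) \<le> G * fnorm ip (\<Sum>i<n. fscale (c i) (da_kernel_at (x i)))" if i: "i < n" for c i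
  proof -
    let ?v = "\<Sum>m<n. fscale (c m) (da_kernel_at (x m))"
    have v: "?v \<in> H" by (rule H_sum) (use kH in auto)
    have "ip ?v (g i) = (\<Sum>m<n. c m * ip (da_kernel_at (x m)) (g i))"
      by (rule ip_sum_left) (use kH g(1)[OF i] in auto)
    also have "\<dots> = (\<Sum>m<n. if m = i then c i else 0)"
      using ip_kernel_left[OF x(1) g(1)[OF i]] g(2,3)[OF i] by (intro sum.cong) auto
    also have "\<dots> = c i" using i by simp
    finally have "cmod (c i) \<le> fnorm ip ?v * fnorm ip (g i)"
      using Cauchy_Schwarz[OF v g(1)[OF i]] by simp
    also have "\<dots> \<le> fnorm ip ?v * G"
      unfolding G_def using i g(1) norm_nonneg
      by (intro mult_left_mono norm_nonneg v member_le_sum) auto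
    finally show ?thesis by (simp add: mult.commute)
  qed
  moreover have "0 \<le> G" unfolding G_def by (intro sum_nonneg norm_nonneg g(1)) simp
  ultimately show ?thesis by blast
qed

lemma kernels_independent:
  fixes L :: "(complex ^ 'd) set"
  assumes L: "finite L" "L \<subseteq> unit_ball"
  shows "inj_on da_kernel_at L" "cfun.independent (da_kernel_at ` L)"
proof -
  have sep: "\<exists>g\<in>H. \<forall>l\<in>L. ip (da_kernel_at l) g = (if l = a then 1 else 0)" if a: "a \<in> L" for a
  proof -
    have aB: "a \<in> unit_ball" using L a by blast
    have "\<exists>g\<in>H. g a = 1 \<and> (\<forall>l\<in>L - {a}. g l = 0)"
      by (rule interpolation[OF _ _ aB]) (use L in auto)
    then obtain g where g: "g \<in> H" "g a = 1" "\<And>l. l \<in> L - {a} \<Longrightarrow> g l = 0" by blast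
    have "ip (da_kernel_at l) g = (if l = a then 1 else 0)" if "l \<in> L" for l
      using ip_kernel_left[OF _ g(1), of l] g(2) g(3)[of l] that L by auto
    then show ?thesis using g(1) by blast
  qed
  show inj: "inj_on da_kernel_at L"
  proof (rule inj_onI)
    fix a b assume "a \<in> L" "b \<in> L" "da_kernel_at a = da_kernel_at b"
    then show "a = b" using sep[of a] by (metis zero_neq_one)
  qed
  show "cfun.independent (da_kernel_at ` L)"
  proof
    assume "cfun.dependent (da_kernel_at ` L)"
    then obtain c v where c: "v \<in> da_kernel_at ` L" "c v \<noteq> 0" "(\<Sum>v\<in>da_kernel_at ` L. fscale (c v) v) = 0"
      using cfun.dependent_finite[of "da_kernel_at ` L"] L by auto
    then obtain a where a: "a \<in> L" "v = da_kernel_at a" by auto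
    obtain g where g: "g \<in> H" "\<And>l. l \<in> L \<Longrightarrow> ip (da_kernel_at l) g = (if l = a then 1 else 0)"
      using sep[OF a(1)] by blast
    have "0 = ip (\<Sum>l\<in>L. fscale (c (da_kernel_at l)) (da_kernel_at l)) g"
      using c(3) ip_zero_left[OF g(1)] by (simp add: sum.reindex[OF inj])
    also have "\<dots> = (\<Sum>l\<in>L. c (da_kernel_at l) * ip (da_kernel_at l) g)"
      by (rule ip_sum_left) (use kernel_H L g(1) in auto)
    also have "\<dots> = (\<Sum>l\<in>L. if l = a then c v else 0)"
      using g(2) a by (intro sum.cong) auto
    also have "\<dots> = c v" using a L by simp
    finally show False using c(2) by simp
  qed
qed

lemma kernel_span_eq:
  fixes L :: "(complex ^ 'd) set"
  assumes L: "finite L" "L \<subseteq> unit_ball" and x: "x \<in> cfun.span (da_kernel_at ` L)"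
  shows "\<exists>c. x = (\<Sum>l\<in>L. fscale (c l) (da_kernel_at l))"
proof -
  obtain u where "x = (\<Sum>v\<in>da_kernel_at ` L. fscale (u v) v)"
    using x L(1) by (auto simp: cfun.span_finite)
  then show ?thesis by (auto simp: sum.reindex[OF kernels_independent(1)[OF L]])
qed

text \<open>
  The squared distance of two kernel functions is an explicit continuous function of the points, and the
  pseudohyperbolic distance from a fixed point controls the Euclidean one.
\<close>

lemma kernel_continuous:
  assumes x: "x \<in> unit_ball" and \<epsilon>: "\<epsilon> > 0"
  shows "\<exists>\<delta>>0. \<forall>y\<in>unit_ball. d_ph x y < \<delta> \<longrightarrow> fnorm ip (da_kernel_at x - da_kernel_at y) < \<epsilon>"
proof -
  define N where "N y = Re (1 / (1 - cdot x x)) + Re (1 / (1 - cdot y y)) - 2 * Re (1 / (1 - cdot y x))" for y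
  have N: "(fnorm ip (da_kernel_at x - da_kernel_at y))\<^sup>2 = N y" if y: "y \<in> unit_ball" for y
    unfolding norm_diff_squared[OF kernel_H[OF x] kernel_H[OF y]] norm_squared[OF kernel_H[OF x]]
      norm_squared[OF kernel_H[OF y]] ip_kernel[OF x kernel_H[OF x]] ip_kernel[OF y kernel_H[OF y]]
      ip_kernel[OF y kernel_H[OF x]] kernel_apply[OF x] kernel_apply[OF y] N_def ..
  have "N x = 0" by (simp add: N_def)
  moreover have "(N \<longlongrightarrow> N x) (at x)"
    unfolding N_def cdot_def
    by (intro tendsto_intros) (use one_minus_cdot_neq_0[OF x x] in \<open>auto simp: cdot_def\<close>)
  ultimately have "\<forall>\<^sub>F y in at x. N y < \<epsilon>\<^sup>2" using \<epsilon> by (intro order_tendstoD(2)) auto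
  then obtain \<eta> where \<eta>: "\<eta> > 0" "\<And>y. y \<noteq> x \<Longrightarrow> dist y x < \<eta> \<Longrightarrow> N y < \<epsilon>\<^sup>2"
    unfolding eventually_at by auto
  define s where "s = 1 - (norm x)\<^sup>2"
  have s: "s > 0" using x by (simp add: s_def power_less_one_iff)
  define \<delta> where "\<delta> = \<eta> * sqrt s / 2"
  have "fnorm ip (da_kernel_at x - da_kernel_at y) < \<epsilon>" if y: "y \<in> unit_ball" and d: "d_ph x y < \<delta>" for y
  proof -
    have "(d_ph x y)\<^sup>2 < \<delta>\<^sup>2" using d d_ph_nonneg by (intro power_strict_mono) auto
    then have "s * (norm (x - y))\<^sup>2 < 4 * \<delta>\<^sup>2" using norm_le_d_ph[OF x y] by (simp add: s_def)
    also have "4 * \<delta>\<^sup>2 = s * \<eta>\<^sup>2" using s by (simp add: \<delta>_def power_mult_distrib power_divide)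
    finally have "(norm (x - y))\<^sup>2 < \<eta>\<^sup>2" using s by simp
    then have "dist y x < \<eta>"
      using power2_less_imp_less[of "norm (x - y)" \<eta>] \<eta>(1) by (simp add: dist_norm norm_minus_commute)
    then have "N y < \<epsilon>\<^sup>2" using \<eta>(2)[of y] \<open>N x = 0\<close> \<epsilon> by (cases "y = x") auto
    then show ?thesis using N[OF y] \<epsilon> by (intro power2_less_imp_less[of _ \<epsilon>]) auto
  qed
  moreover have "\<delta> > 0" using \<eta>(1) s by (simp add: \<delta>_def)
  ultimately show ?thesis by blast
qed

section \<open>Projections onto spans of kernel functions\<close>

text \<open>
  The projection is written down in an orthonormal basis. Its range is coinvariant because the adjoint of
  multiplication by \<open>\<phi>\<close> multiplies the kernel function at \<open>l\<close> by the conjugate of \<open>\<phi> l\<close>.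
\<close>

lemma projection_onto_kernel_span:
  fixes L :: "(complex ^ 'd) set"
  assumes L: "L \<subseteq> unit_ball" "finite L" "card L = n" "n \<ge> 1"
  shows "\<exists>P\<in>kernel_span_projections H ip n. P ` H = cfun.span (da_kernel_at ` L)"
proof -
  let ?V = "cfun.span (da_kernel_at ` L)"
  have V: "cfun.subspace ?V" by (rule cfun.subspace_span)
  have VH: "?V \<subseteq> H" by (rule cfun.span_minimal[OF _ subspace]) (use kernel_H L(1) in auto)
  have dim: "cfun.dim ?V = n"
    using cfun.dim_span_eq_card_independent[OF kernels_independent(2)[OF L(2,1)]]
      card_image[OF kernels_independent(1)[OF L(2,1)]] L(3) by simp
  have "\<exists>e. orthonormal n e \<and> (\<forall>i<n. e i \<in> ?V) \<and>
      (\<forall>(j::bool) i l. i < l \<longrightarrow> l < n \<longrightarrow> ip ((\<lambda>_ _. 0) j (e i)) (e l) = 0)"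
  proof (rule orthonormal_triangular_basis[OF V VH dim L(4)])
    show "endomorphism_on ?V (\<lambda>_. 0)"
      unfolding endomorphism_on_def using cfun.subspace_0[OF V] by (simp add: fscale_def fun_eq_iff)
  qed simp
  then obtain e where e: "orthonormal n e" "\<And>i. i < n \<Longrightarrow> e i \<in> ?V" by blast
  have eH: "e i \<in> H" if "i < n" for i using e(2)[OF that] VH by blast
  define P where "P = (\<lambda>f\<in>H. \<Sum>i<n. fscale (ip f (e i)) (e i))"
  have P: "P f = (\<Sum>i<n. fscale (ip f (e i)) (e i))" if "f \<in> H" for f using that by (simp add: P_def)
  have PV: "P f \<in> ?V" if "f \<in> H" for f
    unfolding P[OF that] by (intro cfun.subspace_sum[OF V] cfun.subspace_scale[OF V] e(2)) simp
  have PH: "P f \<in> H" if "f \<in> H" for f using PV[OF that] VH by blast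
  have Pid: "P x = x" if x: "x \<in> ?V" for x
  proof -
    have "x \<in> H" using x VH by blast
    then show ?thesis using orthonormal_expansion[OF e dim L(4) x] P by simp
  qed
  have range: "P ` H = ?V"
  proof
    show "P ` H \<subseteq> ?V" using PV by blast
    show "?V \<subseteq> P ` H"
      by (rule subsetI, rule image_eqI[OF Pid[symmetric]]) (use VH in blast)+
  qed
  have ext: "P \<in> H \<rightarrow>\<^sub>E H"
    unfolding PiE_def using PH by (simp add: P_def)
  have add: "P (f + g) = P f + P g" if fg: "f \<in> H" "g \<in> H" for f g
  proof -
    have "P (f + g) = (\<Sum>i<n. fscale (ip f (e i)) (e i) + fscale (ip g (e i)) (e i))"
      unfolding P[OF H_add[OF fg]]
      using ip_add_left[OF fg eH] by (intro sum.cong) (simp_all add: cfun.scale_left_distrib)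
    then show ?thesis unfolding sum.distrib P[OF fg(1)] P[OF fg(2)] .
  qed
  have scale: "P (fscale c f) = fscale c (P f)" if f: "f \<in> H" for c f
    unfolding P[OF f] P[OF H_scale[OF f]] cfun.scale_sum_right
    using ip_scale_left[OF f eH] by (intro sum.cong) simp_all
  have "fnorm ip (P f) \<le> real n * fnorm ip f" if f: "f \<in> H" for f
  proof -
    have "fnorm ip (P f) \<le> (\<Sum>i<n. cmod (ip f (e i)) * fnorm ip (e i))"
      unfolding P[OF f] by (rule norm_sum_le) (use eH in auto)
    also have "\<dots> \<le> (\<Sum>i<n. fnorm ip f)"
      using Cauchy_Schwarz[OF f eH] orthonormal_norm[OF e(1)] by (intro sum_mono) simp
    finally show ?thesis by simp
  qed
  then have "\<exists>C. \<forall>f\<in>H. fnorm ip (P f) \<le> C * fnorm ip f" by blast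
  then have "P \<in> bounded_operators H ip"
    unfolding bounded_operators_def using ext add scale by simp
  moreover have "compose H P P = P"
  proof (rule extensionalityI)
    show "compose H P P \<in> extensional H" "P \<in> extensional H" by (simp_all add: compose_def P_def)
    show "compose H P P f = P f" if "f \<in> H" for f using Pid[OF PV[OF that]] that by (simp add: compose_def)
  qed
  moreover have "adjoint_on H ip P = P"
  proof (rule extensionalityI)
    show "adjoint_on H ip P \<in> extensional H" "P \<in> extensional H" by (simp_all add: adjoint_on_def P_def)
    show "adjoint_on H ip P g = P g" if g: "g \<in> H" for g
    proof (rule adjoint_on_eqI[OF g PH[OF g]])
      fix f assume f: "f \<in> H"
      have "ip (P f) g = (\<Sum>i<n. ip f (e i) * ip (e i) g)"
        unfolding P[OF f] by (rule ip_sum_left) (use eH g in auto)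
      also have "\<dots> = (\<Sum>i<n. cnj (ip g (e i)) * ip f (e i))"
        using ip_conj[OF g eH] by (intro sum.cong) simp_all
      also have "\<dots> = ip f (P g)"
        unfolding P[OF g] by (rule ip_sum_right[symmetric]) (use eH f in auto)
      finally show "ip (P f) g = ip f (P g)" .
    qed
  qed
  moreover have "compose H P (compose H (adjoint_on H ip (mult_op H \<phi>)) P) =
      compose H (adjoint_on H ip (mult_op H \<phi>)) P" if \<phi>: "\<phi> \<in> multipliers H" for \<phi>
  proof (rule extensionalityI)
    show "compose H P (compose H (adjoint_on H ip (mult_op H \<phi>)) P) \<in> extensional H"
      "compose H (adjoint_on H ip (mult_op H \<phi>)) P \<in> extensional H" by (simp_all add: compose_def)
    fix g assume g: "g \<in> H"
    obtain c where c: "P g = (\<Sum>l\<in>L. fscale (c l) (da_kernel_at l))"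
      using kernel_span_eq[OF L(2,1) PV[OF g]] by blast
    define h where "h = (\<Sum>l\<in>L. fscale (c l * cnj (\<phi> l)) (da_kernel_at l))"
    have kH: "da_kernel_at l \<in> H" if "l \<in> L" for l using kernel_H L(1) that by blast
    have hV: "h \<in> ?V" unfolding h_def by (intro cfun.span_sum cfun.span_scale cfun.span_base) simp
    have "adjoint_on H ip (mult_op H \<phi>) (P g) = h"
    proof (rule adjoint_on_eqI[OF PH[OF g]])
      show "h \<in> H" using hV VH by blast
      fix f assume f: "f \<in> H"
      have \<phi>f: "\<phi> * f \<in> H" using \<phi> f by (simp add: multipliers_def)
      have "ip (\<phi> * f) (P g) = (\<Sum>l\<in>L. cnj (c l) * ip (\<phi> * f) (da_kernel_at l))"
        unfolding c by (rule ip_sum_right) (use kH \<phi>f in auto)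
      also have "\<dots> = (\<Sum>l\<in>L. cnj (c l * cnj (\<phi> l)) * ip f (da_kernel_at l))"
        using ip_kernel[OF _ \<phi>f] ip_kernel[OF _ f] L(1) by (intro sum.cong) auto
      also have "\<dots> = ip f h"
        unfolding h_def by (rule ip_sum_right[symmetric]) (use kH f in auto)
      finally show "ip (mult_op H \<phi> f) (P g) = ip f h" using f by (simp add: mult_op_def)
    qed
    then show "compose H P (compose H (adjoint_on H ip (mult_op H \<phi>)) P) g =
        compose H (adjoint_on H ip (mult_op H \<phi>)) P g"
      using g Pid[OF hV] by (simp add: compose_def)
  qed
  ultimately have "P \<in> coinvariant_projections H ip n"
    unfolding coinvariant_projections_def using dim range by auto
  then have "P \<in> kernel_span_projections H ip n"
    unfolding kernel_span_projections_def using L range by blast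
  then show ?thesis using range by blast
qed

lemma projection_eqI:
  assumes P: "P \<in> coinvariant_projections H ip n" and Q: "Q \<in> coinvariant_projections H ip n"
    and n: "n \<ge> 1" and range: "P ` H = Q ` H"
  shows "P = Q"
proof (rule extensionalityI)
  interpret P: coinvariant_projection H ip P n using P n by unfold_locales
  interpret Q: coinvariant_projection H ip Q n using Q n by unfold_locales
  show "P \<in> extensional H" "Q \<in> extensional H"
    using P Q by (auto simp: coinvariant_projections_def bounded_operators_def PiE_def)
  fix f assume f: "f \<in> H"
  show "P f = Q f"
  proof (rule P.range_eqI)
    show "P f \<in> P ` H" "Q f \<in> P ` H" using f range by auto
    fix g assume g: "g \<in> P ` H"
    then have "g \<in> H" "P g = g" "Q g = g" using P.range_H P.P_range[OF g] Q.P_range[of g] range by auto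
    then show "ip (P f) g = ip (Q f) g" using P.P_selfadjoint[OF f] Q.P_selfadjoint[OF f] by simp
  qed
qed

lemma projection_best_approximation:
  assumes Q: "Q \<in> coinvariant_projections H ip n" "n \<ge> 1" and h: "h \<in> H"
  shows "fnorm ip (h - Q h) \<le> fnorm ip h" "y \<in> Q ` H \<Longrightarrow> fnorm ip (h - Q h) \<le> fnorm ip (h - y)"
proof -
  interpret Q: coinvariant_projection H ip Q n using Q by unfold_locales
  have le: "fnorm ip (h - Q h) \<le> fnorm ip h" if h: "h \<in> H" for h
  proof -
    have "ip h (Q h) = ip (Q h) (Q h)"
      using Q.P_selfadjoint[OF h Q.P_H[OF h]] Q.P_idem[OF h] by simp
    then have "Re (ip h (Q h)) = (fnorm ip (Q h))\<^sup>2" using norm_squared[OF Q.P_H[OF h]] by simp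
    then have "(fnorm ip (h - Q h))\<^sup>2 \<le> (fnorm ip h)\<^sup>2"
      unfolding norm_diff_squared[OF h Q.P_H[OF h]] by simp
    then show ?thesis by (rule power2_le_imp_le[OF _ norm_nonneg[OF h]])
  qed
  show "fnorm ip (h - Q h) \<le> fnorm ip h" by (rule le[OF h])
  assume y: "y \<in> Q ` H"
  then have yH: "y \<in> H" using Q.range_H by blast
  have "(h - y) - Q (h - y) = h - Q h"
    unfolding Q.P_diff[OF h yH] Q.P_range[OF y] by simp
  then show "fnorm ip (h - Q h) \<le> fnorm ip (h - y)" using le[OF H_diff[OF h yH]] by metis
qed

text \<open>
  A combination of the \<open>v i\<close> and the same combination of the \<open>w i\<close> differ by at most \<open>\<eta>\<close> times the norm of the
  first. So vectors of either range are close to the other range, and the decomposition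
  \<open>P f - Q f = P (f - Q f) + (P (Q f) - Q f)\<close> estimates the difference of the projections. The first
  summand is estimated through \<open>\<parallel>P h\<parallel>\<^sup>2 = \<langle>P h - Q (P h), h\<rangle>\<close> for \<open>h = f - Q f\<close>.
\<close>

lemma projections_close:
  assumes P: "P \<in> coinvariant_projections H ip n" and Q: "Q \<in> coinvariant_projections H ip n" and n: "n \<ge> 1"
    and v: "\<And>i. i < n \<Longrightarrow> v i \<in> P ` H" "\<And>u. u \<in> P ` H \<Longrightarrow> \<exists>c. u = (\<Sum>i<n. fscale (c i) (v i))"
    and w: "\<And>i. i < n \<Longrightarrow> w i \<in> Q ` H" "\<And>u. u \<in> Q ` H \<Longrightarrow> \<exists>c. u = (\<Sum>i<n. fscale (c i) (w i))"
    and G: "0 \<le> G" "\<And>c i. i < n \<Longrightarrow> cmod (c i) \<le> G * fnorm ip (\<Sum>i<n. fscale (c i) (v i))"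
    and close: "\<And>i. i < n \<Longrightarrow> fnorm ip (v i - w i) \<le> \<delta>" and small: "real n * G * \<delta> \<le> \<eta>" "\<eta> \<le> 1 / 2"
  shows "op_dist H ip P Q \<le> 3 * \<eta>"
proof -
  interpret P: coinvariant_projection H ip P n using P n by unfold_locales
  interpret Q: coinvariant_projection H ip Q n using Q n by unfold_locales
  have vH: "v i \<in> H" and wH: "w i \<in> H" if "i < n" for i
    using v(1)[OF that] w(1)[OF that] P.range_H Q.range_H by auto
  have \<delta>: "0 \<le> \<delta>"
    using close[of 0] norm_nonneg[OF H_diff[OF vH wH], of 0] n by fastforce
  have \<eta>0: "0 \<le> \<eta>" using small(1) G(1) \<delta> by (meson mult_nonneg_nonneg of_nat_0_le_iff order_trans)
  have vP: "(\<Sum>i<n. fscale (c i) (v i)) \<in> P ` H" for c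
    by (intro cfun.subspace_sum[OF P.range_subspace] cfun.subspace_scale[OF P.range_subspace] v(1)) simp
  have wQ: "(\<Sum>i<n. fscale (c i) (w i)) \<in> Q ` H" for c
    by (intro cfun.subspace_sum[OF Q.range_subspace] cfun.subspace_scale[OF Q.range_subspace] w(1)) simp
  have cw: "fnorm ip ((\<Sum>i<n. fscale (c i) (v i)) - (\<Sum>i<n. fscale (c i) (w i))) \<le>
      \<eta> * fnorm ip (\<Sum>i<n. fscale (c i) (v i))" for c
  proof -
    let ?v = "\<Sum>i<n. fscale (c i) (v i)"
    have v0: "0 \<le> fnorm ip ?v" using norm_nonneg vP P.range_H by blast
    have "?v - (\<Sum>i<n. fscale (c i) (w i)) = (\<Sum>i<n. fscale (c i) (v i - w i))"
      by (simp only: cfun.scale_right_diff_distrib sum_subtractf)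
    then have "fnorm ip (?v - (\<Sum>i<n. fscale (c i) (w i))) \<le> (\<Sum>i<n. cmod (c i) * fnorm ip (v i - w i))"
      using norm_sum_le[of "{..<n}" "\<lambda>i. v i - w i" c] H_diff[OF vH wH] by simp
    also have "\<dots> \<le> (\<Sum>i<n. (G * fnorm ip ?v) * \<delta>)"
      by (intro sum_mono mult_mono G(2) close norm_nonneg H_diff vH wH mult_nonneg_nonneg G(1) v0) simp_all
    also have "\<dots> = (real n * G * \<delta>) * fnorm ip ?v" by simp
    also have "\<dots> \<le> \<eta> * fnorm ip ?v" by (rule mult_right_mono[OF small(1) v0])
    finally show ?thesis .
  qed
  have A: "fnorm ip (u - Q u) \<le> \<eta> * fnorm ip u" if u: "u \<in> P ` H" for u
  proof -
    obtain c where c: "u = (\<Sum>i<n. fscale (c i) (v i))" using v(2)[OF u] by blast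
    have uH: "u \<in> H" using u P.range_H by blast
    show ?thesis using projection_best_approximation(2)[OF Q n uH wQ[of c]] cw[of c] c by simp
  qed
  have B: "fnorm ip (u - P u) \<le> 2 * \<eta> * fnorm ip u" if u: "u \<in> Q ` H" for u
  proof -
    obtain c where c: "u = (\<Sum>i<n. fscale (c i) (w i))" using w(2)[OF u] by blast
    define y where "y = (\<Sum>i<n. fscale (c i) (v i))"
    have uH: "u \<in> H" using u Q.range_H by blast
    have yP: "y \<in> P ` H" unfolding y_def by (rule vP)
    then have yH: "y \<in> H" using P.range_H by blast
    define d where "d = fnorm ip (y - u)"
    have d: "d \<le> \<eta> * fnorm ip y" using cw[of c] by (simp add: d_def y_def c)
    have d0: "0 \<le> d" unfolding d_def by (rule norm_nonneg[OF H_diff[OF yH uH]])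
    have "fnorm ip y \<le> d + fnorm ip u"
      unfolding d_def using norm_triangle[OF H_diff[OF yH uH] uH] by simp
    then have "\<eta> * fnorm ip y \<le> \<eta> * d + \<eta> * fnorm ip u"
      using mult_left_mono[OF _ \<eta>0] by (fastforce simp: distrib_left)
    moreover have "\<eta> * d \<le> (1/2) * d" by (rule mult_right_mono[OF small(2) d0])
    ultimately have "d \<le> 2 * (\<eta> * fnorm ip u)" using d by linarith
    then have "fnorm ip (u - y) \<le> 2 * \<eta> * fnorm ip u"
      using norm_diff_commute[OF uH yH] by (simp add: d_def)
    then show ?thesis using projection_best_approximation(2)[OF P n uH yP] by linarith
  qed
  show ?thesis
  proof (rule op_dist_least)
    fix f assume f: "f \<in> H" "fnorm ip f \<le> 1"
    define h where "h = f - Q f"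
    have Qf: "Q f \<in> H" "Q f \<in> Q ` H" using Q.P_H f by blast+
    have h: "h \<in> H" unfolding h_def by (rule H_diff[OF f(1) Qf(1)])
    have Ph: "P h \<in> H" "P h \<in> P ` H" using P.P_H h by blast+
    have QPh: "Q (P h) \<in> H" by (rule Q.P_H[OF Ph(1)])
    have "Q h = 0" unfolding h_def Q.P_diff[OF f(1) Qf(1)] Q.P_idem[OF f(1)] by simp
    then have "ip (Q (P h)) h = 0"
      using Q.P_selfadjoint[OF Ph(1) h] ip_zero_right[OF Ph(1)] by simp
    moreover have "ip (P h) h = ip (P h) (P h)"
      using P.P_selfadjoint[OF Ph(1) h] P.P_idem[OF h] by simp
    ultimately have "ip (P h) (P h) = ip (P h - Q (P h)) h"
      using ip_diff_left[OF Ph(1) QPh h] by simp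
    then have "(fnorm ip (P h))\<^sup>2 \<le> fnorm ip (P h - Q (P h)) * fnorm ip h"
      using Cauchy_Schwarz[OF H_diff[OF Ph(1) QPh] h] complex_Re_le_cmod[of "ip (P h) (P h)"]
      by (simp add: norm_squared[OF Ph(1)])
    also have "\<dots> \<le> (\<eta> * fnorm ip (P h)) * fnorm ip h"
      by (rule mult_right_mono[OF A[OF Ph(2)] norm_nonneg[OF h]])
    finally have *: "fnorm ip (P h) * fnorm ip (P h) \<le> fnorm ip (P h) * (\<eta> * fnorm ip h)"
      by (simp add: power2_eq_square mult_ac)
    have h1: "fnorm ip h \<le> 1"
      using projection_best_approximation(1)[OF Q n f(1)] f(2) by (simp add: h_def)
    have "fnorm ip (P h) \<le> \<eta> * fnorm ip h"
      using * norm_nonneg[OF Ph(1)] \<eta>0 norm_nonneg[OF h]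
      by (cases "fnorm ip (P h) = 0") simp_all
    then have 1: "fnorm ip (P h) \<le> \<eta>" using mult_left_mono[OF h1 \<eta>0] by simp
    have "fnorm ip (Q f) \<le> 1" using Q.norm_P_le[OF f(1)] f(2) by linarith
    then have "2 * \<eta> * fnorm ip (Q f) \<le> 2 * \<eta> * 1" by (rule mult_left_mono) (use \<eta>0 in simp)
    then have "fnorm ip (Q f - P (Q f)) \<le> 2 * \<eta>" using B[OF Qf(2)] by simp
    then have 2: "fnorm ip (P (Q f) - Q f) \<le> 2 * \<eta>"
      using norm_diff_commute[OF Qf(1) P.P_H[OF Qf(1)]] by simp
    have "P f - Q f = P h + (P (Q f) - Q f)"
      unfolding h_def P.P_diff[OF f(1) Qf(1)] by simp
    then have "fnorm ip (P f - Q f) \<le> fnorm ip (P h) + fnorm ip (P (Q f) - Q f)"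
      using norm_triangle[OF Ph(1) H_diff[OF P.P_H[OF Qf(1)] Qf(1)]] by metis
    then show "fnorm ip (P f - Q f) \<le> 3 * \<eta>" using 1 2 by linarith
  qed
qed

end


section \<open>The spectral map on spans of kernel functions\<close>

context drury_arveson
begin

lemma kernel_span_projectionE:
  assumes "P \<in> kernel_span_projections H ip n" "n \<ge> 1"
  obtains L where "P \<in> coinvariant_projections H ip n" "L \<subseteq> unit_ball" "finite L" "card L = n"
    "P ` H = cfun.span (da_kernel_at ` L)" "Psi H P = mset_set L"
proof -
  obtain L where L: "P \<in> coinvariant_projections H ip n" "L \<subseteq> unit_ball" "finite L" "card L = n"
    "P ` H = cfun.span (da_kernel_at ` L)"
    using assms(1) by (auto simp: kernel_span_projections_def)
  interpret coinvariant_projection H ip P n using L(1) assms(2) by unfold_locales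
  show thesis using that[OF L Psi_kernel_span[OF L(2-5)]] .
qed

text \<open>
  Small symmetric distance means that the points of the second set can be listed so that corresponding
  points are close. Then corresponding kernel functions are close, and so are the projections.
\<close>

theorem Psi_inverse_continuous:
  assumes P: "P \<in> kernel_span_projections H ip n" and n: "n \<ge> 1" and \<epsilon>: "\<epsilon> > 0"
  shows "\<exists>\<delta>>0. \<forall>Q\<in>kernel_span_projections H ip n.
    sym_dist (Psi H P) (Psi H Q) < \<delta> \<longrightarrow> op_dist H ip P Q < \<epsilon>"
proof -
  obtain L where L: "P \<in> coinvariant_projections H ip n" "L \<subseteq> unit_ball" "finite L" "card L = n"
    "P ` H = cfun.span (da_kernel_at ` L)" "Psi H P = mset_set L"
    by (rule kernel_span_projectionE[OF P n])
  interpret P: coinvariant_projection H ip P n using L(1) n by unfold_locales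
  obtain xs where xs: "set xs = L" "distinct xs" using finite_distinct_list[OF L(3)] by blast
  have len: "length xs = n" using distinct_card[OF xs(2)] xs(1) L(4) by simp
  have mxs: "mset xs = mset_set L" using mset_set_set[OF xs(2)] xs(1) by simp
  have xB: "xs ! i \<in> unit_ball" if "i < n" for i using nth_mem[of i xs] that len xs(1) L(2) by auto
  have inj: "inj_on (\<lambda>i. xs ! i) {..<n}" using xs(2) len by (simp add: inj_on_def nth_eq_iff_index_eq)
  obtain G where G: "G \<ge> 0"
    "\<And>c i. i < n \<Longrightarrow> cmod (c i) \<le> G * fnorm ip (\<Sum>i<n. fscale (c i) (da_kernel_at (xs ! i)))"
    using kernel_coefficients_bounded[OF xB inj] by blast
  have span: "\<exists>c. u = (\<Sum>i<n. fscale (c i) (da_kernel_at (ys ! i)))"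
    if ys: "distinct ys" "length ys = n" "set ys \<subseteq> unit_ball"
      and u: "u \<in> cfun.span (da_kernel_at ` set ys)" for ys :: "(complex ^ 'd) list" and u
  proof -
    obtain c where c: "u = (\<Sum>l\<in>set ys. fscale (c l) (da_kernel_at l))"
      using kernel_span_eq[OF finite_set ys(3) u] by blast
    have "bij_betw (\<lambda>i. ys ! i) {..<n} (set ys)" using ys(1,2) by (intro bij_betw_nth) auto
    then have "u = (\<Sum>i<n. fscale (c (ys ! i)) (da_kernel_at (ys ! i)))"
      unfolding c by (rule sum.reindex_bij_betw[symmetric])
    then show ?thesis by (intro exI[of _ "\<lambda>i. c (ys ! i)"])
  qed
  \<comment> \<open>The final estimate is \<open>3 * \<eta>\<close>, hence the bound \<open>\<epsilon> / 4\<close>; below \<open>1 / 2\<close> the perturbed kernels stay independent.\<close>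
  define \<eta> where "\<eta> = min (1 / 2) (\<epsilon> / 4)"
  have \<eta>: "0 < \<eta>" "\<eta> \<le> 1 / 2" "\<eta> \<le> \<epsilon> / 4" using \<epsilon> by (auto simp: \<eta>_def)
  \<comment> \<open>One more than the constant of the previous estimate, so that the denominator is positive.\<close>
  define \<epsilon>' where "\<epsilon>' = \<eta> / (real n * G + 1)"
  have nG: "0 < real n * G + 1" using G(1) by (intro add_nonneg_pos) auto
  then have \<epsilon>': "0 < \<epsilon>'" using \<eta>(1) by (simp add: \<epsilon>'_def)
  have small: "real n * G * \<epsilon>' \<le> \<eta>"
    using \<eta>(1) G(1) nG unfolding \<epsilon>'_def by (simp add: divide_le_eq algebra_simps)
  have "\<exists>\<delta>>0. \<forall>y\<in>unit_ball. d_ph (xs ! i) y < \<delta> \<longrightarrow> fnorm ip (da_kernel_at (xs ! i) - da_kernel_at y) < \<epsilon>'"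
    if "i < n" for i by (rule kernel_continuous[OF xB[OF that] \<epsilon>'])
  then obtain d where d: "\<And>i. i < n \<Longrightarrow> d i > 0"
    "\<And>i y. i < n \<Longrightarrow> y \<in> unit_ball \<Longrightarrow> d_ph (xs ! i) y < d i \<Longrightarrow>
      fnorm ip (da_kernel_at (xs ! i) - da_kernel_at y) < \<epsilon>'" by metis
  define \<delta> where "\<delta> = Min (d ` {..<n})"
  have fin: "finite (d ` {..<n})" "d ` {..<n} \<noteq> {}" using n by (auto simp: lessThan_empty_iff)
  have \<delta>: "\<delta> > 0" "\<And>i. i < n \<Longrightarrow> \<delta> \<le> d i"
    unfolding \<delta>_def using fin d(1) by (auto simp: Min_gr_iff)
  have "op_dist H ip P Q < \<epsilon>"
    if Q: "Q \<in> kernel_span_projections H ip n" and dist: "sym_dist (Psi H P) (Psi H Q) < \<delta>" for Q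
  proof -
    obtain M where M: "Q \<in> coinvariant_projections H ip n" "M \<subseteq> unit_ball" "finite M" "card M = n"
      "Q ` H = cfun.span (da_kernel_at ` M)" "Psi H Q = mset_set M"
      by (rule kernel_span_projectionE[OF Q n])
    interpret Q: coinvariant_projection H ip Q n using M(1) n by unfold_locales
    define r where "r = sym_dist (Psi H P) (Psi H Q)"
    have "rel_mset (\<lambda>x y. d_ph x y \<le> r) (mset_set L) (mset_set M)"
      using sym_dist_le_iff[OF P.Psi_in_sym_polyball Q.Psi_in_sym_polyball n, of r] L(6) M(6)
      by (simp add: r_def)
    then obtain xs' ys' where "mset xs' = mset_set L" "mset ys' = mset_set M"
      "list_all2 (\<lambda>x y. d_ph x y \<le> r) xs' ys'" unfolding rel_mset_def by blast
    then obtain ys where ys: "list_all2 (\<lambda>x y. d_ph x y \<le> r) xs ys" "mset ys = mset_set M"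
      using list_all2_reorder_left_invariance[of _ xs' ys' xs] mxs by auto
    have lys: "length ys = n" using list_all2_lengthD[OF ys(1)] len by simp
    have sys: "set ys = M" using arg_cong[OF ys(2), of set_mset] M(3) by simp
    have dys: "distinct ys" using M(4) sys lys by (intro card_distinct) simp
    have close: "fnorm ip (da_kernel_at (xs ! i) - da_kernel_at (ys ! i)) \<le> \<epsilon>'" if i: "i < n" for i
    proof -
      have "ys ! i \<in> unit_ball" using nth_mem[of i ys] lys i sys M(2) by blast
      moreover have "d_ph (xs ! i) (ys ! i) < d i"
        using list_all2_nthD[OF ys(1), of i] i len dist \<delta>(2)[OF i] by (simp add: r_def)
      ultimately show ?thesis using d(2)[OF i] less_imp_le by blast
    qed
    have "op_dist H ip P Q \<le> 3 * \<eta>"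
    proof (rule projections_close[OF L(1) M(1) n _ _ _ _ G close small \<eta>(2)])
      show "da_kernel_at (xs ! i) \<in> P ` H" if "i < n" for i
        unfolding L(5) using nth_mem[of i xs] that len xs(1) by (intro cfun.span_base) auto
      show "da_kernel_at (ys ! i) \<in> Q ` H" if "i < n" for i
        unfolding M(5) using nth_mem[of i ys] that lys sys by (intro cfun.span_base) auto
      show "\<exists>c. u = (\<Sum>i<n. fscale (c i) (da_kernel_at (xs ! i)))" if "u \<in> P ` H" for u
        using span[OF xs(2) len] xs(1) L(2,5) that by simp
      show "\<exists>c. u = (\<Sum>i<n. fscale (c i) (da_kernel_at (ys ! i)))" if "u \<in> Q ` H" for u
        using span[OF dys lys] sys M(2,5) that by simp
    qed
    then show ?thesis using \<eta>(3) \<epsilon> by linarith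
  qed
  then show ?thesis using \<delta>(1) by blast
qed

lemma Psi_image:
  assumes n: "n \<ge> 1"
  shows "Psi H ` kernel_span_projections H ip n = sym_polyball0 n"
proof (intro subset_antisym subsetI)
  fix X assume "X \<in> Psi H ` kernel_span_projections H ip n"
  then obtain P where P: "P \<in> kernel_span_projections H ip n" "X = Psi H P" by blast
  obtain L where "P \<in> coinvariant_projections H ip n" "L \<subseteq> unit_ball" "finite L" "card L = n"
    "P ` H = cfun.span (da_kernel_at ` L)" "Psi H P = mset_set L"
    by (rule kernel_span_projectionE[OF P(1) n])
  then show "X \<in> sym_polyball0 n"
    using P(2) by (auto simp: sym_polyball0_def sym_polyball_def)
next
  fix X :: "(complex ^ 'd) multiset" assume X: "X \<in> sym_polyball0 n"
  define L where "L = set_mset X"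
  have XL: "X = mset_set L"
    by (rule multiset_eqI) (use X in \<open>auto simp: L_def sym_polyball0_def count_mset_set' not_in_iff\<close>)
  have "size X = n" using X by (simp add: sym_polyball0_def sym_polyball_def)
  then have "card L = n" using arg_cong[OF XL, of size] by (simp only: size_mset_set)
  moreover have "L \<subseteq> unit_ball" "finite L"
    using X by (simp_all add: sym_polyball0_def sym_polyball_def L_def)
  ultimately have L: "L \<subseteq> unit_ball" "finite L" "card L = n" by simp_all
  obtain P where PL: "P \<in> kernel_span_projections H ip n" "P ` H = cfun.span (da_kernel_at ` L)"
    using projection_onto_kernel_span[OF L n] by blast
  have "P \<in> coinvariant_projections H ip n"
    using PL(1) by (simp add: kernel_span_projections_def)
  then interpret coinvariant_projection H ip P n using n by unfold_locales
  have "Psi H P = X" using Psi_kernel_span[OF L PL(2)] XL by simp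
  then show "X \<in> Psi H ` kernel_span_projections H ip n" using imageI[OF PL(1), of "Psi H"] by simp
qed

lemma Psi_inj_on:
  assumes n: "n \<ge> 1"
  shows "inj_on (Psi H) (kernel_span_projections H ip n)"
proof (rule inj_onI)
  fix P Q assume PQ: "P \<in> kernel_span_projections H ip n" "Q \<in> kernel_span_projections H ip n" "Psi H P = Psi H Q"
  obtain L where L: "P \<in> coinvariant_projections H ip n" "L \<subseteq> unit_ball" "finite L" "card L = n"
    "P ` H = cfun.span (da_kernel_at ` L)" "Psi H P = mset_set L"
    by (rule kernel_span_projectionE[OF PQ(1) n])
  obtain M where M: "Q \<in> coinvariant_projections H ip n" "M \<subseteq> unit_ball" "finite M" "card M = n"
    "Q ` H = cfun.span (da_kernel_at ` M)" "Psi H Q = mset_set M"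
    by (rule kernel_span_projectionE[OF PQ(2) n])
  have "mset_set L = mset_set M" using PQ(3) L(6) M(6) by simp
  then have "L = M" using L(3) M(3) by (simp add: mset_set_eq_iff)
  then show "P = Q" using projection_eqI[OF L(1) M(1) n] L(5) M(5) by simp
qed

end

lemma continuous_map_metric_I:
  assumes M: "Metric_space M d" and N: "Metric_space N d'"
    and f: "\<And>x. x \<in> M \<Longrightarrow> f x \<in> N"
      "\<And>x \<epsilon>. x \<in> M \<Longrightarrow> \<epsilon> > 0 \<Longrightarrow> \<exists>\<delta>>0. \<forall>y\<in>M. d x y < \<delta> \<longrightarrow> d' (f x) (f y) < \<epsilon>"
  shows "continuous_map (Metric_space.mtopology M d) (Metric_space.mtopology N d') f"
  unfolding Metric_space.metric_continuous_map[OF M N]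
proof (intro conjI ballI allI impI)
  show "f ` M \<subseteq> N" using f(1) by blast
  fix x and \<epsilon> :: real assume "x \<in> M" "\<epsilon> > 0"
  then show "\<exists>\<delta>>0. \<forall>y. y \<in> M \<and> d x y < \<delta> \<longrightarrow> d' (f x) (f y) < \<epsilon>" using f(2) by meson
qed

theorem theoremA:
  fixes H :: "(complex ^ 'd \<Rightarrow> complex) set"
    and ip :: "(complex ^ 'd \<Rightarrow> complex) \<Rightarrow> (complex ^ 'd \<Rightarrow> complex) \<Rightarrow> complex"
    and n :: nat
  assumes "drury_arveson_space H ip"
    and "n \<ge> 1"
  shows "continuous_map (projection_topology H ip n) (sym_polyball_topology n) (Psi H) \<and>
    homeomorphic_map
      (subtopology (projection_topology H ip n) (kernel_span_projections H ip n))
      (subtopology (sym_polyball_topology n) (sym_polyball0 n))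
      (Psi H)"
proof -
  interpret drury_arveson H ip by unfold_locales (rule assms(1))
  let ?C = "coinvariant_projections H ip n" and ?K = "kernel_span_projections H ip n"
  let ?S = "sym_polyball n :: (complex ^ 'd) multiset set"
  let ?D = "sym_polyball0 n :: (complex ^ 'd) multiset set"
  define dC where "dC = (\<lambda>P Q. if P \<in> ?C \<and> Q \<in> ?C then op_dist H ip P Q else 0)"
  define dS where "dS = (\<lambda>X Y. if X \<in> ?S \<and> Y \<in> ?S then sym_dist X Y else 0)"
  have MC: "Metric_space ?C dC"
    using Metric_space_coinvariant_projections[OF assms(1)] unfolding dC_def .
  have MS: "Metric_space ?S dS"
    using Metric_space_sym_polyball[OF assms(2)] unfolding dS_def .
  have tops: "projection_topology H ip n = Metric_space.mtopology ?C dC"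
    "sym_polyball_topology n = Metric_space.mtopology ?S dS"
    by (simp_all add: projection_topology_def sym_polyball_topology_def dist_topology_def dC_def dS_def)
  have KC: "?K \<subseteq> ?C" and S0S: "?D \<subseteq> ?S"
    by (auto simp: kernel_span_projections_def sym_polyball0_def)
  have subC: "Submetric ?C dC ?K" and subS: "Submetric ?S dS ?D"
    using MC MS KC S0S by (simp_all add: Submetric_def Submetric_axioms_def)
  have MK: "Metric_space ?K dC" and MS0: "Metric_space ?D dS"
    using Metric_space.subspace[OF MC KC] Metric_space.subspace[OF MS S0S] .
  have PsiS: "Psi H P \<in> ?S" if "P \<in> ?C" for P
  proof -
    interpret coinvariant_projection H ip P n using that assms(2) by unfold_locales
    show ?thesis by (rule Psi_in_sym_polyball)
  qed
  have cont: "continuous_map (projection_topology H ip n) (sym_polyball_topology n) (Psi H)"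
    unfolding tops
  proof (rule continuous_map_metric_I[OF MC MS PsiS])
    fix P and \<epsilon> :: real assume P: "P \<in> ?C" and \<epsilon>: "\<epsilon> > 0"
    show "\<exists>\<delta>>0. \<forall>Q\<in>?C. dC P Q < \<delta> \<longrightarrow> dS (Psi H P) (Psi H Q) < \<epsilon>"
      using Psi_continuous[OF P assms(2) \<epsilon>] P PsiS by (simp add: dC_def dS_def)
  qed
  define R where "R = inv_into ?K (Psi H)"
  have inj: "inj_on (Psi H) ?K" and img: "Psi H ` ?K = ?D"
    using Psi_inj_on[OF assms(2)] Psi_image[OF assms(2)] .
  have R: "R X \<in> ?K" "Psi H (R X) = X" if "X \<in> ?D" for X
    unfolding R_def using inv_into_into[of X "Psi H" ?K] f_inv_into_f[of X "Psi H" ?K] that img by simp_all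
  have contR: "continuous_map (subtopology (sym_polyball_topology n) ?D)
      (subtopology (projection_topology H ip n) ?K) R"
    unfolding tops Submetric.mtopology_submetric[OF subC, symmetric]
      Submetric.mtopology_submetric[OF subS, symmetric]
  proof (rule continuous_map_metric_I[OF MS0 MK R(1)])
    fix X and \<epsilon> :: real assume X: "X \<in> ?D" and \<epsilon>: "\<epsilon> > 0"
    obtain \<delta> where \<delta>: "\<delta> > 0" "\<And>Q. Q \<in> ?K \<Longrightarrow> sym_dist (Psi H (R X)) (Psi H Q) < \<delta> \<Longrightarrow> op_dist H ip (R X) Q < \<epsilon>"
      using Psi_inverse_continuous[OF R(1)[OF X] assms(2) \<epsilon>] by blast
    have "dC (R X) (R Y) < \<epsilon>" if "Y \<in> ?D" "dS X Y < \<delta>" for Y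
      using \<delta>(2)[OF R(1)[OF that(1)]] that X R S0S KC \<epsilon> by (auto simp: dC_def dS_def subset_iff)
    then show "\<exists>\<delta>>0. \<forall>Y\<in>?D. dS X Y < \<delta> \<longrightarrow> dC (R X) (R Y) < \<epsilon>" using \<delta>(1) by blast
  qed
  have "homeomorphic_maps (subtopology (projection_topology H ip n) ?K)
      (subtopology (sym_polyball_topology n) ?D) (Psi H) R"
    unfolding homeomorphic_maps_def
  proof (intro conjI ballI contR)
    show "continuous_map (subtopology (projection_topology H ip n) ?K)
        (subtopology (sym_polyball_topology n) ?D) (Psi H)"
      by (intro continuous_map_into_subtopology continuous_map_from_subtopology cont)
        (use img in \<open>auto simp: topspace_subtopology\<close>)
    show "R (Psi H P) = P" if "P \<in> topspace (subtopology (projection_topology H ip n) ?K)" for P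
      unfolding R_def using that by (intro inv_into_f_f[OF inj]) (simp add: topspace_subtopology)
    show "Psi H (R X) = X" if "X \<in> topspace (subtopology (sym_polyball_topology n) ?D)" for X
      using that R(2) by (simp add: topspace_subtopology)
  qed
  then show ?thesis using cont homeomorphic_maps_imp_map by blast
qed

end
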